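(* Let $n\ge2$, $m\ge1$, let $\Theta\subset\mathbf{R}^{n+1}$ be a bounded open set with $\xi_0=(0,0)\in\partial\Theta$, and let $\Theta_-:=\{(x,t)\in\Theta:t<0\}$. If $\xi_0\notin\partial\Theta_-$, which in particular holds if $\Theta_-$ is empty, then $\xi_0$ is regular for positive boundary data with respect to $\Theta$.
   Context: Points of $\mathbf{R}^{n+1}$ are $\xi=(x,t)$, $x\in\mathbf{R}^n$, $t\in\mathbf{R}$; $\nabla,\Delta$ are taken with respect to $x$ only. All functions considered are nonnegative. The equation is the porous medium equation $\partial_t u=\Delta u^m$. $A\Subset B$ means that $\overline A$ is a compact subset of $B$. Cylinders: $U_{t_1,t_2}=U\times(t_1,t_2)$ with $U\subset\mathbf{R}^n$ bounded and open, $t_1<t_2$; it is a $C^{2,\alpha}$-cylinder if $U$ is $C^{2,\alpha}$-smooth ($0<\alpha<1$). Its parabolic boundary is $\partial_pU_{t_1,t_2}=(\overline U\times\{t_1\})\cup(\partial U\times(t_1,t_2])$. Parabolic functions: $u:\Theta\to[0,\infty]$ is a weak solution in the open set $\Theta$ if for every cylinder $U_{t_1,t_2}\Subset\Theta$ we have $u\in C([t_1,t_2];L^{m+1}(U))$, $u^m\in L^2(t_1,t_2;W^{1,2}(U))$ and $\int_{t_1}^{t_2}\int_U\nabla u^m\cdot\nabla\varphi\,dx\,dt-\int_{t_1}^{t_2}\int_Uu\,\partial_t\varphi\,dx\,dt=0$ for all $\varphi\in C_0^\infty(U_{t_1,t_2})$. Continuous weak solutions are called parabolic. Superparabolic functions: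 $u:\Theta\to[0,\infty]$ is superparabolic if (i) $u$ is lower semicontinuous; (ii) $u$ is finite in a dense subset of $\Theta$; (iii) for each $C^{2,\alpha}$-cylinder $U_{t_1,t_2}\Subset\Theta$, whenever $h\in C(\overline U_{t_1,t_2})$ is parabolic in $U_{t_1,t_2}$ and $h\le u$ on $\partial_pU_{t_1,t_2}$, then $h\le u$ in $U_{t_1,t_2}$. Subparabolic: $v:\Theta\to[0,\infty)$ is upper semicontinuous and $h\ge v$ on $\partial_pU_{t_1,t_2}$ implies $h\ge v$ in $U_{t_1,t_2}$ for all such $h$ and $U_{t_1,t_2}$. Perron solutions: for $f:\partial\Theta\to[0,\infty)$ bounded, $\overline{P}f(\xi)=\inf u(\xi)$, the infimum over all superparabolic $u$ in $\Theta$ with $\liminf_{\Theta\ni\eta\to\zeta}u(\eta)\ge f(\zeta)$ for all $\zeta\in\partial\Theta$; $\underline{P}f(\xi)=\sup u(\xi)$, the supremum over all subparabolic $u$ in $\Theta$ that are bounded above and satisfy $\limsup_{\Theta\ni\eta\to\zeta}u(\eta)\le f(\zeta)$ for all $\zeta\in\partial\Theta$. Regularity: $\xi_0\in\partial\Theta$ is upper regular with respect to $\Theta$ if $\limsup_{\Theta\ni\xi\to\xi_0}\overline{P}f(\xi)\le f(\xi_0)$ for every continuous $f:\partial\Theta\to(0,\infty)$. It is lower regular for positive boundary data if $\liminf_{\Theta\ni\xi\to\xi_0}\underline{P}f(\xi)\ge f(\xi_0)$ for every continuous $f:\partial\Theta\to(0,\infty)$. It is regular for positive boundary data if it is both upper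 regular and lower regular for positive boundary data. *)

theory Defs
  imports "HOL-Analysis.Analysis"
begin

text \<open>
  Points of \<open>R^(n+1)\<close> are pairs \<open>(x, t)\<close> of type \<open>(real ^ 'n) \<times> real\<close>. Functions with values in
  \<open>[0,\<infinity>]\<close> have type \<open>ennreal\<close>, are total, and matter only on the set they are considered on.
\<close>

subsection \<open>Smooth functions and smooth domains\<close>

definition partial_deriv :: "'a::euclidean_space \<Rightarrow> ('a \<Rightarrow> real) \<Rightarrow> 'a \<Rightarrow> real" where
  "partial_deriv b f x = frechet_derivative f (at x) b"

primrec Ck :: "nat \<Rightarrow> ('a::euclidean_space \<Rightarrow> real) \<Rightarrow> bool" where
  "Ck 0 f \<longleftrightarrow> continuous_on UNIV f"
| "Ck (Suc k) f \<longleftrightarrow> (\<forall>x. f differentiable (at x)) \<and> (\<forall>b\<in>Basis. Ck k (partial_deriv b f))"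

definition test_function :: "'a::euclidean_space set \<Rightarrow> ('a \<Rightarrow> real) \<Rightarrow> bool" where
  "test_function S \<phi> \<longleftrightarrow> (\<forall>k. Ck k \<phi>) \<and>
     compact (closure {x. \<phi> x \<noteq> 0}) \<and> closure {x. \<phi> x \<noteq> 0} \<subseteq> S"

definition C2_Holder :: "real \<Rightarrow> ('a::euclidean_space \<Rightarrow> real) \<Rightarrow> bool" where
  "C2_Holder \<alpha> f \<longleftrightarrow> Ck 2 f \<and>
     (\<exists>C. \<forall>b\<in>Basis. \<forall>c\<in>Basis. \<forall>x y.
        \<bar>partial_deriv b (partial_deriv c f) x - partial_deriv b (partial_deriv c f) y\<bar>
          \<le> C * dist x y powr \<alpha>)"

text \<open>
  Near every boundary point the set is the region strictly above the graph of a \<open>C^(2,\<alpha>)\<close> function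
  in suitably rotated coordinates: \<open>e\<close> is the vertical unit vector, and \<open>x - (x \<bullet> e) e\<close> is the
  projection of \<open>x\<close> to the hyperplane orthogonal to \<open>e\<close>. The values of \<open>\<gamma>\<close> off this
  hyperplane are irrelevant (a function on the hyperplane extends constantly along \<open>e\<close>).
\<close>

definition C2_Holder_domain :: "real \<Rightarrow> 'a::euclidean_space set \<Rightarrow> bool" where
  "C2_Holder_domain \<alpha> U \<longleftrightarrow>
     (\<forall>x0\<in>frontier U. \<exists>r e \<gamma>. r > 0 \<and> norm e = 1 \<and> C2_Holder \<alpha> \<gamma> \<and>
        U \<inter> ball x0 r = {x \<in> ball x0 r. \<gamma> (x - (x \<bullet> e) *\<^sub>R e) < x \<bullet> e})"

subsection \<open>Cylinders\<close>

definition compactly_contained :: "'a::topological_space set \<Rightarrow> 'a set \<Rightarrow> bool" where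
  "compactly_contained A B \<longleftrightarrow> compact (closure A) \<and> closure A \<subseteq> B"

definition cylinder :: "'a set \<Rightarrow> real \<Rightarrow> real \<Rightarrow> ('a \<times> real) set" where
  "cylinder U t1 t2 = U \<times> {t1<..<t2}"

definition cylinder_in ::
    "('a::euclidean_space \<times> real) set \<Rightarrow> 'a set \<Rightarrow> real \<Rightarrow> real \<Rightarrow> bool" where
  "cylinder_in \<Theta> U t1 t2 \<longleftrightarrow>
     bounded U \<and> open U \<and> t1 < t2 \<and> compactly_contained (cylinder U t1 t2) \<Theta>"

definition parabolic_boundary ::
    "'a::euclidean_space set \<Rightarrow> real \<Rightarrow> real \<Rightarrow> ('a \<times> real) set" where
  "parabolic_boundary U t1 t2 = closure U \<times> {t1} \<union> frontier U \<times> {t1<..t2}"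

subsection \<open>Function spaces\<close>

definition in_Lp :: "real \<Rightarrow> 'a::euclidean_space set \<Rightarrow> ('a \<Rightarrow> 'b::euclidean_space) \<Rightarrow> bool" where
  "in_Lp p S f \<longleftrightarrow> f \<in> borel_measurable (lebesgue_on S) \<and>
     integrable (lebesgue_on S) (\<lambda>x. norm (f x) powr p)"

definition in_W12 :: 
    "'a::euclidean_space set \<Rightarrow> ('a \<Rightarrow> real) \<Rightarrow> ('a \<Rightarrow> 'a) \<Rightarrow> bool" where
  \<comment> \<open>\<open>v \<in> W^(1,2)(U)\<close> with weak gradient \<open>G\<close>\<close>
  "in_W12 U v G \<longleftrightarrow> in_Lp 2 U v \<and> in_Lp 2 U G \<and>
     (\<forall>\<phi>. test_function U \<phi> \<longrightarrow> (\<forall>b\<in>Basis.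
        (\<integral>x. v x * partial_deriv b \<phi> x \<partial>lebesgue_on U)
          = - (\<integral>x. (G x \<bullet> b) * \<phi> x \<partial>lebesgue_on U)))"

text \<open>
  \<open>v \<in> L^2(t1,t2; W^(1,2)(U))\<close> with weak spatial gradient \<open>G\<close>, using the identification of
  \<open>L^2(t1,t2; L^2(U))\<close> with the \<open>L^2\<close> space of the cylinder.
\<close>

definition in_L2_W12 ::
    "'a::euclidean_space set \<Rightarrow> real \<Rightarrow> real \<Rightarrow> ('a \<times> real \<Rightarrow> real) \<Rightarrow> ('a \<times> real \<Rightarrow> 'a) \<Rightarrow> bool" where
  "in_L2_W12 U t1 t2 v G \<longleftrightarrow>
     in_Lp 2 (cylinder U t1 t2) v \<and> in_Lp 2 (cylinder U t1 t2) G \<and>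
     (AE t in lebesgue_on {t1<..<t2}. in_W12 U (\<lambda>x. v (x, t)) (\<lambda>x. G (x, t)))"

definition in_C_Lp ::
    "real \<Rightarrow> 'a::euclidean_space set \<Rightarrow> real \<Rightarrow> real \<Rightarrow> ('a \<times> real \<Rightarrow> ennreal) \<Rightarrow> bool" where
  \<comment> \<open>\<open>u \<in> C([t1,t2]; L^p(U))\<close>\<close>
  "in_C_Lp p U t1 t2 u \<longleftrightarrow>
     (\<forall>t\<in>{t1..t2}. (AE x in lebesgue_on U. u (x, t) < \<infinity>) \<and>
        in_Lp p U (\<lambda>x. enn2real (u (x, t))) \<and>
        ((\<lambda>s. \<integral>x. \<bar>enn2real (u (x, s)) - enn2real (u (x, t))\<bar> powr p \<partial>lebesgue_on U)
           \<longlongrightarrow> 0) (at t within {t1..t2}))"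

subsection \<open>Parabolic, superparabolic and subparabolic functions\<close>

definition spatial_grad :: "((real ^ 'n) \<times> real \<Rightarrow> real) \<Rightarrow> (real ^ 'n) \<times> real \<Rightarrow> real ^ 'n" where
  "spatial_grad \<phi> \<xi> = (\<chi> i. partial_deriv (axis i 1, 0) \<phi> \<xi>)"

definition time_deriv :: "((real ^ 'n) \<times> real \<Rightarrow> real) \<Rightarrow> (real ^ 'n) \<times> real \<Rightarrow> real" where
  "time_deriv \<phi> \<xi> = partial_deriv (0, 1) \<phi> \<xi>"

definition weak_solution ::
    "real \<Rightarrow> ((real ^ 'n) \<times> real) set \<Rightarrow> ((real ^ 'n) \<times> real \<Rightarrow> ennreal) \<Rightarrow> bool" where
  "weak_solution m \<Theta> u \<longleftrightarrow>
     (\<forall>U t1 t2. cylinder_in \<Theta> U t1 t2 \<longrightarrow>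
        in_C_Lp (m + 1) U t1 t2 u \<and>
        (\<exists>G. in_L2_W12 U t1 t2 (\<lambda>\<xi>. enn2real (u \<xi>) powr m) G \<and>
           (\<forall>\<phi>. test_function (cylinder U t1 t2) \<phi> \<longrightarrow>
              (\<integral>\<xi>. G \<xi> \<bullet> spatial_grad \<phi> \<xi> \<partial>lebesgue_on (cylinder U t1 t2))
              - (\<integral>\<xi>. enn2real (u \<xi>) * time_deriv \<phi> \<xi> \<partial>lebesgue_on (cylinder U t1 t2)) = 0)))"

definition parabolic ::
    "real \<Rightarrow> ((real ^ 'n) \<times> real) set \<Rightarrow> ((real ^ 'n) \<times> real \<Rightarrow> ennreal) \<Rightarrow> bool" where
  "parabolic m \<Theta> u \<longleftrightarrow> weak_solution m \<Theta> u \<and> continuous_on \<Theta> u"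

definition comparison_function ::
    "real \<Rightarrow> (real ^ 'n) set \<Rightarrow> real \<Rightarrow> real \<Rightarrow> ((real ^ 'n) \<times> real \<Rightarrow> ennreal) \<Rightarrow> bool" where
  \<comment> \<open>\<open>h\<close> is a finite continuous function on the closed cylinder, parabolic in the open one\<close>
  "comparison_function m U t1 t2 h \<longleftrightarrow>
     continuous_on (closure (cylinder U t1 t2)) h \<and>
     (\<forall>\<xi>\<in>closure (cylinder U t1 t2). h \<xi> < \<infinity>) \<and>
     parabolic m (cylinder U t1 t2) h"

definition lsc_on :: "'a::topological_space set \<Rightarrow> ('a \<Rightarrow> ennreal) \<Rightarrow> bool" where
  "lsc_on S u \<longleftrightarrow> (\<forall>x\<in>S. u x \<le> Liminf (at x within S) u)"

definition usc_on :: "'a::topological_space set \<Rightarrow> ('a \<Rightarrow> ennreal) \<Rightarrow> bool" where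
  "usc_on S u \<longleftrightarrow> (\<forall>x\<in>S. Limsup (at x within S) u \<le> u x)"

definition superparabolic ::
    "real \<Rightarrow> real \<Rightarrow> ((real ^ 'n) \<times> real) set \<Rightarrow> ((real ^ 'n) \<times> real \<Rightarrow> ennreal) \<Rightarrow> bool" where
  "superparabolic m \<alpha> \<Theta> u \<longleftrightarrow>
     lsc_on \<Theta> u \<and>
     \<Theta> \<subseteq> closure {\<xi>\<in>\<Theta>. u \<xi> < \<infinity>} \<and>
     (\<forall>U t1 t2 h. cylinder_in \<Theta> U t1 t2 \<and> C2_Holder_domain \<alpha> U \<and>
        comparison_function m U t1 t2 h \<and> (\<forall>\<xi>\<in>parabolic_boundary U t1 t2. h \<xi> \<le> u \<xi>) \<longrightarrow>
        (\<forall>\<xi>\<in>cylinder U t1 t2. h \<xi> \<le> u \<xi>))"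

definition subparabolic ::
    "real \<Rightarrow> real \<Rightarrow> ((real ^ 'n) \<times> real) set \<Rightarrow> ((real ^ 'n) \<times> real \<Rightarrow> ennreal) \<Rightarrow> bool" where
  "subparabolic m \<alpha> \<Theta> v \<longleftrightarrow>
     (\<forall>\<xi>\<in>\<Theta>. v \<xi> < \<infinity>) \<and>
     usc_on \<Theta> v \<and>
     (\<forall>U t1 t2 h. cylinder_in \<Theta> U t1 t2 \<and> C2_Holder_domain \<alpha> U \<and>
        comparison_function m U t1 t2 h \<and> (\<forall>\<xi>\<in>parabolic_boundary U t1 t2. v \<xi> \<le> h \<xi>) \<longrightarrow>
        (\<forall>\<xi>\<in>cylinder U t1 t2. v \<xi> \<le> h \<xi>))"

subsection \<open>Perron solutions and boundary regularity\<close>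

definition upper_perron ::
    "real \<Rightarrow> real \<Rightarrow> ((real ^ 'n) \<times> real) set \<Rightarrow> ((real ^ 'n) \<times> real \<Rightarrow> real)
      \<Rightarrow> (real ^ 'n) \<times> real \<Rightarrow> ennreal" where
  "upper_perron m \<alpha> \<Theta> f \<xi> =
     (INF u\<in>{u. superparabolic m \<alpha> \<Theta> u \<and>
               (\<forall>\<zeta>\<in>frontier \<Theta>. ennreal (f \<zeta>) \<le> Liminf (at \<zeta> within \<Theta>) u)}. u \<xi>)"

definition lower_perron ::
    "real \<Rightarrow> real \<Rightarrow> ((real ^ 'n) \<times> real) set \<Rightarrow> ((real ^ 'n) \<times> real \<Rightarrow> real)
      \<Rightarrow> (real ^ 'n) \<times> real \<Rightarrow> ennreal" where
  "lower_perron m \<alpha> \<Theta> f \<xi> =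
     (SUP u\<in>{u. subparabolic m \<alpha> \<Theta> u \<and> (\<exists>C::real. \<forall>\<eta>\<in>\<Theta>. u \<eta> \<le> ennreal C) \<and>
               (\<forall>\<zeta>\<in>frontier \<Theta>. Limsup (at \<zeta> within \<Theta>) u \<le> ennreal (f \<zeta>))}. u \<xi>)"

definition upper_regular ::
    "real \<Rightarrow> real \<Rightarrow> ((real ^ 'n) \<times> real) set \<Rightarrow> (real ^ 'n) \<times> real \<Rightarrow> bool" where
  "upper_regular m \<alpha> \<Theta> \<xi>0 \<longleftrightarrow>
     (\<forall>f. continuous_on (frontier \<Theta>) f \<and> (\<forall>\<zeta>\<in>frontier \<Theta>. 0 < f \<zeta>) \<longrightarrow>
        Limsup (at \<xi>0 within \<Theta>) (upper_perron m \<alpha> \<Theta> f) \<le> ennreal (f \<xi>0))"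

definition lower_regular_positive ::
    "real \<Rightarrow> real \<Rightarrow> ((real ^ 'n) \<times> real) set \<Rightarrow> (real ^ 'n) \<times> real \<Rightarrow> bool" where
  "lower_regular_positive m \<alpha> \<Theta> \<xi>0 \<longleftrightarrow>
     (\<forall>f. continuous_on (frontier \<Theta>) f \<and> (\<forall>\<zeta>\<in>frontier \<Theta>. 0 < f \<zeta>) \<longrightarrow>
        ennreal (f \<xi>0) \<le> Liminf (at \<xi>0 within \<Theta>) (lower_perron m \<alpha> \<Theta> f))"

definition regular_positive ::
    "real \<Rightarrow> real \<Rightarrow> ((real ^ 'n) \<times> real) set \<Rightarrow> (real ^ 'n) \<times> real \<Rightarrow> bool" where
  "regular_positive m \<alpha> \<Theta> \<xi>0 \<longleftrightarrow> upper_regular m \<alpha> \<Theta> \<xi>0 \<and> lower_regular_positive m \<alpha> \<Theta> \<xi>0"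

definition past_part :: "('a \<times> real) set \<Rightarrow> ('a \<times> real) set" where
  "past_part \<Theta> = {(x, t) \<in> \<Theta>. t < 0}"

end

theory Submission
  imports Defs
begin

text \<open>
  Near the origin \<open>\<Theta>\<close> lies in \<open>t > 0\<close>. Hence the explicit classical super- and subsolutions
  \<open>(a + \<beta>|x|\<^sup>2 + K t)\<^bsup>1/m\<^esup>\<close> and \<open>A exp (- \<beta>|x|\<^sup>2 - K t)\<close>, truncated by constants, are barriers:
  with \<open>t\<close> replaced by \<open>|t|\<close> they are constant at distance \<open>\<ge> r\<close> from the origin, and a cylinder
  in \<open>\<Theta>\<close> that reaches below \<open>t = 0\<close> stays in that region.

  What remains is to compare a continuous weak solution \<open>h\<close> with a positive classical super- or
  subsolution \<open>\<phi>\<close>. Let \<open>z = h - \<phi>\<close> and \<open>w = h\<^sup>m - \<phi>\<^sup>m = a z\<close> (signs reversed for a subsolution), where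
  \<open>a\<close> is bounded and bounded away from \<open>0\<close>; then \<open>\<integral> z \<partial>\<^sub>t\<eta> + w \<Delta>\<eta> \<ge> 0\<close> for test functions \<open>\<eta> \<ge> 0\<close>. By
  duality it suffices to solve the backward problem \<open>\<partial>\<^sub>t\<psi> + a \<Delta>\<psi> = - g\<close> approximately, where \<open>a\<close> is
  merely measurable. We discretise \<open>\<partial>\<^sub>t\<close> and \<open>\<Delta>\<close> by differences of sizes \<open>\<tau>\<close> and \<open>\<epsilon>\<close>: the scheme is explicit
  and positive, and its energy estimate bounds the discrete Laplacian of \<open>\<psi>\<close> in \<open>L\<^sup>2\<close> independently of
  \<open>\<epsilon>\<close>. The test function is \<open>\<psi>\<close> mollified at scale \<open>\<delta>\<close>; first \<open>\<epsilon> \<rightarrow> 0\<close> and then \<open>\<delta> \<rightarrow> 0\<close>.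
  No cut-off is needed, as the terms outside the domain of the scheme have a sign.
\<close>

subsection \<open>Test functions and mollifiers\<close>

text \<open>The equation degenerates where \<open>h\<close> vanishes, but a difference quotient of
  \<open>s \<mapsto> s^m\<close> is bounded below through the larger of its two arguments, so a
  positive lower bound for \<phi> suffices. Here positivity of the boundary data enters: the lower
  barrier may be cut off at a positive constant. Strict inequality on the parabolic boundary gives
  \<open>z \<le> - \<kappa>\<close> in a collar. Outside the domain of the scheme \<psi> is zero,
  yet the differences see its values inside: the time difference then contributes at most -
  \<kappa>/\<tau> times the value of \<psi> one step later, the discrete Laplacian at most a
  multiple of 1/\<epsilon>^2 times it. So \<tau> is a small multiple of \<epsilon>^2. Since
  \<open>a\<close> is only measurable, no smoothness of \<psi> is available. Passing from
  derivatives of the mollified \<psi> to differences costs an error that depends on \<psi> only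
  through its L1 norm, so \<epsilon> may be chosen after \<delta>. Averages of
  \<open>w = a z\<close> differ from \<open>a\<close> times averages of \<open>z\<close> by a
  quantity that is small with \<delta>, uniformly, because \<open>z\<close> and \<open>w\<close> are
  uniformly continuous; it multiplies the discrete Laplacian of \<psi>, for which the L2 bound is
  enough.\<close>

lemma partial_deriv_eqI:
  "(f has_derivative f') (at x) \<Longrightarrow> partial_deriv b f x = f' b"
  unfolding partial_deriv_def by (metis frechet_derivative_at)

lemma has_derivative_partial_deriv:
  fixes f :: "'a::euclidean_space \<Rightarrow> real"
  assumes "f differentiable (at x)"
  shows "(f has_derivative (\<lambda>v. \<Sum>b\<in>Basis. (v \<bullet> b) * partial_deriv b f x)) (at x)"
proof -
  have d: "(f has_derivative frechet_derivative f (at x)) (at x)"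
    using assms frechet_derivative_works by blast
  interpret linear "frechet_derivative f (at x)"
    using d has_derivative_linear by blast
  have "frechet_derivative f (at x) v = (\<Sum>b\<in>Basis. (v \<bullet> b) * partial_deriv b f x)" for v
  proof -
    have "frechet_derivative f (at x) v = frechet_derivative f (at x) (\<Sum>b\<in>Basis. (v \<bullet> b) *\<^sub>R b)"
      by (simp add: euclidean_representation)
    then show ?thesis by (simp add: sum scale partial_deriv_def)
  qed
  then show ?thesis using d by presburger
qed

lemma has_real_derivative_along:
  fixes f :: "'a::euclidean_space \<Rightarrow> real"
  assumes "f differentiable (at (x + s *\<^sub>R b))"
  shows "((\<lambda>s. f (x + s *\<^sub>R b)) has_real_derivative partial_deriv b f (x + s *\<^sub>R b)) (at s)"
proof -
  have d: "(f has_derivative frechet_derivative f (at (x + s *\<^sub>R b))) (at (x + s *\<^sub>R b))"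
    using assms frechet_derivative_works by blast
  have "((\<lambda>s. x + s *\<^sub>R b) has_derivative (\<lambda>h. h *\<^sub>R b)) (at s)"
    by (auto intro!: derivative_eq_intros)
  from diff_chain_at[OF this d]
  have "((\<lambda>s. f (x + s *\<^sub>R b)) has_derivative
      (\<lambda>h. frechet_derivative f (at (x + s *\<^sub>R b)) (h *\<^sub>R b))) (at s)"
    by (simp add: o_def)
  moreover have "frechet_derivative f (at (x + s *\<^sub>R b)) (h *\<^sub>R b)
      = h * partial_deriv b f (x + s *\<^sub>R b)" for h
    using linear_frechet_derivative[OF assms] by (simp add: linear_scale partial_deriv_def)
  ultimately show ?thesis
    by (simp add: has_field_derivative_def mult.commute[of _ "partial_deriv b f _"])
qed

text \<open>Coinduction: a class of differentiable functions that is closed under partial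
  derivatives consists of smooth functions, with no formula for higher derivatives. It serves the
  bump functions and the mollified functions, each time with a class made for the purpose.\<close>

lemma Ck_coinduct:
  assumes "f \<in> S"
    and "\<And>g x. g \<in> S \<Longrightarrow> g differentiable (at x)"
    and "\<And>g b. g \<in> S \<Longrightarrow> b \<in> Basis \<Longrightarrow> partial_deriv b g \<in> S"
  shows "Ck k f"
  using assms(1)
proof (induction k arbitrary: f)
  case 0
  then show ?case
    using assms(2) by (auto simp: continuous_on_eq_continuous_at intro: differentiable_imp_continuous_within)
next
  case (Suc k)
  then show ?case using assms(2,3) by simp
qed

lemma Ck_imp_continuous_on: "Ck k f \<Longrightarrow> continuous_on UNIV f"
  by (cases k) (auto simp: continuous_on_eq_continuous_at intro: differentiable_imp_continuous_within)

lemma zero_off_support: "\<xi> \<notin> closure {x. \<phi> x \<noteq> 0} \<Longrightarrow> \<phi> \<xi> = 0"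
  using closure_subset[of "{x. \<phi> x \<noteq> 0}"] by blast

lemma partial_deriv_zero_off_support:
  fixes \<phi> :: "'a::euclidean_space \<Rightarrow> real"
  assumes "\<xi> \<notin> closure {x. \<phi> x \<noteq> 0}"
  shows "partial_deriv b \<phi> \<xi> = 0"
proof -
  have "\<forall>\<^sub>F x in nhds \<xi>. x \<in> - closure {x. \<phi> x \<noteq> 0}"
    using assms by (intro eventually_nhds_in_open) auto
  then have "\<forall>\<^sub>F x in nhds \<xi>. 0 = \<phi> x"
    by (rule eventually_mono) (use zero_off_support in force)
  then have "(\<phi> has_derivative (\<lambda>_. 0)) (at \<xi>)"
    using has_derivative_transform_eventually[of "\<lambda>_. 0" "\<lambda>_. 0" \<xi> UNIV \<phi>]
      zero_off_support[OF assms]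
    by (simp add: eventually_nhds_conv_at)
  then show ?thesis by (rule partial_deriv_eqI)
qed

lemma test_function_partial_deriv:
  assumes "test_function S \<phi>" "b \<in> Basis"
  shows "test_function S (partial_deriv b \<phi>)"
proof -
  have "closure {x. partial_deriv b \<phi> x \<noteq> 0} \<subseteq> closure {x. \<phi> x \<noteq> 0}"
    by (intro closure_minimal) (use partial_deriv_zero_off_support in auto)
  moreover have "\<forall>k. Ck k (partial_deriv b \<phi>)"
  proof
    fix k have "Ck (Suc k) \<phi>" using assms by (auto simp only: test_function_def)
    then show "Ck k (partial_deriv b \<phi>)" using assms(2) by simp
  qed
  ultimately show ?thesis
    using assms unfolding test_function_def
    by (meson bounded_subset closed_closure compact_eq_bounded_closed order_trans)
qed

lemma test_function_differentiable: "test_function S \<phi> \<Longrightarrow> \<phi> differentiable (at x)"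
  unfolding test_function_def by (auto dest: spec[of _ "Suc 0"])

lemma test_function_continuous: "test_function S \<phi> \<Longrightarrow> continuous_on A \<phi>"
  unfolding test_function_def using Ck_imp_continuous_on continuous_on_subset by blast

lemma test_function_measurable: "test_function S \<phi> \<Longrightarrow> \<phi> \<in> borel_measurable borel"
  by (intro borel_measurable_continuous_onI test_function_continuous)

lemma test_function_bounded:
  assumes "test_function S \<phi>"
  obtains C where "C > 0" "\<And>x. \<bar>\<phi> x\<bar> \<le> C"
proof -
  let ?K = "closure {x. \<phi> x \<noteq> 0}"
  have "compact (\<phi> ` ?K)"
    using assms by (intro compact_continuous_image test_function_continuous[OF assms])
      (auto simp: test_function_def)
  then obtain C where C: "\<forall>y\<in>\<phi> ` ?K. norm y \<le> C"
    using compact_imp_bounded bounded_iff by blast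
  have "\<bar>\<phi> x\<bar> \<le> max C 1" for x
    using C zero_off_support[of x \<phi>] by (cases "x \<in> ?K") (force, simp)
  then show ?thesis using that[of "max C 1"] by auto
qed

lemma test_function_uniformly_continuous:
  assumes "test_function S \<phi>"
  shows "uniformly_continuous_on UNIV \<phi>"
  unfolding uniformly_continuous_on_def
proof (intro allI impI)
  fix e :: real assume "e > 0"
  let ?K = "closure {x. \<phi> x \<noteq> 0}"
  \<comment> \<open>\<open>L\<close> is the support fattened by 1. Two points at distance less than
    1 either both lie in the compact set \<open>L\<close>, where \<phi> is uniformly continuous, or
    both lie off the support, where it vanishes.\<close>
  define L where "L = {x + y |x y. x \<in> ?K \<and> y \<in> cball 0 1}"
  have "compact L" unfolding L_def using assms by (intro compact_sums) (auto simp: test_function_def)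
  then have "uniformly_continuous_on L \<phi>"
    by (intro compact_uniformly_continuous test_function_continuous[OF assms])
  then obtain d where d: "d > 0" "\<And>x y. x \<in> L \<Longrightarrow> y \<in> L \<Longrightarrow> dist y x < d \<Longrightarrow> dist (\<phi> y) (\<phi> x) < e"
    using \<open>e > 0\<close> by (elim uniformly_continuous_onE) blast+
  have sub: "y \<in> L" if "x \<in> ?K" "dist y x < 1" for x y
  proof -
    have "y = x + (y - x) \<and> x \<in> ?K \<and> y - x \<in> cball 0 1" using that by (simp add: dist_norm norm_minus_commute)
    then show ?thesis unfolding L_def by blast
  qed
  have "dist (\<phi> y) (\<phi> x) < e" if "dist y x < min d 1" for x y
  proof (cases "x \<in> ?K \<or> y \<in> ?K")
    case True
    moreover have "dist x y < 1" "dist y x < 1" "dist x x < 1" "dist y y < 1"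
      using that by (auto simp: dist_commute)
    ultimately have "x \<in> L \<and> y \<in> L" using sub by blast
    then show ?thesis using d that by auto
  next
    case False
    then show ?thesis using zero_off_support[of x \<phi>] zero_off_support[of y \<phi>] \<open>e > 0\<close> by simp
  qed
  then show "\<exists>d>0. \<forall>x\<in>UNIV. \<forall>x'\<in>UNIV. dist x' x < d \<longrightarrow> dist (\<phi> x') (\<phi> x) < e"
    using d(1) by (intro exI[of _ "min d 1"]) auto
qed

section \<open>Smooth bump functions\<close>

text \<open>\<open>k = 0\<close> is the classical smooth function that is flat at the origin. The
  powers of 1/s make the family closed, up to linear combinations, under differentiation and under
  difference quotients at 0.\<close>

definition flat_exp :: "nat \<Rightarrow> real \<Rightarrow> real" where
  "flat_exp k s = (if s > 0 then (1/s)^k * exp (- (1/s)) else 0)"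

lemma flat_exp_tendsto_0: "(flat_exp k \<longlongrightarrow> 0) (at 0)"
proof -
  have l: "((\<lambda>s. flat_exp k s) \<longlongrightarrow> 0) (at_right 0)"
  proof -
    have "((\<lambda>y::real. y^k / exp y) \<longlongrightarrow> 0) at_top" by (rule tendsto_power_div_exp_0)
    then have "((\<lambda>s::real. (inverse s)^k / exp (inverse s)) \<longlongrightarrow> 0) (at_right 0)"
      using filterlim_compose filterlim_inverse_at_top_right by blast
    moreover have "\<forall>\<^sub>F s in at_right (0::real). (inverse s)^k / exp (inverse s) = flat_exp k s"
      unfolding flat_exp_def eventually_at_right_field
      by (intro exI[of _ 1]) (auto simp: exp_minus field_simps)
    ultimately show ?thesis using tendsto_cong by fastforce
  qed
  have "\<forall>\<^sub>F s in at_left (0::real). 0 = flat_exp k s"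
    unfolding flat_exp_def eventually_at_left_field by (intro exI[of _ "-1"]) auto
  then have "((\<lambda>s. flat_exp k s) \<longlongrightarrow> 0) (at_left 0)"
    using tendsto_cong by fastforce
  with l show ?thesis by (simp add: filterlim_at_split)
qed

lemma flat_exp_has_derivative:
  "(flat_exp k has_real_derivative (flat_exp (k + 2) s - real k * flat_exp (k + 1) s)) (at s)"
proof -
  consider "s > 0" | "s < 0" | "s = 0" by linarith
  then show ?thesis
  proof cases
    case 1
    have i: "((\<lambda>s. 1 / s) has_real_derivative - ((1/s) * (1/s))) (at s)"
      using DERIV_inverse[of s] 1 by (simp add: divide_inverse power2_eq_square)
    have "((\<lambda>s. (1/s)^k * exp (- (1/s))) has_real_derivative
        of_nat k * (- (1 / s * (1 / s)) * (1 / s) ^ (k - Suc 0)) * exp (- (1 / s)) +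
        exp (- (1 / s)) * (- (- (1 / s * (1 / s)))) * (1 / s) ^ k) (at s)"
      by (rule DERIV_mult[OF DERIV_power[OF i, of k] DERIV_fun_exp[OF DERIV_minus[OF i]]])
    moreover have "of_nat k * (- (1 / s * (1 / s)) * (1 / s) ^ (k - Suc 0)) * exp (- (1 / s)) +
        exp (- (1 / s)) * (- (- (1 / s * (1 / s)))) * (1 / s) ^ k
        = flat_exp (k + 2) s - real k * flat_exp (k + 1) s"
    \<comment> \<open>The power rule carries the truncated exponent \<open>k - Suc 0\<close>, so
      \<open>k = 0\<close> is separated.\<close>
    proof (cases k)
      case (Suc j)
      have "real (Suc j) * (- (y * y) * y ^ j) * E + E * (- (- (y * y))) * y ^ Suc j
          = y ^ (Suc j + 2) * E - real (Suc j) * (y ^ (Suc j + 1) * E)" for y E :: real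
        by (simp add: algebra_simps)
      from this[of "1/s" "exp (- (1/s))"] show ?thesis unfolding flat_exp_def Suc using 1
        by (simp only: if_True diff_Suc_Suc diff_zero)
    qed (use 1 in \<open>simp add: flat_exp_def\<close>)
    moreover have "\<forall>\<^sub>F x in nhds s. (1/x)^k * exp (- (1/x)) = flat_exp k x"
      using eventually_nhds_in_open[of "{0<..}" s] 1
      by (auto elim!: eventually_mono simp: flat_exp_def)
    ultimately show ?thesis by (metis DERIV_cong_ev)
  next
    case 2
    have "\<forall>\<^sub>F x in nhds s. 0 = flat_exp k x"
      using eventually_nhds_in_open[of "{..<0}" s] 2
      by (auto elim!: eventually_mono simp: flat_exp_def)
    moreover have "((\<lambda>x. 0) has_real_derivative 0) (at s)" by simp
    ultimately show ?thesis using 2 DERIV_cong_ev[of s s "\<lambda>x. 0" "flat_exp k" 0 0]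
      by (simp add: flat_exp_def)
  next
    case 3
    \<comment> \<open>At 0 the difference quotient of one member is the next member, so the
      derivative there is the limit from \<open>flat_exp_tendsto_0\<close>.\<close>
    have "(\<lambda>h. (flat_exp k (0 + h) - flat_exp k 0) / h) = flat_exp (Suc k)"
      by (auto simp: flat_exp_def fun_eq_iff)
    then show ?thesis
      using 3 flat_exp_tendsto_0[of "Suc k"] by (simp add: DERIV_def flat_exp_def)
  qed
qed

text \<open>The smallest class that contains the radial bumps and is visibly closed under partial
  derivatives: by the chain rule a derivative of a bump is a coordinate times other bumps.
  \<open>r\<close> is the square of the radius of the supporting ball.\<close>

inductive_set bump_class :: "real \<Rightarrow> ('a::euclidean_space \<Rightarrow> real) set" for r where
  base: "(\<lambda>x. flat_exp k (r - x \<bullet> x)) \<in> bump_class r"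
| add: "f \<in> bump_class r \<Longrightarrow> g \<in> bump_class r \<Longrightarrow> (\<lambda>x. f x + g x) \<in> bump_class r"
| scale: "f \<in> bump_class r \<Longrightarrow> (\<lambda>x. c * f x) \<in> bump_class r"
| coord: "f \<in> bump_class r \<Longrightarrow> (\<lambda>x. (x \<bullet> b) * f x) \<in> bump_class r"

lemma bump_class_derivative:
  assumes "f \<in> bump_class r"
  shows "(\<forall>x. f differentiable (at x)) \<and> (\<forall>b. partial_deriv b f \<in> bump_class r)"
  using assms
proof induction
  case (base k)
  have d: "((\<lambda>x. flat_exp k (r - x \<bullet> x)) has_derivative
      (\<lambda>h. -2 * (x \<bullet> h) * (flat_exp (k + 2) (r - x \<bullet> x) - real k * flat_exp (k + 1) (r - x \<bullet> x)))) (at x)"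
    for x :: 'a
  proof -
    have "((\<lambda>x. r - x \<bullet> x) has_derivative (\<lambda>h. - 2 * (x \<bullet> h))) (at x)"
      by (auto intro!: derivative_eq_intros simp: inner_commute)
    from diff_chain_at[OF this, OF flat_exp_has_derivative[unfolded has_field_derivative_def]]
    show ?thesis by (simp add: o_def mult.commute)
  qed
  have "(\<lambda>x. (-2) * ((x \<bullet> b) * (flat_exp (k + 2) (r - x \<bullet> x) + (- real k) * flat_exp (k + 1) (r - x \<bullet> x))))
      \<in> bump_class r" for b :: 'a
    by (intro bump_class.intros)
  moreover have "partial_deriv b (\<lambda>x::'a. flat_exp k (r - x \<bullet> x))
    = (\<lambda>x. (-2) * ((x \<bullet> b) * (flat_exp (k + 2) (r - x \<bullet> x) + (- real k) * flat_exp (k + 1) (r - x \<bullet> x))))" for b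
    by (rule ext, subst partial_deriv_eqI[OF d]) (simp add: algebra_simps)
  ultimately show ?case using d by (auto simp: differentiable_def)
next
  case (add f g)
  have "partial_deriv b (\<lambda>x. f x + g x) = (\<lambda>x. partial_deriv b f x + partial_deriv b g x)" for b
    by (rule ext, rule partial_deriv_eqI[where f' = "\<lambda>h. frechet_derivative f (at x) h + frechet_derivative g (at x) h" for x, THEN trans])
      (use add in \<open>auto simp: partial_deriv_def intro!: has_derivative_add simp flip: frechet_derivative_works\<close>)
  then show ?case using add by (auto intro: bump_class.intros)
next
  case (scale f c)
  have "partial_deriv b (\<lambda>x. c * f x) = (\<lambda>x. c * partial_deriv b f x)" for b
    by (rule ext, rule partial_deriv_eqI[where f' = "\<lambda>h. c * frechet_derivative f (at x) h" for x, THEN trans])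
      (use scale in \<open>auto simp: partial_deriv_def intro!: has_derivative_mult_right simp flip: frechet_derivative_works\<close>)
  then show ?case using scale by (auto intro: bump_class.intros)
next
  case (coord f c)
  have d: "((\<lambda>x. (x \<bullet> c) * f x) has_derivative
     (\<lambda>h. (x \<bullet> c) * frechet_derivative f (at x) h + (h \<bullet> c) * f x)) (at x)" for x
    by (intro has_derivative_mult has_derivative_inner_left has_derivative_ident)
      (use coord in \<open>auto simp flip: frechet_derivative_works\<close>)
  have "partial_deriv b (\<lambda>x. (x \<bullet> c) * f x) = (\<lambda>x. (x \<bullet> c) * partial_deriv b f x + (b \<bullet> c) * f x)" for b
    by (rule ext, subst partial_deriv_eqI[OF d]) (simp add: partial_deriv_def)
  moreover have "(\<lambda>x. (x \<bullet> c) * partial_deriv b f x + (b \<bullet> c) * f x) \<in> bump_class r" for b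
    using coord by (intro bump_class.intros) auto
  ultimately show ?case using d by (auto simp: differentiable_def)
qed

lemma mollifier_exists:
  assumes "d > 0"
  obtains \<rho> :: "'a::euclidean_space \<Rightarrow> real" where "test_function (cball 0 d) \<rho>" "\<And>x. 0 \<le> \<rho> x"
    "integrable lborel \<rho>" "(\<integral>x. \<rho> x \<partial>lborel) = 1"
proof -
  define f :: "'a \<Rightarrow> real" where "f = (\<lambda>x. flat_exp 0 (d\<^sup>2 - x \<bullet> x))"
  have f0: "0 \<le> f x" for x by (simp add: f_def flat_exp_def)
  have fpos: "f x > 0 \<longleftrightarrow> norm x < d" for x
    using assms by (auto simp: f_def flat_exp_def dot_square_norm abs_square_less_1 power2_less_imp_less
        intro: power_strict_mono)
  have supp: "closure {x. c * f x \<noteq> 0} \<subseteq> cball 0 d" for c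
    by (rule closure_minimal) (use fpos f0 in \<open>auto simp: less_le\<close>)
  have comp: "compact (closure {x. c * f x \<noteq> 0})" for c
    using supp[of c] by (meson bounded_cball bounded_subset closed_closure compact_eq_bounded_closed)
  have test: "test_function (cball 0 d) (\<lambda>x. c * f x)" for c
  proof -
    have "(\<lambda>x. c * f x) \<in> bump_class (d\<^sup>2)" unfolding f_def by (intro bump_class.intros)
    then have "Ck k (\<lambda>x. c * f x)" for k
      by (rule Ck_coinduct) (use bump_class_derivative in auto)
    then show ?thesis using supp comp by (auto simp: test_function_def)
  qed
  have test1: "test_function (cball 0 d) f" using test[of 1] by simp
  have contf: "continuous_on A f" for A by (rule test_function_continuous[OF test1])
  have "integrable lborel (\<lambda>x. indicator (cball 0 d) x *\<^sub>R f x)"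
    using borel_integrable_compact[OF compact_cball contf] by simp
  moreover have "(\<lambda>x. indicator (cball 0 d) x *\<^sub>R f x) = f"
    using fpos f0 by (auto simp: fun_eq_iff indicator_def less_le)
  ultimately have int: "integrable lborel f" by simp
  have "integral\<^sup>L lborel f > 0"
  proof (rule ccontr)
    assume "\<not> ?thesis"
    moreover have "integral\<^sup>L lborel f \<ge> 0" using f0 by simp
    ultimately have "integral\<^sup>L lborel f = 0" by linarith
    then have "AE x in lborel. f x = 0"
      using integral_nonneg_eq_0_iff_AE[OF int] f0 by simp
    then have "AE x in lborel. x \<notin> ball (0::'a) d"
      by eventually_elim (use fpos in \<open>metis less_irrefl mem_ball_0\<close>)
    then have "ball (0::'a) d \<in> null_sets lborel"
      by (subst AE_iff_null_sets) auto
    then have "negligible (ball (0::'a) d)"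
      using null_sets_completionI negligible_iff_null_sets by blast
    then show False using open_not_negligible[of "ball (0::'a) d"] assms by auto
  qed
  then show ?thesis
    using that[of "\<lambda>x. inverse (integral\<^sup>L lborel f) * f x"] test f0 int by simp
qed

section \<open>Uniform Taylor expansions of test functions\<close>

lemma finite_common_bound:
  fixes P :: "'b \<Rightarrow> real \<Rightarrow> bool"
  assumes "finite B" "\<And>b. b \<in> B \<Longrightarrow> \<exists>d>0. P b d"
    and mono: "\<And>b d d'. P b d \<Longrightarrow> 0 < d' \<Longrightarrow> d' \<le> d \<Longrightarrow> P b d'"
  shows "\<exists>d>0. \<forall>b\<in>B. P b d"
  using assms(1,2)
proof (induction B rule: finite_induct)
  case empty
  show ?case by (intro exI[of _ 1]) simp
next
  case (insert b B)
  obtain d where d: "d > 0" "\<forall>b\<in>B. P b d" using insert by auto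
  obtain d' where d': "d' > 0" "P b d'" using insert.prems by auto
  have "\<forall>c\<in>insert b B. P c (min d d')"
    using d d' mono[of _ d "min d d'"] mono[of _ d' "min d d'"] by auto
  then show ?case using d d' by (intro exI[of _ "min d d'"]) auto
qed

lemma partial_deriv_sum_Basis:
  fixes f :: "'a::euclidean_space \<Rightarrow> real"
  assumes "f differentiable (at x)"
  shows "partial_deriv v f x = (\<Sum>b\<in>Basis. (v \<bullet> b) * partial_deriv b f x)"
  by (rule partial_deriv_eqI[OF has_derivative_partial_deriv[OF assms]])

text \<open>The mean value theorem along the segment turns the remainder into an increment of the
  gradient, and uniform continuity of the gradient makes the threshold \<open>d\<close> independent
  of \<open>x\<close>. This independence is what allows the expansion of a kernel to be
  integrated.\<close>

lemma test_function_uniform_derivative: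
  fixes \<phi> :: "'a::euclidean_space \<Rightarrow> real"
  assumes t: "test_function S \<phi>" and "e > 0"
  shows "\<exists>d>0. \<forall>x v. norm v < d \<longrightarrow>
    \<bar>\<phi> (x + v) - \<phi> x - (\<Sum>b\<in>Basis. (v \<bullet> b) * partial_deriv b \<phi> x)\<bar> \<le> e * norm v"
proof -
  define e' where "e' = e / real DIM('a)"
  have e': "e' > 0" using \<open>e > 0\<close> by (simp add: e'_def)
  have "\<exists>d>0. \<forall>b\<in>Basis. \<forall>x y. norm (y - x) < d \<longrightarrow> \<bar>partial_deriv b \<phi> y - partial_deriv b \<phi> x\<bar> \<le> e'"
  proof (rule finite_common_bound)
    fix b :: 'a assume "b \<in> Basis"
    then have "uniformly_continuous_on UNIV (partial_deriv b \<phi>)"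
      using test_function_uniformly_continuous test_function_partial_deriv t by blast
    then obtain d where "d > 0"
      "\<And>x y. dist y x < d \<Longrightarrow> dist (partial_deriv b \<phi> y) (partial_deriv b \<phi> x) < e'"
      using e' by (elim uniformly_continuous_onE) auto
    then show "\<exists>d>0. \<forall>x y. norm (y - x) < d \<longrightarrow> \<bar>partial_deriv b \<phi> y - partial_deriv b \<phi> x\<bar> \<le> e'"
      by (intro exI[of _ d]) (auto simp: dist_norm intro: less_imp_le)
  qed auto
  then obtain d where d: "d > 0"
    "\<And>b x y. b \<in> Basis \<Longrightarrow> norm (y - x) < d \<Longrightarrow> \<bar>partial_deriv b \<phi> y - partial_deriv b \<phi> x\<bar> \<le> e'"
    by blast
  have "\<bar>\<phi> (x + v) - \<phi> x - (\<Sum>b\<in>Basis. (v \<bullet> b) * partial_deriv b \<phi> x)\<bar> \<le> e * norm v"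
    if v: "norm v < d" for x v
  proof -
    have "\<exists>s>0. s < 1 \<and> \<phi> (x + 1 *\<^sub>R v) - \<phi> (x + 0 *\<^sub>R v) = (1 - 0) * partial_deriv v \<phi> (x + s *\<^sub>R v)"
      by (intro MVT2) (auto intro!: has_real_derivative_along test_function_differentiable[OF t] simp del: scaleR_one scaleR_zero_left)
    then obtain s where s: "0 < s" "s < 1" "\<phi> (x + v) - \<phi> x = partial_deriv v \<phi> (x + s *\<^sub>R v)"
      by auto
    have n: "norm (x + s *\<^sub>R v - x) < d"
      using s v mult_left_le_one_le[of "norm v" s] by simp
    have "\<phi> (x + v) - \<phi> x - (\<Sum>b\<in>Basis. (v \<bullet> b) * partial_deriv b \<phi> x)
       = (\<Sum>b\<in>Basis. (v \<bullet> b) * (partial_deriv b \<phi> (x + s *\<^sub>R v) - partial_deriv b \<phi> x))"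
      unfolding s(3) partial_deriv_sum_Basis[OF test_function_differentiable[OF t], of v]
      by (simp add: sum_subtractf right_diff_distrib)
    also have "\<bar>\<dots>\<bar> \<le> (\<Sum>b\<in>(Basis::'a set). norm v * e')"
      by (intro order_trans[OF sum_abs] sum_mono)
        (simp add: abs_mult mult_mono Basis_le_norm d(2)[OF _ n])
    also have "\<dots> = e * norm v" by (simp add: e'_def)
    finally show ?thesis .
  qed
  then show ?thesis using d(1) by blast
qed

text \<open>The difference quotient is centred at \<open>y\<close> while the derivative is taken at
  \<open>x\<close>, because the scheme evaluates its space differences one time step later.\<close>

lemma test_function_second_difference:
  fixes \<phi> :: "'a::euclidean_space \<Rightarrow> real"
  assumes t: "test_function S \<phi>" and b: "b \<in> Basis" and "e > 0"
  shows "\<exists>d>0. \<forall>h x y. 0 < h \<longrightarrow> h < d \<longrightarrow> norm (y - x) < d \<longrightarrow>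
    \<bar>(\<phi> (y + h *\<^sub>R b) + \<phi> (y - h *\<^sub>R b) - 2 * \<phi> y) / h\<^sup>2
      - partial_deriv b (partial_deriv b \<phi>) x\<bar> \<le> e"
proof -
  let ?p = "partial_deriv b \<phi>" let ?q = "partial_deriv b ?p"
  have tp: "test_function S ?p" and tq: "test_function S ?q"
    using t b test_function_partial_deriv by blast+
  obtain d where d: "d > 0" "\<And>x y. dist y x < d \<Longrightarrow> dist (?q y) (?q x) < e"
    using test_function_uniformly_continuous[OF tq] \<open>e > 0\<close> by (elim uniformly_continuous_onE) auto
  have "\<bar>(\<phi> (y + h *\<^sub>R b) + \<phi> (y - h *\<^sub>R b) - 2 * \<phi> y) / h\<^sup>2 - ?q x\<bar> \<le> e"
    if h: "0 < h" "h < d / 2" "norm (y - x) < d / 2" for h x y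
  proof -
    \<comment> \<open>With this \<open>Q\<close> the function
      \<open>s \<mapsto> \<phi>(y + s b) + \<phi>(y - s b) - s^2 Q\<close> takes the value
      \<open>2 \<phi>(y)\<close> at both 0 and \<open>h\<close>, so its derivative vanishes in
      between; a second use of the mean value theorem, now for the first derivative, identifies
      \<open>Q\<close> with a value of the second derivative.\<close>
    define Q where "Q = (\<phi> (y + h *\<^sub>R b) + \<phi> (y - h *\<^sub>R b) - 2 * \<phi> y) / h\<^sup>2"
    have D: "((\<lambda>s. \<phi> (y + s *\<^sub>R b)) has_real_derivative ?p (y + s *\<^sub>R b)) (at s)"
      "((\<lambda>s. ?p (y + s *\<^sub>R b)) has_real_derivative ?q (y + s *\<^sub>R b)) (at s)" for s
      by (intro has_real_derivative_along test_function_differentiable[OF t] test_function_differentiable[OF tp])+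
    have Dm: "((\<lambda>s. \<phi> (y - s *\<^sub>R b)) has_real_derivative - ?p (y - s *\<^sub>R b)) (at s)" for s
      using DERIV_chain2[OF D(1)[of "-s"] DERIV_minus[OF DERIV_ident]] by simp
    have "\<exists>s>0. s < h \<and> (\<phi> (y + h *\<^sub>R b) + \<phi> (y - h *\<^sub>R b) - h\<^sup>2 * Q)
        - (\<phi> (y + 0 *\<^sub>R b) + \<phi> (y - 0 *\<^sub>R b) - 0\<^sup>2 * Q)
       = (h - 0) * (?p (y + s *\<^sub>R b) - ?p (y - s *\<^sub>R b) - 2 * s * Q)"
      by (intro MVT2[OF h(1)]) (auto intro!: derivative_eq_intros D Dm)
    moreover have "(\<phi> (y + h *\<^sub>R b) + \<phi> (y - h *\<^sub>R b) - h\<^sup>2 * Q)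
        - (\<phi> (y + 0 *\<^sub>R b) + \<phi> (y - 0 *\<^sub>R b) - 0\<^sup>2 * Q) = 0"
      using h(1) by (simp add: Q_def)
    ultimately obtain s where s: "0 < s" "s < h" "?p (y + s *\<^sub>R b) - ?p (y - s *\<^sub>R b) = 2 * s * Q"
      using h(1) by auto
    have "\<exists>r>-s. r < s \<and> ?p (y + s *\<^sub>R b) - ?p (y + (-s) *\<^sub>R b) = (s - (-s)) * ?q (y + r *\<^sub>R b)"
      using s(1) by (intro MVT2) (auto intro!: D)
    then obtain r where r: "-s < r" "r < s" "Q = ?q (y + r *\<^sub>R b)"
      using s by auto
    have "dist (y + r *\<^sub>R b) x \<le> \<bar>r\<bar> + norm (y - x)"
      using norm_triangle_ineq[of "r *\<^sub>R b" "y - x"] b by (simp add: dist_norm algebra_simps)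
    also have "\<dots> < d" using r s h by linarith
    finally have "\<bar>Q - ?q x\<bar> \<le> e" using d(2) r(3) by (force simp: dist_real_def)
    then show ?thesis by (simp add: Q_def)
  qed
  then show ?thesis using d(1) by (intro exI[of _ "d / 2"]) auto
qed

section \<open>Bounded measurable functions of bounded support\<close>

text \<open>A class inside L1 that is closed under sums, products, translations and multiplication
  by bounded measurable functions, so that integrability in the scheme can be read off from the
  shape of the integrand. Continuity is left out because the dual solution is only
  measurable.\<close>

definition bounded_supp :: "('a::euclidean_space \<Rightarrow> real) \<Rightarrow> bool" where
  "bounded_supp f \<longleftrightarrow> f \<in> borel_measurable borel \<and> bounded (range f) \<and> bounded {x. f x \<noteq> 0}"

lemma bounded_suppI:
  assumes "f \<in> borel_measurable borel" "\<And>x. \<bar>f x\<bar> \<le> C" "bounded A" "\<And>x. x \<notin> A \<Longrightarrow> f x = 0"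
  shows "bounded_supp f"
  unfolding bounded_supp_def
proof (intro conjI)
  show "bounded (range f)" using assms(2) by (auto simp: bounded_iff)
  show "bounded {x. f x \<noteq> 0}" using assms(3) by (rule bounded_subset) (use assms(4) in auto)
qed fact

lemma bounded_suppE:
  assumes "bounded_supp f"
  obtains C A where "C > 0" "\<And>x. \<bar>f x\<bar> \<le> C" "bounded A" "\<And>x. x \<notin> A \<Longrightarrow> f x = 0" "f \<in> borel_measurable borel"
proof -
  obtain C where "C > 0" "\<forall>y\<in>range f. norm y \<le> C"
    using assms unfolding bounded_supp_def by (meson bounded_pos)
  then show ?thesis
    using assms by (intro that[of C "{x. f x \<noteq> 0}"]) (auto simp: bounded_supp_def)
qed

lemma bounded_supp_integrable:
  assumes "bounded_supp f" shows "integrable lborel f"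
proof -
  obtain C A where A: "C > 0" "\<And>x. \<bar>f x\<bar> \<le> C" "bounded A" "\<And>x. x \<notin> A \<Longrightarrow> f x = 0"
    and m: "f \<in> borel_measurable borel" by (rule bounded_suppE[OF assms]) (rule that)
  obtain c d where cd: "A \<subseteq> cbox c d" using A(3) bounded_subset_cbox_symmetric by meson
  show ?thesis
  proof (rule Bochner_Integration.integrable_bound)
    show "integrable lborel (\<lambda>x. C * indicator (cbox c d) x :: real)"
      by (intro integrable_mult_right integrable_real_indicator) (use emeasure_lborel_cbox_finite in \<open>auto simp: top.not_eq_extremum\<close>)
    show "AE x in lborel. norm (f x) \<le> norm (C * indicator (cbox c d) x :: real)"
      using A cd by (intro AE_I2) (auto simp: indicator_def)
  qed (use m in simp)
qed

lemma bounded_supp_mult: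
  assumes "bounded_supp f" "g \<in> borel_measurable borel" "\<And>x. \<bar>g x\<bar> \<le> C"
  shows "bounded_supp (\<lambda>x. f x * g x)"
proof -
  obtain C' A where A: "C' > 0" "\<And>x. \<bar>f x\<bar> \<le> C'" "bounded A" "\<And>x. x \<notin> A \<Longrightarrow> f x = 0"
    and m: "f \<in> borel_measurable borel" by (rule bounded_suppE[OF assms(1)]) (rule that)
  show ?thesis
    by (rule bounded_suppI[of _ "C' * C" A])
      (use A assms m in \<open>auto simp: abs_mult intro!: mult_mono less_imp_le[OF A(1)]\<close>)
qed

lemma bounded_supp_mult':
  assumes "bounded_supp f" "bounded_supp g"
  shows "bounded_supp (\<lambda>x. f x * g x)"
  by (rule bounded_suppE[OF assms(2)]) (rule bounded_supp_mult[OF assms(1)])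

lemma bounded_supp_add:
  assumes "bounded_supp f" "bounded_supp g"
  shows "bounded_supp (\<lambda>x. f x + g x)"
proof -
  obtain C A where A: "C > 0" "\<And>x. \<bar>f x\<bar> \<le> C" "bounded A" "\<And>x. x \<notin> A \<Longrightarrow> f x = 0"
    and m: "f \<in> borel_measurable borel" by (rule bounded_suppE[OF assms(1)]) (rule that)
  obtain D B where B: "D > 0" "\<And>x. \<bar>g x\<bar> \<le> D" "bounded B" "\<And>x. x \<notin> B \<Longrightarrow> g x = 0"
    and m': "g \<in> borel_measurable borel" by (rule bounded_suppE[OF assms(2)]) (rule that)
  show ?thesis
  proof (rule bounded_suppI[of _ "C + D" "A \<union> B"])
    show "\<bar>f x + g x\<bar> \<le> C + D" for x using A(2)[of x] B(2)[of x] by linarith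
  qed (use A B m m' in auto)
qed

lemma bounded_supp_0: "bounded_supp (\<lambda>x. 0)"
  by (rule bounded_suppI[of _ 0 "{}"]) auto

lemma bounded_supp_cmult: "bounded_supp f \<Longrightarrow> bounded_supp (\<lambda>x. c * f x)"
  using bounded_supp_mult[of f "\<lambda>x. c" "\<bar>c\<bar>"] by (simp add: mult.commute)

lemma bounded_supp_diff:
  "bounded_supp f \<Longrightarrow> bounded_supp g \<Longrightarrow> bounded_supp (\<lambda>x. f x - g x)"
  using bounded_supp_add[of f "\<lambda>x. (-1) * g x"] bounded_supp_cmult[of g "-1"] by simp

lemma bounded_supp_sum:
  "finite I \<Longrightarrow> (\<And>i. i \<in> I \<Longrightarrow> bounded_supp (f i)) \<Longrightarrow> bounded_supp (\<lambda>x. \<Sum>i\<in>I. f i x)"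
  by (induction I rule: finite_induct) (auto intro: bounded_supp_0 bounded_supp_add)

lemma bounded_supp_translate:
  assumes "bounded_supp f" shows "bounded_supp (\<lambda>x. f (x + v))"
proof -
  obtain C A where A: "C > 0" "\<And>x. \<bar>f x\<bar> \<le> C" "bounded A" "\<And>x. x \<notin> A \<Longrightarrow> f x = 0"
    and m: "f \<in> borel_measurable borel" by (rule bounded_suppE[OF assms(1)]) (rule that)
  show ?thesis
  proof (rule bounded_suppI[of _ C "(\<lambda>x. - v + x) ` A"])
    show "(\<lambda>x. f (x + v)) \<in> borel_measurable borel" using m by measurable
    show "f (x + v) = 0" if "x \<notin> (\<lambda>x. - v + x) ` A" for x
      using that by (intro A(4)) (force simp: image_iff)
    show "bounded ((\<lambda>x. - v + x) ` A)" by (rule bounded_translation[OF A(3)])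
  qed (use A in auto)
qed

lemma test_function_bounded_supp: "test_function S \<phi> \<Longrightarrow> bounded_supp \<phi>"
proof -
  assume t: "test_function S \<phi>"
  then obtain C where C: "\<And>x. \<bar>\<phi> x\<bar> \<le> C" using test_function_bounded by blast
  show "bounded_supp \<phi>"
  proof (rule bounded_suppI[OF test_function_measurable[OF t] C])
    show "bounded (closure {x. \<phi> x \<noteq> 0})" using t by (simp add: test_function_def compact_imp_bounded)
  qed (rule zero_off_support)
qed

lemma integral_translate:
  fixes f :: "'a::euclidean_space \<Rightarrow> real"
  assumes "f \<in> borel_measurable borel"
  shows "(\<integral>x. f (x + v) \<partial>lborel) = (\<integral>x. f x \<partial>lborel)"
proof -
  have "(\<integral>x. f x \<partial>lborel) = (\<integral>x. f x \<partial>distr lborel borel ((+) v))"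
    by (simp add: lborel_distr_plus)
  also have "\<dots> = (\<integral>x. f (v + x) \<partial>lborel)"
    using assms by (intro integral_distr) auto
  finally show ?thesis by (simp add: add.commute)
qed

section \<open>Mollification\<close>

definition mollify :: "('a::euclidean_space \<Rightarrow> real) \<Rightarrow> ('a \<Rightarrow> real) \<Rightarrow> 'a \<Rightarrow> real" where
  "mollify \<rho> \<psi> \<xi> = (\<integral>\<zeta>. \<psi> \<zeta> * \<rho> (\<xi> - \<zeta>) \<partial>lborel)"

lemma mollify_integrable:
  assumes "bounded_supp \<psi>" "test_function S \<rho>"
  shows "integrable lborel (\<lambda>\<zeta>. \<psi> \<zeta> * \<rho> (\<xi> - \<zeta>))"
proof -
  obtain C where C: "\<And>x. \<bar>\<rho> x\<bar> \<le> C" using test_function_bounded[OF assms(2)] by metis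
  have "(\<lambda>\<zeta>. \<rho> (\<xi> - \<zeta>)) \<in> borel_measurable borel"
    using test_function_measurable[OF assms(2)] by measurable
  then show ?thesis using C by (intro bounded_supp_integrable bounded_supp_mult[OF assms(1)])
qed

text \<open>Error estimates for mollified functions pass through this bound: a uniform estimate for
  the kernel \<open>f\<close> becomes one that depends on \<psi> only through its L1 norm.\<close>

lemma mollify_bound:
  assumes "bounded_supp \<psi>" "integrable lborel (\<lambda>\<zeta>. \<psi> \<zeta> * f \<zeta>)" "\<And>\<zeta>. \<bar>f \<zeta>\<bar> \<le> e"
  shows "\<bar>\<integral>\<zeta>. \<psi> \<zeta> * f \<zeta> \<partial>lborel\<bar> \<le> e * (\<integral>\<zeta>. \<bar>\<psi> \<zeta>\<bar> \<partial>lborel)"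
proof -
  have "\<bar>\<integral>\<zeta>. \<psi> \<zeta> * f \<zeta> \<partial>lborel\<bar> \<le> (\<integral>\<zeta>. \<bar>\<psi> \<zeta> * f \<zeta>\<bar> \<partial>lborel)" by (rule integral_abs_bound)
  also have "\<dots> \<le> (\<integral>\<zeta>. e * \<bar>\<psi> \<zeta>\<bar> \<partial>lborel)"
  proof (rule integral_mono)
    show "integrable lborel (\<lambda>\<zeta>. \<bar>\<psi> \<zeta> * f \<zeta>\<bar>)" using assms(2) by (rule integrable_abs)
    show "integrable lborel (\<lambda>\<zeta>. e * \<bar>\<psi> \<zeta>\<bar>)"
      using bounded_supp_integrable[OF assms(1)] by (intro integrable_mult_right integrable_abs)
    show "\<bar>\<psi> \<zeta> * f \<zeta>\<bar> \<le> e * \<bar>\<psi> \<zeta>\<bar>" for \<zeta>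
      using mult_right_mono[OF assms(3)[of \<zeta>], of "\<bar>\<psi> \<zeta>\<bar>"] by (simp add: abs_mult mult.commute)
  qed
  finally show ?thesis by simp
qed

lemma mollify_has_derivative:
  fixes \<psi> :: "'a::euclidean_space \<Rightarrow> real"
  assumes \<psi>: "bounded_supp \<psi>" and t: "test_function S \<rho>"
  shows "(mollify \<rho> \<psi> has_derivative
    (\<lambda>v. \<Sum>b\<in>Basis. (v \<bullet> b) * mollify (partial_deriv b \<rho>) \<psi> \<xi>)) (at \<xi>)"
  unfolding has_derivative_at_alt
proof (intro conjI allI impI)
  show "bounded_linear (\<lambda>v. \<Sum>b\<in>Basis. (v \<bullet> b) * mollify (partial_deriv b \<rho>) \<psi> \<xi>)"
    by (intro bounded_linear_sum bounded_linear_mult_const bounded_linear_inner_left)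
  fix e :: real assume "e > 0"
  define I where "I = (\<integral>\<zeta>. \<bar>\<psi> \<zeta>\<bar> \<partial>lborel)"
  have I: "I \<ge> 0" by (simp add: I_def)
  \<comment> \<open>The \<open>+ 1\<close> covers the case \<open>I = 0\<close>.\<close>
  obtain d where d: "d > 0" "\<And>x v. norm v < d \<Longrightarrow>
    \<bar>\<rho> (x + v) - \<rho> x - (\<Sum>b\<in>Basis. (v \<bullet> b) * partial_deriv b \<rho> x)\<bar> \<le> e / (I + 1) * norm v"
    using test_function_uniform_derivative[OF t, of "e / (I + 1)"] \<open>e > 0\<close> I by auto
  have "norm (mollify \<rho> \<psi> y - mollify \<rho> \<psi> \<xi> - (\<Sum>b\<in>Basis. ((y - \<xi>) \<bullet> b) * mollify (partial_deriv b \<rho>) \<psi> \<xi>))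
      \<le> e * norm (y - \<xi>)" if y: "norm (y - \<xi>) < d" for y
  proof -
    let ?f = "\<lambda>\<zeta>. \<rho> ((\<xi> - \<zeta>) + (y - \<xi>)) - \<rho> (\<xi> - \<zeta>)
      - (\<Sum>b\<in>Basis. ((y - \<xi>) \<bullet> b) * partial_deriv b \<rho> (\<xi> - \<zeta>))"
    have int: "integrable lborel (\<lambda>\<zeta>. \<psi> \<zeta> * \<rho> (y - \<zeta>))" "integrable lborel (\<lambda>\<zeta>. \<psi> \<zeta> * \<rho> (\<xi> - \<zeta>))"
      "\<And>b. b \<in> Basis \<Longrightarrow> integrable lborel (\<lambda>\<zeta>. \<psi> \<zeta> * partial_deriv b \<rho> (\<xi> - \<zeta>))"
      using mollify_integrable[OF \<psi>] t test_function_partial_deriv by blast+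
    have eq: "(\<lambda>\<zeta>. \<psi> \<zeta> * ?f \<zeta>) = (\<lambda>\<zeta>. \<psi> \<zeta> * \<rho> (y - \<zeta>) - \<psi> \<zeta> * \<rho> (\<xi> - \<zeta>)
        - (\<Sum>b\<in>Basis. ((y - \<xi>) \<bullet> b) * (\<psi> \<zeta> * partial_deriv b \<rho> (\<xi> - \<zeta>))))"
      by (auto simp: fun_eq_iff algebra_simps sum_distrib_left)
    have i: "integrable lborel (\<lambda>\<zeta>. \<psi> \<zeta> * ?f \<zeta>)"
      unfolding eq using int by (intro Bochner_Integration.integrable_diff integrable_sum integrable_mult_right) auto
    have "mollify \<rho> \<psi> y - mollify \<rho> \<psi> \<xi> - (\<Sum>b\<in>Basis. ((y - \<xi>) \<bullet> b) * mollify (partial_deriv b \<rho>) \<psi> \<xi>)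
      = (\<integral>\<zeta>. \<psi> \<zeta> * ?f \<zeta> \<partial>lborel)"
      unfolding mollify_def eq using int
      by (subst Bochner_Integration.integral_diff Bochner_Integration.integral_sum | simp)+
    also have "\<bar>\<dots>\<bar> \<le> (e / (I + 1) * norm (y - \<xi>)) * I"
      unfolding I_def by (intro mollify_bound \<psi> i d(2)[OF y, unfolded I_def])
    also have "\<dots> \<le> e * norm (y - \<xi>)"
      using I \<open>e > 0\<close> by (simp add: field_simps mult_left_mono)
    finally show ?thesis by simp
  qed
  then show "\<exists>d>0. \<forall>y. norm (y - \<xi>) < d \<longrightarrow> norm (mollify \<rho> \<psi> y - mollify \<rho> \<psi> \<xi> -
      (\<Sum>b\<in>Basis. ((y - \<xi>) \<bullet> b) * mollify (partial_deriv b \<rho>) \<psi> \<xi>)) \<le> e * norm (y - \<xi>)"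
    using d(1) by blast
qed

lemma partial_deriv_mollify:
  assumes "bounded_supp \<psi>" "test_function S \<rho>" "b \<in> Basis"
  shows "partial_deriv b (mollify \<rho> \<psi>) = mollify (partial_deriv b \<rho>) \<psi>"
proof
  fix \<xi>
  have "(\<Sum>c\<in>Basis. (b \<bullet> c) * mollify (partial_deriv c \<rho>) \<psi> \<xi>) = mollify (partial_deriv b \<rho>) \<psi> \<xi>"
    using assms(3) by (subst sum.remove[of _ b]) (auto simp: inner_Basis sum.neutral)
  then show "partial_deriv b (mollify \<rho> \<psi>) \<xi> = mollify (partial_deriv b \<rho>) \<psi> \<xi>"
    using partial_deriv_eqI[OF mollify_has_derivative[OF assms(1,2), of \<xi>], of b] by simp
qed

text \<open>Derivatives fall on the kernel, so \<psi> may be merely bounded and measurable; the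
  support grows by \<delta>, and \<open>S\<close> has to make room for this.\<close>

lemma test_function_mollify:
  assumes \<psi>: "bounded_supp \<psi>" and t: "test_function (cball 0 \<delta>) \<rho>"
    and K: "compact K" "\<And>\<zeta>. \<zeta> \<notin> K \<Longrightarrow> \<psi> \<zeta> = 0"
    and S: "\<And>\<xi> \<zeta>. \<zeta> \<in> K \<Longrightarrow> dist \<xi> \<zeta> \<le> \<delta> \<Longrightarrow> \<xi> \<in> S"
  shows "test_function S (mollify \<rho> \<psi>)"
proof -
  define L where "L = {x + y |x y. x \<in> K \<and> y \<in> cball 0 \<delta>}"
  have L: "compact L" unfolding L_def using K by (intro compact_sums) auto
  have LS: "L \<subseteq> S"
  proof
    fix x assume "x \<in> L"
    then obtain k y where "x = k + y" "k \<in> K" "y \<in> cball 0 \<delta>" unfolding L_def by blast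
    then show "x \<in> S" using S[of k x] by (simp add: dist_norm)
  qed
  have "mollify \<rho> \<psi> \<xi> = 0" if "\<xi> \<notin> L" for \<xi>
  proof -
    have "\<psi> \<zeta> * \<rho> (\<xi> - \<zeta>) = 0" for \<zeta>
    proof (cases "\<zeta> \<in> K")
      case True
      have "\<xi> - \<zeta> \<notin> cball 0 \<delta>"
      proof
        assume "\<xi> - \<zeta> \<in> cball 0 \<delta>"
        with True have "\<zeta> + (\<xi> - \<zeta>) \<in> L" unfolding L_def by blast
        then show False using that by simp
      qed
      then have "\<rho> (\<xi> - \<zeta>) = 0" using t zero_off_support[of "\<xi> - \<zeta>" \<rho>] unfolding test_function_def by blast
      then show ?thesis by simp
    qed (use K in simp)
    then show ?thesis unfolding mollify_def by (simp only: Bochner_Integration.integral_zero)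
  qed
  then have "closure {x. mollify \<rho> \<psi> x \<noteq> 0} \<subseteq> L"
    by (intro closure_minimal) (use L in \<open>auto simp: compact_imp_closed\<close>)
  moreover from this L have "compact (closure {x. mollify \<rho> \<psi> x \<noteq> 0})"
    by (meson bounded_subset closed_closure compact_eq_bounded_closed)
  moreover have "Ck k (mollify \<rho> \<psi>)" for k
  \<comment> \<open>The class for the coinduction consists of the mollifications of the fixed \<psi>
    by all test kernels with support in the same ball.\<close>
  proof (rule Ck_coinduct[where S = "{mollify \<rho> \<psi> |\<rho>. test_function (cball 0 \<delta>) \<rho>}"])
    show "mollify \<rho> \<psi> \<in> {mollify \<rho> \<psi> |\<rho>. test_function (cball 0 \<delta>) \<rho>}" using t by blast
    show "g differentiable (at x)" if "g \<in> {mollify \<rho> \<psi> |\<rho>. test_function (cball 0 \<delta>) \<rho>}" for g x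
      using that mollify_has_derivative[OF \<psi>] unfolding differentiable_def by blast
    show "partial_deriv b g \<in> {mollify \<rho> \<psi> |\<rho>. test_function (cball 0 \<delta>) \<rho>}"
      if "g \<in> {mollify \<rho> \<psi> |\<rho>. test_function (cball 0 \<delta>) \<rho>}" "b \<in> Basis" for g b
      using that partial_deriv_mollify[OF \<psi>] test_function_partial_deriv by blast
  qed
  ultimately show ?thesis using LS unfolding test_function_def by blast
qed

text \<open>Fubini moves the mollification from \<psi> to \<open>z\<close>, where it acts with the
  reflected kernel. Since convolution commutes with translations, the identity may carry a shift
  \<open>v\<close>; this lets it be combined into identities for difference operators.\<close>

lemma integral_mult_mollify:
  fixes z \<psi> :: "'a::euclidean_space \<Rightarrow> real"
  assumes z: "bounded_supp z" and \<psi>: "bounded_supp \<psi>" and t: "test_function S \<rho>"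
  shows "(\<integral>\<xi>. z \<xi> * mollify \<rho> \<psi> (\<xi> + v) \<partial>lborel) = (\<integral>\<zeta>. (\<integral>\<xi>. z \<xi> * \<rho> (\<xi> - \<zeta>) \<partial>lborel) * \<psi> (\<zeta> + v) \<partial>lborel)"
    "bounded_supp (\<lambda>\<xi>. z \<xi> * mollify \<rho> \<psi> (\<xi> + v))"
    "integrable lborel (\<lambda>\<zeta>. (\<integral>\<xi>. z \<xi> * \<rho> (\<xi> - \<zeta>) \<partial>lborel) * \<psi> (\<zeta> + v))"
proof -
  have m\<rho>: "\<rho> \<in> borel_measurable borel" by (rule test_function_measurable[OF t])
  have m\<psi>: "\<psi> \<in> borel_measurable borel" using \<psi> by (simp add: bounded_supp_def)
  have mz: "z \<in> borel_measurable borel" using z by (simp add: bounded_supp_def)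
  define \<psi>' where "\<psi>' = (\<lambda>\<zeta>. \<psi> (\<zeta> + v))"
  have \<psi>': "bounded_supp \<psi>'" unfolding \<psi>'_def by (rule bounded_supp_translate[OF \<psi>])
  have m\<psi>': "\<psi>' \<in> borel_measurable borel" using \<psi>' by (simp add: bounded_supp_def)
  have shift: "mollify \<rho> \<psi> (\<xi> + v) = mollify \<rho> \<psi>' \<xi>" for \<xi>
    unfolding mollify_def \<psi>'_def
    using integral_translate[of "\<lambda>\<zeta>. \<psi> \<zeta> * \<rho> (\<xi> + v - \<zeta>)" v] m\<psi> m\<rho> by (simp add: algebra_simps)
  let ?f = "\<lambda>(\<xi>, \<zeta>). z \<xi> * \<psi>' \<zeta> * \<rho> (\<xi> - \<zeta>)"
  have bs: "bounded_supp ?f"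
  proof -
    obtain C A where A: "C > 0" "\<And>x. \<bar>z x\<bar> \<le> C" "bounded A" "\<And>x. x \<notin> A \<Longrightarrow> z x = 0"
      by (rule bounded_suppE[OF z]) (rule that)
    obtain D B where B: "D > 0" "\<And>x. \<bar>\<psi>' x\<bar> \<le> D" "bounded B" "\<And>x. x \<notin> B \<Longrightarrow> \<psi>' x = 0"
      by (rule bounded_suppE[OF \<psi>']) (rule that)
    obtain E where E: "\<And>x. \<bar>\<rho> x\<bar> \<le> E" using test_function_bounded[OF t] by metis
    show ?thesis
    proof (rule bounded_suppI[of _ "C * D * E" "A \<times> B"])
      show "bounded (A \<times> B)" using A B by (intro bounded_Times)
      show "\<bar>?f x\<bar> \<le> C * D * E" for x
        using A B E by (cases x) (auto simp: abs_mult intro!: mult_mono less_imp_le[OF A(1)] less_imp_le[OF B(1)] mult_nonneg_nonneg)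
      show "?f \<in> borel_measurable borel" unfolding borel_prod[symmetric]
        using mz m\<psi>' m\<rho> by measurable
      show "?f x = 0" if "x \<notin> A \<times> B" for x
        using that A(4)[of "fst x"] B(4)[of "snd x"] by (cases x) auto
    qed
  qed
  have int: "integrable (lborel \<Otimes>\<^sub>M lborel) ?f"
    using bounded_supp_integrable[OF bs] by (simp add: lborel_prod)
  have "(\<integral>\<xi>. z \<xi> * mollify \<rho> \<psi>' \<xi> \<partial>lborel) = (\<integral>\<xi>. (\<integral>\<zeta>. z \<xi> * \<psi>' \<zeta> * \<rho> (\<xi> - \<zeta>) \<partial>lborel) \<partial>lborel)"
    by (simp add: mollify_def mult.assoc)
  also have "\<dots> = (\<integral>\<zeta>. (\<integral>\<xi>. z \<xi> * \<psi>' \<zeta> * \<rho> (\<xi> - \<zeta>) \<partial>lborel) \<partial>lborel)"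
    using lborel_pair.Fubini_integral[OF int] by simp
  also have "\<dots> = (\<integral>\<zeta>. (\<integral>\<xi>. z \<xi> * \<rho> (\<xi> - \<zeta>) \<partial>lborel) * \<psi>' \<zeta> \<partial>lborel)"
    by (subst Bochner_Integration.integral_mult_left_zero[symmetric]) (simp add: mult_ac)
  finally show "(\<integral>\<xi>. z \<xi> * mollify \<rho> \<psi> (\<xi> + v) \<partial>lborel) = (\<integral>\<zeta>. (\<integral>\<xi>. z \<xi> * \<rho> (\<xi> - \<zeta>) \<partial>lborel) * \<psi> (\<zeta> + v) \<partial>lborel)"
    by (simp add: shift \<psi>'_def)
  have "integrable lborel (\<lambda>\<zeta>. (\<integral>\<xi>. z \<xi> * \<psi>' \<zeta> * \<rho> (\<xi> - \<zeta>) \<partial>lborel))"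
    using lborel_pair.integrable_snd[OF int] by simp
  then show "integrable lborel (\<lambda>\<zeta>. (\<integral>\<xi>. z \<xi> * \<rho> (\<xi> - \<zeta>) \<partial>lborel) * \<psi> (\<zeta> + v))"
    by (subst Bochner_Integration.integral_mult_left_zero[symmetric]) (simp add: mult_ac \<psi>'_def)
  have cont: "continuous_on UNIV (mollify \<rho> \<psi>')"
    using mollify_has_derivative[OF \<psi>' t] has_derivative_continuous continuous_at_imp_continuous_on by blast
  obtain E where E: "\<And>x. \<bar>\<rho> x\<bar> \<le> E" using test_function_bounded[OF t] by metis
  have "\<bar>mollify \<rho> \<psi>' \<xi>\<bar> \<le> E * (\<integral>\<zeta>. \<bar>\<psi>' \<zeta>\<bar> \<partial>lborel)" for \<xi>
    unfolding mollify_def by (intro mollify_bound \<psi>' mollify_integrable[OF \<psi>' t] E)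
  then show "bounded_supp (\<lambda>\<xi>. z \<xi> * mollify \<rho> \<psi> (\<xi> + v))"
    unfolding shift by (intro bounded_supp_mult z borel_measurable_continuous_onI cont)
qed

subsection \<open>Differences of mollified functions\<close>

definition laplacian :: "('a::euclidean_space \<times> real \<Rightarrow> real) \<Rightarrow> 'a \<times> real \<Rightarrow> real" where
  "laplacian u \<xi> = (\<Sum>b\<in>Basis. partial_deriv (b, 0) (partial_deriv (b, 0) u) \<xi>)"

text \<open>Taken at all points rather than on a grid, so that summation by parts becomes a
  translation in a Lebesgue integral.\<close>

definition second_diff :: "real \<Rightarrow> ('a::euclidean_space \<times> real \<Rightarrow> real) \<Rightarrow> 'a \<times> real \<Rightarrow> real" where
  "second_diff \<epsilon> u \<xi> =
     (\<Sum>b\<in>Basis. u (\<xi> + (\<epsilon> *\<^sub>R b, 0)) + u (\<xi> - (\<epsilon> *\<^sub>R b, 0)) - 2 * u \<xi>) / \<epsilon>\<^sup>2"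

lemma Basis_pair_space: "b \<in> Basis \<Longrightarrow> (b, 0) \<in> Basis"
  and Basis_pair_time: "(0, 1::real) \<in> Basis"
  by (auto simp: Basis_prod_def)

lemma laplacian_test_function:
  fixes \<phi> :: "'a::euclidean_space \<times> real \<Rightarrow> real"
  assumes "test_function S \<phi>"
  shows "bounded_supp (laplacian \<phi>)" "continuous_on A (laplacian \<phi>)"
  unfolding laplacian_def
  by (intro bounded_supp_sum finite_Basis test_function_bounded_supp[of S]
      continuous_on_sum test_function_continuous[of S] test_function_partial_deriv Basis_pair_space assms; assumption)+

lemma test_function_second_diff:
  fixes \<phi> :: "'a::euclidean_space \<times> real \<Rightarrow> real"
  assumes t: "test_function S \<phi>" and "e > 0"
  shows "\<exists>d>0. \<forall>\<epsilon> \<tau> \<xi>. 0 < \<epsilon> \<longrightarrow> \<epsilon> < d \<longrightarrow> \<bar>\<tau>\<bar> < d \<longrightarrow>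
    \<bar>second_diff \<epsilon> \<phi> (\<xi> + (0, \<tau>)) - laplacian \<phi> \<xi>\<bar> \<le> e"
proof -
  define e' where "e' = e / real DIM('a)"
  have e': "e' > 0" using \<open>e > 0\<close> by (simp add: e'_def)
  have "\<exists>d>0. \<forall>b\<in>(Basis::'a set). \<forall>h x y. 0 < h \<longrightarrow> h < d \<longrightarrow> norm (y - x) < d \<longrightarrow>
    \<bar>(\<phi> (y + h *\<^sub>R (b, 0)) + \<phi> (y - h *\<^sub>R (b, 0)) - 2 * \<phi> y) / h\<^sup>2
      - partial_deriv (b, 0) (partial_deriv (b, 0) \<phi>) x\<bar> \<le> e'"
    by (intro finite_common_bound finite_Basis test_function_second_difference[OF t _ e'] Basis_pair_space) auto
  then obtain d where d: "d > 0" "\<And>b h x y. b \<in> (Basis::'a set) \<Longrightarrow> 0 < h \<Longrightarrow> h < d \<Longrightarrow> norm (y - x) < d \<Longrightarrow>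
    \<bar>(\<phi> (y + h *\<^sub>R (b, 0)) + \<phi> (y - h *\<^sub>R (b, 0)) - 2 * \<phi> y) / h\<^sup>2
      - partial_deriv (b, 0) (partial_deriv (b, 0) \<phi>) x\<bar> \<le> e'" by blast
  have "\<bar>second_diff \<epsilon> \<phi> (\<xi> + (0, \<tau>)) - laplacian \<phi> \<xi>\<bar> \<le> e" if "0 < \<epsilon>" "\<epsilon> < d" "\<bar>\<tau>\<bar> < d" for \<epsilon> \<tau> \<xi>
  proof -
    have n: "norm ((\<xi> + (0, \<tau>)) - \<xi>) < d" using that by (simp add: norm_Pair)
    have "second_diff \<epsilon> \<phi> (\<xi> + (0, \<tau>)) - laplacian \<phi> \<xi> =
       (\<Sum>b\<in>Basis. (\<phi> (\<xi> + (0, \<tau>) + \<epsilon> *\<^sub>R (b, 0)) + \<phi> (\<xi> + (0, \<tau>) - \<epsilon> *\<^sub>R (b, 0)) - 2 * \<phi> (\<xi> + (0, \<tau>))) / \<epsilon>\<^sup>2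
      - partial_deriv (b, 0) (partial_deriv (b, 0) \<phi>) \<xi>)"
      unfolding second_diff_def laplacian_def sum_divide_distrib sum_subtractf[symmetric] by simp
    also have "\<bar>\<dots>\<bar> \<le> (\<Sum>b\<in>(Basis::'a set). e')"
      by (intro order_trans[OF sum_abs] sum_mono d(2)[OF _ that(1,2) n])
    also have "\<dots> = e" by (simp add: e'_def)
    finally show ?thesis .
  qed
  then show ?thesis using d(1) by blast
qed

lemma test_function_time_diff:
  fixes \<phi> :: "'a::euclidean_space \<times> real \<Rightarrow> real"
  assumes t: "test_function S \<phi>" and "e > 0"
  shows "\<exists>d>0. \<forall>\<tau> \<xi>. 0 < \<tau> \<longrightarrow> \<tau> < d \<longrightarrow>
    \<bar>(\<phi> (\<xi> + (0, \<tau>)) - \<phi> \<xi>) / \<tau> - partial_deriv (0, 1) \<phi> \<xi>\<bar> \<le> e"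
proof -
  obtain d where d: "d > 0" "\<And>x v. norm v < d \<Longrightarrow>
    \<bar>\<phi> (x + v) - \<phi> x - (\<Sum>b\<in>Basis. (v \<bullet> b) * partial_deriv b \<phi> x)\<bar> \<le> e * norm v"
    using test_function_uniform_derivative[OF t \<open>e > 0\<close>] by blast
  have "\<bar>(\<phi> (\<xi> + (0, \<tau>)) - \<phi> \<xi>) / \<tau> - partial_deriv (0, 1) \<phi> \<xi>\<bar> \<le> e" if "0 < \<tau>" "\<tau> < d" for \<tau> \<xi>
  proof -
    have "(\<Sum>b\<in>Basis. ((0, \<tau>) \<bullet> b) * partial_deriv b \<phi> \<xi>) = \<tau> * (\<Sum>b\<in>Basis. ((0, 1) \<bullet> b) * partial_deriv b \<phi> \<xi>)"
      unfolding sum_distrib_left by (rule sum.cong) (auto simp: Basis_prod_def)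
    also have "\<dots> = \<tau> * partial_deriv (0, 1) \<phi> \<xi>"
      using partial_deriv_sum_Basis[OF test_function_differentiable[OF t]] by metis
    finally have "\<bar>\<phi> (\<xi> + (0, \<tau>)) - \<phi> \<xi> - \<tau> * partial_deriv (0, 1) \<phi> \<xi>\<bar> \<le> e * \<tau>"
      using d(2)[of "(0, \<tau>)" \<xi>] that by (simp add: norm_Pair)
    moreover have "(\<phi> (\<xi> + (0, \<tau>)) - \<phi> \<xi>) / \<tau> - partial_deriv (0, 1) \<phi> \<xi>
      = (\<phi> (\<xi> + (0, \<tau>)) - \<phi> \<xi> - \<tau> * partial_deriv (0, 1) \<phi> \<xi>) / \<tau>"
      using that by (simp add: field_simps)
    ultimately show ?thesis using that by (simp add: abs_mult field_simps)
  qed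
  then show ?thesis using d(1) by blast
qed

text \<open>The threshold \<open>d\<close> depends on the kernel and \<open>e\<close> only. The dual
  solution is constructed from \<epsilon> and \<tau>, so a threshold depending on \<psi> would be
  circular.\<close>

lemma mollify_approx:
  fixes \<rho> :: "'a::euclidean_space \<times> real \<Rightarrow> real"
  assumes t: "test_function S \<rho>" and "e > 0"
  shows "\<exists>d>0. \<forall>\<epsilon> \<tau> \<psi> \<xi>. 0 < \<epsilon> \<longrightarrow> \<epsilon> < d \<longrightarrow> 0 < \<tau> \<longrightarrow> \<tau> < d \<longrightarrow> bounded_supp \<psi> \<longrightarrow>
    \<bar>second_diff \<epsilon> (mollify \<rho> \<psi>) (\<xi> + (0, \<tau>)) - laplacian (mollify \<rho> \<psi>) \<xi>\<bar> \<le> e * (\<integral>\<zeta>. \<bar>\<psi> \<zeta>\<bar> \<partial>lborel) \<and>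
    \<bar>(mollify \<rho> \<psi> (\<xi> + (0, \<tau>)) - mollify \<rho> \<psi> \<xi>) / \<tau> - partial_deriv (0, 1) (mollify \<rho> \<psi>) \<xi>\<bar>
      \<le> e * (\<integral>\<zeta>. \<bar>\<psi> \<zeta>\<bar> \<partial>lborel)"
proof -
  obtain d1 where d1: "d1 > 0" "\<And>\<epsilon> \<tau> \<xi>. 0 < \<epsilon> \<Longrightarrow> \<epsilon> < d1 \<Longrightarrow> \<bar>\<tau>\<bar> < d1 \<Longrightarrow>
    \<bar>second_diff \<epsilon> \<rho> (\<xi> + (0, \<tau>)) - laplacian \<rho> \<xi>\<bar> \<le> e"
    using test_function_second_diff[OF assms] by metis
  obtain d2 where d2: "d2 > 0" "\<And>\<tau> \<xi>. 0 < \<tau> \<Longrightarrow> \<tau> < d2 \<Longrightarrow>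
    \<bar>(\<rho> (\<xi> + (0, \<tau>)) - \<rho> \<xi>) / \<tau> - partial_deriv (0, 1) \<rho> \<xi>\<bar> \<le> e"
    using test_function_time_diff[OF assms] by metis
  have main: "\<bar>second_diff \<epsilon> (mollify \<rho> \<psi>) (\<xi> + (0, \<tau>)) - laplacian (mollify \<rho> \<psi>) \<xi>\<bar> \<le> e * (\<integral>\<zeta>. \<bar>\<psi> \<zeta>\<bar> \<partial>lborel)"
    "\<bar>(mollify \<rho> \<psi> (\<xi> + (0, \<tau>)) - mollify \<rho> \<psi> \<xi>) / \<tau> - partial_deriv (0, 1) (mollify \<rho> \<psi>) \<xi>\<bar>
      \<le> e * (\<integral>\<zeta>. \<bar>\<psi> \<zeta>\<bar> \<partial>lborel)"
    if h: "0 < \<epsilon>" "\<epsilon> < min d1 d2" "0 < \<tau>" "\<tau> < min d1 d2" and \<psi>: "bounded_supp \<psi>" for \<epsilon> \<tau> \<psi> \<xi>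
  proof -
    have pp: "test_function S (partial_deriv (b, 0) \<rho>)"
      "test_function S (partial_deriv (b, 0) (partial_deriv (b, 0) \<rho>))" if "b \<in> Basis" for b
      using t that by (blast intro: test_function_partial_deriv Basis_pair_space)+
    have lap: "laplacian (mollify \<rho> \<psi>) \<xi> = (\<Sum>b\<in>Basis. mollify (partial_deriv (b, 0) (partial_deriv (b, 0) \<rho>)) \<psi> \<xi>)"
      unfolding laplacian_def
      by (intro sum.cong refl) (simp add: partial_deriv_mollify[OF \<psi> t] partial_deriv_mollify[OF \<psi> pp(1)] Basis_pair_space)
    note int = mollify_integrable[OF \<psi> t] mollify_integrable[OF \<psi> pp(2)]
      mollify_integrable[OF \<psi> test_function_partial_deriv[OF t Basis_pair_time]]
    let ?f = "\<lambda>\<zeta>. second_diff \<epsilon> \<rho> ((\<xi> - \<zeta>) + (0, \<tau>)) - laplacian \<rho> (\<xi> - \<zeta>)"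
    have eq: "(\<lambda>\<zeta>. \<psi> \<zeta> * ?f \<zeta>) = (\<lambda>\<zeta>. (\<Sum>b\<in>Basis. \<psi> \<zeta> * \<rho> ((\<xi> + (0, \<tau>) + (\<epsilon> *\<^sub>R b, 0)) - \<zeta>)
        + \<psi> \<zeta> * \<rho> ((\<xi> + (0, \<tau>) - (\<epsilon> *\<^sub>R b, 0)) - \<zeta>) - 2 * (\<psi> \<zeta> * \<rho> ((\<xi> + (0, \<tau>)) - \<zeta>))) / \<epsilon>\<^sup>2
        - (\<Sum>b\<in>Basis. \<psi> \<zeta> * partial_deriv (b, 0) (partial_deriv (b, 0) \<rho>) (\<xi> - \<zeta>)))"
      by (rule ext) (simp add: second_diff_def laplacian_def right_diff_distrib sum_distrib_left
          distrib_left algebra_simps add_diff_eq)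
    have i: "integrable lborel (\<lambda>\<zeta>. \<psi> \<zeta> * ?f \<zeta>)"
      unfolding eq using int
      by (intro Bochner_Integration.integrable_diff Bochner_Integration.integrable_add Bochner_Integration.integrable_sum
          integrable_divide integrable_mult_right)
    have "second_diff \<epsilon> (mollify \<rho> \<psi>) (\<xi> + (0, \<tau>)) - laplacian (mollify \<rho> \<psi>) \<xi> = (\<integral>\<zeta>. \<psi> \<zeta> * ?f \<zeta> \<partial>lborel)"
      unfolding eq lap unfolding second_diff_def mollify_def using int
      by (subst Bochner_Integration.integral_diff Bochner_Integration.integral_add Bochner_Integration.integral_sum integral_divide_zero
          | intro Bochner_Integration.integrable_diff Bochner_Integration.integrable_add Bochner_Integration.integrable_sum
          integrable_divide integrable_mult_right | simp)+
    also have "\<bar>\<dots>\<bar> \<le> e * (\<integral>\<zeta>. \<bar>\<psi> \<zeta>\<bar> \<partial>lborel)"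
      using h by (intro mollify_bound \<psi> i d1(2)) auto
    finally show "\<bar>second_diff \<epsilon> (mollify \<rho> \<psi>) (\<xi> + (0, \<tau>)) - laplacian (mollify \<rho> \<psi>) \<xi>\<bar> \<le> e * (\<integral>\<zeta>. \<bar>\<psi> \<zeta>\<bar> \<partial>lborel)" .
    let ?g = "\<lambda>\<zeta>. (\<rho> ((\<xi> - \<zeta>) + (0, \<tau>)) - \<rho> (\<xi> - \<zeta>)) / \<tau> - partial_deriv (0, 1) \<rho> (\<xi> - \<zeta>)"
    have eq': "(\<lambda>\<zeta>. \<psi> \<zeta> * ?g \<zeta>) = (\<lambda>\<zeta>. (\<psi> \<zeta> * \<rho> ((\<xi> + (0, \<tau>)) - \<zeta>) - \<psi> \<zeta> * \<rho> (\<xi> - \<zeta>)) / \<tau>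
        - \<psi> \<zeta> * partial_deriv (0, 1) \<rho> (\<xi> - \<zeta>))"
      by (rule ext) (simp add: right_diff_distrib algebra_simps)
    have i': "integrable lborel (\<lambda>\<zeta>. \<psi> \<zeta> * ?g \<zeta>)"
      unfolding eq' using int
      by (intro Bochner_Integration.integrable_diff integrable_divide)
    have "(mollify \<rho> \<psi> (\<xi> + (0, \<tau>)) - mollify \<rho> \<psi> \<xi>) / \<tau> - partial_deriv (0, 1) (mollify \<rho> \<psi>) \<xi>
      = (\<integral>\<zeta>. \<psi> \<zeta> * ?g \<zeta> \<partial>lborel)"
      unfolding eq' partial_deriv_mollify[OF \<psi> t Basis_pair_time] unfolding mollify_def using int
      by (subst Bochner_Integration.integral_diff integral_divide_zero
          | intro Bochner_Integration.integrable_diff integrable_divide | simp)+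
    also have "\<bar>\<dots>\<bar> \<le> e * (\<integral>\<zeta>. \<bar>\<psi> \<zeta>\<bar> \<partial>lborel)"
      using h by (intro mollify_bound \<psi> i' d2(2)) auto
    finally show "\<bar>(mollify \<rho> \<psi> (\<xi> + (0, \<tau>)) - mollify \<rho> \<psi> \<xi>) / \<tau> - partial_deriv (0, 1) (mollify \<rho> \<psi>) \<xi>\<bar>
      \<le> e * (\<integral>\<zeta>. \<bar>\<psi> \<zeta>\<bar> \<partial>lborel)" .
  qed
  then show ?thesis using d1(1) d2(1) by (intro exI[of _ "min d1 d2"]) simp
qed

text \<open>The discrete form of \<open>|grad (u + d)|^2 = |grad u|^2 + 2 grad u . grad d + |grad
  d|^2\<close> in direction \<open>s\<close>. Translation invariance plays the role of integration
  by parts in the mixed term, and the last term is bounded crudely by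
  \<open>(p - q)^2 \<le> 2 p^2 + 2 q^2\<close>, a loss that the smallness of \<tau>/\<epsilon>^2
  makes good later.\<close>

lemma difference_energy_add:
  fixes u d :: "'a::euclidean_space \<Rightarrow> real"
  assumes u: "bounded_supp u" and d: "bounded_supp d"
  shows "(\<integral>\<xi>. ((u (\<xi> + s) + d (\<xi> + s)) - (u \<xi> + d \<xi>))\<^sup>2 \<partial>lborel) \<le>
    (\<integral>\<xi>. (u (\<xi> + s) - u \<xi>)\<^sup>2 \<partial>lborel) - 2 * (\<integral>\<xi>. d \<xi> * (u (\<xi> + s) + u (\<xi> - s) - 2 * u \<xi>) \<partial>lborel)
    + 4 * (\<integral>\<xi>. (d \<xi>)\<^sup>2 \<partial>lborel)"
proof -
  note bs = bounded_supp_translate bounded_supp_mult' bounded_supp_cmult bounded_supp_add bounded_supp_diff u d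
  have um: "bounded_supp (\<lambda>\<xi>. u (\<xi> - s))" using bounded_supp_translate[OF u, of "-s"] by simp
  have int: "integrable lborel (\<lambda>\<xi>. (u (\<xi> + s) - u \<xi>)\<^sup>2)" "integrable lborel (\<lambda>\<xi>. (d (\<xi> + s))\<^sup>2)"
    "integrable lborel (\<lambda>\<xi>. (d \<xi>)\<^sup>2)"  "integrable lborel (\<lambda>\<xi>. u (\<xi> + s) * d (\<xi> + s))"
    "integrable lborel (\<lambda>\<xi>. u \<xi> * d \<xi>)" "integrable lborel (\<lambda>\<xi>. d \<xi> * u (\<xi> + s))"
    "integrable lborel (\<lambda>\<xi>. d (\<xi> + s) * u \<xi>)" "integrable lborel (\<lambda>\<xi>. d \<xi> * u (\<xi> - s))"
    unfolding power2_eq_square by (intro bounded_supp_integrable bs um)+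
  have m: "u \<in> borel_measurable borel" "d \<in> borel_measurable borel"
    using u d by (auto simp: bounded_supp_def)
  have t1: "(\<integral>\<xi>. (d (\<xi> + s))\<^sup>2 \<partial>lborel) = (\<integral>\<xi>. (d \<xi>)\<^sup>2 \<partial>lborel)"
    using m by (intro integral_translate[of "\<lambda>\<xi>. (d \<xi>)\<^sup>2"]) measurable
  have t2: "(\<integral>\<xi>. u (\<xi> + s) * d (\<xi> + s) \<partial>lborel) = (\<integral>\<xi>. u \<xi> * d \<xi> \<partial>lborel)"
    using m by (intro integral_translate[of "\<lambda>\<xi>. u \<xi> * d \<xi>"]) measurable
  have t3: "(\<integral>\<xi>. d (\<xi> + s) * u \<xi> \<partial>lborel) = (\<integral>\<xi>. d \<xi> * u (\<xi> - s) \<partial>lborel)"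
    using m integral_translate[of "\<lambda>\<xi>. d \<xi> * u (\<xi> - s)" s] by simp
  have "(\<integral>\<xi>. ((u (\<xi> + s) + d (\<xi> + s)) - (u \<xi> + d \<xi>))\<^sup>2 \<partial>lborel) \<le>
    (\<integral>\<xi>. (u (\<xi> + s) - u \<xi>)\<^sup>2 + 2 * (u (\<xi> + s) * d (\<xi> + s)) + 2 * (u \<xi> * d \<xi>) - 2 * (d \<xi> * u (\<xi> + s))
      - 2 * (d (\<xi> + s) * u \<xi>) + 2 * (d (\<xi> + s))\<^sup>2 + 2 * (d \<xi>)\<^sup>2 \<partial>lborel)"
  proof (rule integral_mono)
    show "integrable lborel (\<lambda>\<xi>. ((u (\<xi> + s) + d (\<xi> + s)) - (u \<xi> + d \<xi>))\<^sup>2)"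
      unfolding power2_eq_square by (intro bounded_supp_integrable bs)
    show "((u (\<xi> + s) + d (\<xi> + s)) - (u \<xi> + d \<xi>))\<^sup>2 \<le> (u (\<xi> + s) - u \<xi>)\<^sup>2 + 2 * (u (\<xi> + s) * d (\<xi> + s))
      + 2 * (u \<xi> * d \<xi>) - 2 * (d \<xi> * u (\<xi> + s)) - 2 * (d (\<xi> + s) * u \<xi>) + 2 * (d (\<xi> + s))\<^sup>2 + 2 * (d \<xi>)\<^sup>2" for \<xi>
      using zero_le_power2[of "d (\<xi> + s) + d \<xi>"] by (simp add: power2_eq_square algebra_simps)
  qed (use int in auto)
  also have "\<dots> = (\<integral>\<xi>. (u (\<xi> + s) - u \<xi>)\<^sup>2 \<partial>lborel) + 4 * (\<integral>\<xi>. u \<xi> * d \<xi> \<partial>lborel)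
     - 2 * (\<integral>\<xi>. d \<xi> * u (\<xi> + s) \<partial>lborel) - 2 * (\<integral>\<xi>. d \<xi> * u (\<xi> - s) \<partial>lborel) + 4 * (\<integral>\<xi>. (d \<xi>)\<^sup>2 \<partial>lborel)"
    using int by (simp add: t1 t2 t3)
  also have "(\<integral>\<xi>. d \<xi> * (u (\<xi> + s) + u (\<xi> - s) - 2 * u \<xi>) \<partial>lborel) =
     (\<integral>\<xi>. d \<xi> * u (\<xi> + s) + d \<xi> * u (\<xi> - s) - 2 * (u \<xi> * d \<xi>) \<partial>lborel)"
    by (simp add: algebra_simps)
  then have "(\<integral>\<xi>. d \<xi> * (u (\<xi> + s) + u (\<xi> - s) - 2 * u \<xi>) \<partial>lborel) =
     (\<integral>\<xi>. d \<xi> * u (\<xi> + s) \<partial>lborel) + (\<integral>\<xi>. d \<xi> * u (\<xi> - s) \<partial>lborel) - 2 * (\<integral>\<xi>. u \<xi> * d \<xi> \<partial>lborel)"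
    using int by simp
  ultimately show ?thesis by simp
qed

subsection \<open>An explicit scheme for the backward dual problem\<close>

text \<open>Nonnegative weights in the averages would need only
  \<open>2 n a2 \<tau> \<le> \<epsilon>^2\<close> with \<open>n = DIM('a)\<close>; the further
  factor 4 in \<open>cfl\<close> leaves room to absorb the quadratic error of the energy estimate.
  Beyond its bounds \<open>a\<close> is only required to be measurable, since it will be the
  quotient of \<open>w\<close> and \<open>z\<close>.\<close>

locale dual_scheme =
  fixes B :: "'a::euclidean_space set" and t0 T \<epsilon> \<tau> a1 a2 :: real and a g :: "'a \<times> real \<Rightarrow> real"
  assumes B: "bounded B" "B \<in> sets borel" and t0T: "t0 < T" and eps: "0 < \<epsilon>" and tau: "0 < \<tau>"
    and a1: "0 < a1" and a: "a \<in> borel_measurable borel" "\<And>\<xi>. a1 \<le> a \<xi>" "\<And>\<xi>. a \<xi> \<le> a2"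
    and g: "g \<in> borel_measurable borel" "\<And>\<xi>. 0 \<le> g \<xi>" "\<And>\<xi>. g \<xi> \<le> 1"
    and cfl: "8 * real DIM('a) * a2 * \<tau> \<le> \<epsilon>\<^sup>2"
begin

abbreviation "D \<equiv> B \<times> {t0..<T}"

text \<open>One explicit Euler step backward in time, from \<open>t + \<tau>\<close> to
  \<open>t\<close>. A fixed point solves the discrete equation on \<open>D\<close> and vanishes
  elsewhere, which encodes the terminal condition at \<open>T\<close> and the lateral Dirichlet
  condition.\<close>

definition step :: "('a \<times> real \<Rightarrow> real) \<Rightarrow> 'a \<times> real \<Rightarrow> real" where
  "step u \<xi> = indicator D \<xi> * (u (\<xi> + (0, \<tau>)) + \<tau> * (a \<xi> * second_diff \<epsilon> u (\<xi> + (0, \<tau>)) + g \<xi>))"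

lemma step_in: "\<xi> \<in> D \<Longrightarrow> step u \<xi> = u (\<xi> + (0, \<tau>)) + \<tau> * (a \<xi> * second_diff \<epsilon> u (\<xi> + (0, \<tau>)) + g \<xi>)"
  and step_out: "\<xi> \<notin> D \<Longrightarrow> step u \<xi> = 0"
  by (simp_all add: step_def)

lemma D_meas [measurable]: "D \<in> sets borel"
  using B by (simp add: borel_prod[symmetric])

lemma D_bounded: "bounded D"
  using B by (intro bounded_Times) auto

lemma a_pos: "0 < a \<xi>"
  using a(2) a1 less_le_trans by blast

lemma cfl': "2 * real DIM('a) * (\<tau> * a \<xi>) \<le> \<epsilon>\<^sup>2 / 4"
proof -
  have "real DIM('a) * \<tau> * a \<xi> \<le> real DIM('a) * \<tau> * a2"
    using a(3) tau by (intro mult_left_mono) auto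
  then show ?thesis using cfl by (simp add: field_simps)
qed

lemma drift_eq:
  fixes u :: "'a \<times> real \<Rightarrow> real"
  shows "u \<xi> + \<tau> * (a \<eta> * second_diff \<epsilon> u \<xi>) = (1 - 2 * real DIM('a) * (\<tau> * a \<eta>) / \<epsilon>\<^sup>2) * u \<xi>
    + (\<tau> * a \<eta> / \<epsilon>\<^sup>2) * (\<Sum>b\<in>Basis. u (\<xi> + (\<epsilon> *\<^sub>R b, 0)) + u (\<xi> - (\<epsilon> *\<^sub>R b, 0)))"
  using eps by (simp add: second_diff_def sum_subtractf field_simps)

text \<open>By \<open>drift_eq\<close> the new value is an average of old values, with weights that
  sum to 1 and are nonnegative by the step size condition: the discrete maximum principle.\<close>

lemma drift_bounds:
  fixes u :: "'a \<times> real \<Rightarrow> real"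
  assumes "\<And>\<xi>. 0 \<le> u \<xi>" "\<And>\<xi>. u \<xi> \<le> c"
  shows "0 \<le> u \<xi> + \<tau> * (a \<eta> * second_diff \<epsilon> u \<xi>)" "u \<xi> + \<tau> * (a \<eta> * second_diff \<epsilon> u \<xi>) \<le> c"
proof -
  have p: "1 - 2 * real DIM('a) * (\<tau> * a \<eta>) / \<epsilon>\<^sup>2 \<ge> 0"
  proof -
    have "2 * real DIM('a) * (\<tau> * a \<eta>) \<le> \<epsilon>\<^sup>2"
      using cfl'[of \<eta>] zero_le_power2[of \<epsilon>] by linarith
    then show ?thesis using eps by (simp add: divide_le_eq_1)
  qed
  have q: "\<tau> * a \<eta> / \<epsilon>\<^sup>2 \<ge> 0" using tau a_pos[of \<eta>] by simp
  show "0 \<le> u \<xi> + \<tau> * (a \<eta> * second_diff \<epsilon> u \<xi>)"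
    unfolding drift_eq using p q assms by (intro add_nonneg_nonneg mult_nonneg_nonneg sum_nonneg) auto
  have "u \<xi> + \<tau> * (a \<eta> * second_diff \<epsilon> u \<xi>) \<le> (1 - 2 * real DIM('a) * (\<tau> * a \<eta>) / \<epsilon>\<^sup>2) * c
    + (\<tau> * a \<eta> / \<epsilon>\<^sup>2) * (\<Sum>b\<in>(Basis::'a set). c + c)"
    unfolding drift_eq using p q assms by (intro add_mono mult_left_mono sum_mono) auto
  also have "\<dots> = c" using eps by (simp add: field_simps)
  finally show "u \<xi> + \<tau> * (a \<eta> * second_diff \<epsilon> u \<xi>) \<le> c" .
qed

lemma second_diff_measurable:
  fixes u :: "'a \<times> real \<Rightarrow> real"
  assumes "u \<in> borel_measurable borel"
  shows "(\<lambda>\<xi>. second_diff \<epsilon> u (\<xi> + v)) \<in> borel_measurable borel"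
proof -
  have "(\<lambda>\<xi>. u (\<xi> + v + w)) \<in> borel_measurable borel" "(\<lambda>\<xi>. u (\<xi> + v - w)) \<in> borel_measurable borel"
    "(\<lambda>\<xi>. u (\<xi> + v)) \<in> borel_measurable borel" for w
    using assms by measurable
  then show ?thesis unfolding second_diff_def by measurable
qed

lemma bounded_supp_second_diff:
  fixes u :: "'a \<times> real \<Rightarrow> real"
  assumes "bounded_supp u"
  shows "bounded_supp (\<lambda>\<xi>. second_diff \<epsilon> u (\<xi> + v))"
proof -
  have "second_diff \<epsilon> u (\<xi> + v) = inverse (\<epsilon>\<^sup>2) * (\<Sum>b\<in>Basis. u (\<xi> + (v + (\<epsilon> *\<^sub>R b, 0)))
     + u (\<xi> + (v - (\<epsilon> *\<^sub>R b, 0))) - 2 * u (\<xi> + v))" for \<xi>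
    by (simp add: second_diff_def divide_inverse mult.commute add.assoc add_diff_eq)
  then show ?thesis
    using assms by (simp only:) (intro bounded_supp_sum bounded_supp_cmult bounded_supp_diff bounded_supp_add
        bounded_supp_translate finite_Basis)
qed

text \<open>The maximum principle, with a source that adds at most \<tau> per step.\<close>

lemma funpow_step_bounds: "0 \<le> (step ^^ k) (\<lambda>_. 0) \<xi> \<and> (step ^^ k) (\<lambda>_. 0) \<xi> \<le> real k * \<tau>"
proof (induction k arbitrary: \<xi>)
  case (Suc k)
  let ?u = "(step ^^ k) (\<lambda>_. 0)"
  have b: "0 \<le> ?u (\<xi> + (0, \<tau>)) + \<tau> * (a \<xi> * second_diff \<epsilon> ?u (\<xi> + (0, \<tau>)))"
    "?u (\<xi> + (0, \<tau>)) + \<tau> * (a \<xi> * second_diff \<epsilon> ?u (\<xi> + (0, \<tau>))) \<le> real k * \<tau>"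
    using drift_bounds[of ?u "real k * \<tau>"] Suc by auto
  have "0 \<le> \<tau> * g \<xi>" "\<tau> * g \<xi> \<le> \<tau>" using g(2,3)[of \<xi>] tau by (auto simp: mult_left_le)
  have "0 \<le> step ?u \<xi> \<and> step ?u \<xi> \<le> \<tau> + real k * \<tau>"
  proof (cases "\<xi> \<in> D")
    case True
    then show ?thesis using b \<open>0 \<le> \<tau> * g \<xi>\<close> \<open>\<tau> * g \<xi> \<le> \<tau>\<close>
      by (simp only: step_in distrib_left) linarith
  next
    case False
    then show ?thesis using tau by (simp add: step_out)
  qed
  then show ?case by (simp add: distrib_right)
qed simp

lemma step_measurable:
  assumes [measurable]: "u \<in> borel_measurable borel"
  shows "step u \<in> borel_measurable borel"
proof -
  have [measurable]: "(\<lambda>\<xi>. u (\<xi> + (0, \<tau>))) \<in> borel_measurable borel"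
    by measurable
  have [measurable]: "(\<lambda>\<xi>. second_diff \<epsilon> u (\<xi> + (0, \<tau>))) \<in> borel_measurable borel"
    by (rule second_diff_measurable[OF assms])
  note [measurable] = a(1) g(1)
  have "(\<lambda>\<xi>. u (\<xi> + (0, \<tau>)) + \<tau> * (a \<xi> * second_diff \<epsilon> u (\<xi> + (0, \<tau>)) + g \<xi>)) \<in> borel_measurable borel"
    by measurable
  with borel_measurable_indicator[OF D_meas] show ?thesis
    unfolding step_def[abs_def] by (rule borel_measurable_times)
qed

lemma funpow_step_measurable: "(step ^^ k) (\<lambda>_. 0) \<in> borel_measurable borel"
  by (induction k) (simp_all add: step_measurable)

lemma step_cong:
  "(\<And>\<eta>. snd \<eta> = snd \<xi> + \<tau> \<Longrightarrow> u \<eta> = v \<eta>) \<Longrightarrow> step u \<xi> = step v \<xi>"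
  by (simp add: step_def second_diff_def)

text \<open>A step reads only values exactly \<tau> later, and everything is zero from time
  \<open>T\<close> on. So each iteration settles the values on a further time layer of height
  \<tau>.\<close>

lemma funpow_step_stable:
  "T - real k * \<tau> \<le> snd \<xi> \<Longrightarrow> (step ^^ Suc k) (\<lambda>_. 0) \<xi> = (step ^^ k) (\<lambda>_. 0) \<xi>"
proof (induction k arbitrary: \<xi>)
  case 0
  then show ?case by (cases \<xi>) (simp add: step_out)
next
  case (Suc k)
  have eq: "(step ^^ Suc k) (\<lambda>_. 0) \<eta> = (step ^^ k) (\<lambda>_. 0) \<eta>" if "snd \<eta> = snd \<xi> + \<tau>" for \<eta>
    using Suc that by (intro Suc.IH) (simp add: algebra_simps)
  have "step ((step ^^ Suc k) (\<lambda>_. 0)) \<xi> = step ((step ^^ k) (\<lambda>_. 0)) \<xi>"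
    by (rule step_cong[OF eq])
  then show ?case by simp
qed

lemma dual_exists:
  obtains \<psi> where "bounded_supp \<psi>" "\<And>\<xi>. 0 \<le> \<psi> \<xi>" "\<And>\<xi>. \<psi> \<xi> \<le> T - t0 + \<tau>"
    "\<And>\<xi>. \<xi> \<notin> D \<Longrightarrow> \<psi> \<xi> = 0" "step \<psi> = \<psi>"
proof
  \<comment> \<open>After \<open>N\<close> steps the settled times reach down to \<open>t0\<close>,
    hence cover \<open>D\<close>; rounding up costs the extra \<tau> in the bound.\<close>
  define N where "N = nat \<lceil>(T - t0) / \<tau>\<rceil>"
  have N: "T - t0 \<le> real N * \<tau>" "real N * \<tau> \<le> T - t0 + \<tau>"
  proof -
    have "(T - t0) / \<tau> \<le> real N" "real N \<le> (T - t0) / \<tau> + 1"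
      using t0T tau unfolding N_def by (auto simp: real_nat_ceiling_ge of_nat_ceiling)
    then show "T - t0 \<le> real N * \<tau>" "real N * \<tau> \<le> T - t0 + \<tau>" using tau by (auto simp: field_simps)
  qed
  let ?\<psi> = "(step ^^ N) (\<lambda>_. 0)"
  show 0: "0 \<le> ?\<psi> \<xi>" for \<xi> using funpow_step_bounds by blast
  show 1: "?\<psi> \<xi> \<le> T - t0 + \<tau>" for \<xi> using funpow_step_bounds[of N \<xi>] N by linarith
  have off: "(step ^^ k) (\<lambda>_. 0) \<xi> = 0" if "\<xi> \<notin> D" for k \<xi>
    using that by (cases k) (simp_all add: step_out)
  show "?\<psi> \<xi> = 0" if "\<xi> \<notin> D" for \<xi> using off[OF that] .
  show "step ?\<psi> = ?\<psi>"
  proof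
    fix \<xi>
    show "step ?\<psi> \<xi> = ?\<psi> \<xi>"
    proof (cases "\<xi> \<in> D")
      case True
      then have "T - real N * \<tau> \<le> snd \<xi>" using N by (cases \<xi>) auto
      from funpow_step_stable[OF this] show ?thesis by simp
    next
      case False
      then show ?thesis using off[of \<xi> N] by (simp add: step_out)
    qed
  qed
  show "bounded_supp ?\<psi>"
    by (rule bounded_suppI[OF funpow_step_measurable _ D_bounded off, of _ "T - t0 + \<tau>"])
      (use 0 1 in \<open>auto simp: abs_le_iff intro: order_trans[OF _ 0]\<close>)
qed

text \<open>The shift by \<open>\<tau>\<close> preserves the Dirichlet energy, and \<open>\<psi>\<close> restricted to times \<open>\<ge> t0\<close> is the
  shifted \<open>\<psi>\<close> plus the increment \<open>d\<close>; so the energy of \<open>\<psi>\<close> cancels and only \<open>d\<close> remains.\<close>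

lemma energy_estimate:
  assumes \<psi>: "bounded_supp \<psi>" "\<And>\<xi>. \<xi> \<notin> D \<Longrightarrow> \<psi> \<xi> = 0" "step \<psi> = \<psi>"
  shows "(\<integral>\<xi>. indicator D \<xi> * (second_diff \<epsilon> \<psi> (\<xi> + (0, \<tau>)))\<^sup>2 \<partial>lborel) \<le> 6 / a1\<^sup>2 * measure lborel D"
proof -
  define u where "u = (\<lambda>\<xi>. \<psi> (\<xi> + (0, \<tau>)))"
  define X where "X = (\<lambda>\<xi>. second_diff \<epsilon> \<psi> (\<xi> + (0, \<tau>)))"
  define d where "d = (\<lambda>\<xi>. indicator D \<xi> * (\<tau> * (a \<xi> * X \<xi> + g \<xi>)))"
  have bu: "bounded_supp u" unfolding u_def by (rule bounded_supp_translate[OF \<psi>(1)])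
  have bX: "bounded_supp X" unfolding X_def by (rule bounded_supp_second_diff[OF \<psi>(1)])
  have bD: "bounded_supp (indicator D :: 'a \<times> real \<Rightarrow> real)"
    by (rule bounded_suppI[of _ 1 D]) (use D_bounded in \<open>auto simp: indicator_def\<close>)
  have bd: "bounded_supp d"
  proof -
    have d_eq: "d = (\<lambda>\<xi>. \<tau> * (indicator D \<xi> * (X \<xi> * a \<xi>) + indicator D \<xi> * g \<xi>))"
      by (simp add: d_def algebra_simps)
    have "bounded_supp (\<lambda>\<xi>. indicator D \<xi> * (X \<xi> * a \<xi>))"
      by (intro bounded_supp_mult'[OF bD] bounded_supp_mult[OF bX a(1), of a2])
        (use a(3) a_pos in \<open>auto simp: abs_of_pos\<close>)
    moreover have "bounded_supp (\<lambda>\<xi>. indicator D \<xi> * g \<xi>)"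
      by (intro bounded_supp_mult[OF bD g(1), of 1]) (use g in auto)
    ultimately show ?thesis unfolding d_eq by (intro bounded_supp_cmult bounded_supp_add)
  qed
  have X: "X \<xi> = (\<Sum>b\<in>Basis. u (\<xi> + (\<epsilon> *\<^sub>R b, 0)) + u (\<xi> - (\<epsilon> *\<^sub>R b, 0)) - 2 * u \<xi>) / \<epsilon>\<^sup>2" for \<xi>
    unfolding X_def second_diff_def u_def by (simp add: algebra_simps)
  \<comment> \<open>From time \<open>T\<close> on and off \<open>B\<close> the shifted function
    vanishes as well, so the identity is exact for times at least \<open>t0\<close>; before
    \<open>t0\<close> the shift may be nonzero and is cut away.\<close>
  have ud: "\<psi> \<xi> = (if t0 \<le> snd \<xi> then u \<xi> + d \<xi> else 0)" for \<xi>
  proof (cases "\<xi> \<in> D")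
    case True
    have "\<psi> \<xi> = step \<psi> \<xi>" using \<psi>(3) by simp
    then show ?thesis using True by (auto simp: step_in u_def d_def X_def algebra_simps)
  next
    case False
    then have "t0 \<le> snd \<xi> \<Longrightarrow> \<xi> + (0, \<tau>) \<notin> D" using tau by (cases \<xi>) auto
    then show ?thesis using \<psi>(2) False by (auto simp: u_def d_def)
  qed
  let ?s = "\<lambda>b::'a. (\<epsilon> *\<^sub>R b, 0::real)"
  note bs = bounded_supp_translate bounded_supp_mult' bounded_supp_cmult bounded_supp_add bounded_supp_diff bu bd \<psi>(1)
  \<comment> \<open>Both points of a spatial difference have the same time, so cutting off before
    \<open>t0\<close> can only lower the square integral; this is the inequality between \<psi> and
    \<open>u + d\<close>.\<close>
  have each: "2 * (\<integral>\<xi>. d \<xi> * (u (\<xi> + ?s b) + u (\<xi> - ?s b) - 2 * u \<xi>) \<partial>lborel) \<le> 4 * (\<integral>\<xi>. (d \<xi>)\<^sup>2 \<partial>lborel)" for b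
  proof -
    have m: "\<psi> \<in> borel_measurable borel" using \<psi>(1) by (simp add: bounded_supp_def)
    have "(\<integral>\<xi>. (u (\<xi> + ?s b) - u \<xi>)\<^sup>2 \<partial>lborel) = (\<integral>\<xi>. (\<psi> (\<xi> + ?s b) - \<psi> \<xi>)\<^sup>2 \<partial>lborel)"
      using integral_translate[of "\<lambda>\<xi>. (\<psi> (\<xi> + ?s b) - \<psi> \<xi>)\<^sup>2" "(0, \<tau>)"] m
      by (simp add: u_def add_ac)
    also have "\<dots> \<le> (\<integral>\<xi>. ((u (\<xi> + ?s b) + d (\<xi> + ?s b)) - (u \<xi> + d \<xi>))\<^sup>2 \<partial>lborel)"
    proof (rule integral_mono)
      show "integrable lborel (\<lambda>\<xi>. (\<psi> (\<xi> + ?s b) - \<psi> \<xi>)\<^sup>2)"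
        unfolding power2_eq_square by (intro bounded_supp_integrable bs)
      show "integrable lborel (\<lambda>\<xi>. ((u (\<xi> + ?s b) + d (\<xi> + ?s b)) - (u \<xi> + d \<xi>))\<^sup>2)"
        unfolding power2_eq_square by (intro bounded_supp_integrable bs)
      show "(\<psi> (\<xi> + ?s b) - \<psi> \<xi>)\<^sup>2 \<le> ((u (\<xi> + ?s b) + d (\<xi> + ?s b)) - (u \<xi> + d \<xi>))\<^sup>2" for \<xi>
        by (simp add: ud)
    qed
    also note difference_energy_add[OF bu bd]
    finally show ?thesis by simp
  qed
  have bS: "bounded_supp (\<lambda>\<xi>. d \<xi> * (u (\<xi> + ?s b) + u (\<xi> - ?s b) - 2 * u \<xi>))" for b
  proof -
    have "bounded_supp (\<lambda>\<xi>. u (\<xi> - ?s b))" using bounded_supp_translate[OF bu, of "- ?s b"] by (simp only: diff_conv_add_uminus)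
    then show ?thesis
      by (intro bounded_supp_mult'[OF bd] bounded_supp_diff[OF bounded_supp_add[OF bounded_supp_translate[OF bu]]]
          bounded_supp_cmult bu)
  qed
  have "(\<integral>\<xi>. d \<xi> * X \<xi> \<partial>lborel) * \<epsilon>\<^sup>2 =
     (\<integral>\<xi>. (\<Sum>b\<in>Basis. d \<xi> * (u (\<xi> + ?s b) + u (\<xi> - ?s b) - 2 * u \<xi>)) \<partial>lborel)"
    unfolding X using eps by (subst integral_mult_left_zero[symmetric]) (simp add: sum_distrib_left)
  also have "\<dots> = (\<Sum>b\<in>Basis. \<integral>\<xi>. d \<xi> * (u (\<xi> + ?s b) + u (\<xi> - ?s b) - 2 * u \<xi>) \<partial>lborel)"
    by (intro Bochner_Integration.integral_sum bounded_supp_integrable bS)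
  also have "\<dots> \<le> (\<Sum>b\<in>(Basis::'a set). 2 * (\<integral>\<xi>. (d \<xi>)\<^sup>2 \<partial>lborel))"
    by (intro sum_mono) (use each in force)
  finally have main: "(\<integral>\<xi>. d \<xi> * X \<xi> \<partial>lborel) * \<epsilon>\<^sup>2 \<le> 2 * real DIM('a) * (\<integral>\<xi>. (d \<xi>)\<^sup>2 \<partial>lborel)" by simp
  have idX: "integrable lborel (\<lambda>\<xi>. d \<xi> * X \<xi>)" and idd: "integrable lborel (\<lambda>\<xi>. (d \<xi>)\<^sup>2)"
    and iX: "integrable lborel (\<lambda>\<xi>. indicator D \<xi> * (X \<xi>)\<^sup>2)" and iD: "integrable lborel (indicator D :: _ \<Rightarrow> real)"
    unfolding power2_eq_square by (intro bounded_supp_integrable bs bX bD)+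
  have "0 \<le> (\<integral>\<xi>. 2 * real DIM('a) * (d \<xi>)\<^sup>2 - \<epsilon>\<^sup>2 * (d \<xi> * X \<xi>) \<partial>lborel)"
    using main idX idd by (simp add: mult.commute)
  also have "\<dots> \<le> (\<integral>\<xi>. \<epsilon>\<^sup>2 * \<tau> * (3 / (2 * a1) * indicator D \<xi> - a1 / 4 * (indicator D \<xi> * (X \<xi>)\<^sup>2)) \<partial>lborel)"
  proof (rule integral_mono)
    fix \<xi>
    show "2 * real DIM('a) * (d \<xi>)\<^sup>2 - \<epsilon>\<^sup>2 * (d \<xi> * X \<xi>)
        \<le> \<epsilon>\<^sup>2 * \<tau> * (3 / (2 * a1) * indicator D \<xi> - a1 / 4 * (indicator D \<xi> * (X \<xi>)\<^sup>2))"
    proof (cases "\<xi> \<in> D")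
      case True
      let ?a = "a \<xi>" and ?X = "X \<xi>" and ?g = "g \<xi>" and ?n = "real DIM('a)"
      have d: "d \<xi> = \<tau> * (?a * ?X + ?g)" using True by (simp add: d_def)
      \<comment> \<open>The quadratic error \<open>2 n d^2\<close> is to be absorbed by
        \<open>\<epsilon>^2 d X\<close>, whose main part is
        \<open>\<epsilon>^2 \<tau> a X^2\<close>. This inequality and the step size condition make
        the error at most half of \<open>\<epsilon>^2 \<tau> (a X^2 + g^2/a)\<close>.\<close>
      have sq: "(?a * ?X + ?g)\<^sup>2 \<le> 2 * ?a * (?a * ?X\<^sup>2 + ?g\<^sup>2 / ?a)"
      proof -
        have "2 * ?a * (?a * ?X\<^sup>2 + ?g\<^sup>2 / ?a) = 2 * (?a * ?X)\<^sup>2 + 2 * ?g\<^sup>2"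
          using a_pos[of \<xi>] by (simp add: field_simps power2_eq_square)
        then show ?thesis using zero_le_power2[of "?a * ?X - ?g"] by (simp add: power2_eq_square algebra_simps)
      qed
      have nn: "0 \<le> ?a * ?X\<^sup>2 + ?g\<^sup>2 / ?a" using a_pos[of \<xi>] by simp
      have "2 * ?n * (d \<xi>)\<^sup>2 = 2 * ?n * \<tau> * \<tau> * (?a * ?X + ?g)\<^sup>2" by (simp add: d power2_eq_square)
      also have "\<dots> \<le> 2 * ?n * \<tau> * \<tau> * (2 * ?a * (?a * ?X\<^sup>2 + ?g\<^sup>2 / ?a))"
        using tau by (intro mult_left_mono[OF sq]) auto
      also have "\<dots> = (2 * ?n * (\<tau> * ?a)) * (2 * \<tau> * (?a * ?X\<^sup>2 + ?g\<^sup>2 / ?a))" by (simp add: algebra_simps)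
      also have "\<dots> \<le> \<epsilon>\<^sup>2 / 4 * (2 * \<tau> * (?a * ?X\<^sup>2 + ?g\<^sup>2 / ?a))"
        using tau nn by (intro mult_right_mono[OF cfl']) auto
      also have "e / 4 * (2 * t * Y) = e * t * (Y / 2)" for e t Y :: real by simp
      finally have 1: "2 * ?n * (d \<xi>)\<^sup>2 \<le> \<epsilon>\<^sup>2 * \<tau> * ((?a * ?X\<^sup>2 + ?g\<^sup>2 / ?a) / 2)" .
      \<comment> \<open>Young's inequality for the mixed term uses a quarter of
        \<open>a X^2\<close>. With the half spent on the error a quarter remains, and the terms in
        \<open>g\<close> add up to \<open>3/2 g^2/a \<le> 3/(2 a1)\<close>.\<close>
      have "- (?g * ?X) \<le> ?a * ?X\<^sup>2 / 4 + ?g\<^sup>2 / ?a"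
        using a_pos[of \<xi>] zero_le_power2[of "?a * ?X / 2 + ?g"]
        by (simp add: field_simps power2_eq_square)
      moreover have "?g\<^sup>2 / ?a \<le> 1 / a1"
        using g(2,3)[of \<xi>] a(2)[of \<xi>] a1 by (intro frac_le) (auto simp: power_le_one)
      moreover have "3 / (2 * a1) = 3 / 2 * (1 / a1)" "a1 / 4 * ?X\<^sup>2 = (a1 * ?X\<^sup>2) / 4" by simp_all
      moreover have "a1 * ?X\<^sup>2 \<le> ?a * ?X\<^sup>2" using a(2) by (intro mult_right_mono) auto
      ultimately have 2: "(?a * ?X\<^sup>2 + ?g\<^sup>2 / ?a) / 2 - (?a * ?X\<^sup>2 + ?g * ?X) \<le> 3 / (2 * a1) - a1 / 4 * ?X\<^sup>2"
        by (simp only:) argo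
      have "2 * ?n * (d \<xi>)\<^sup>2 - \<epsilon>\<^sup>2 * (d \<xi> * X \<xi>)
        \<le> \<epsilon>\<^sup>2 * \<tau> * ((?a * ?X\<^sup>2 + ?g\<^sup>2 / ?a) / 2 - (?a * ?X\<^sup>2 + ?g * ?X))"
        using 1 by (simp add: d power2_eq_square algebra_simps)
      also have "\<dots> \<le> \<epsilon>\<^sup>2 * \<tau> * (3 / (2 * a1) - a1 / 4 * ?X\<^sup>2)"
        using tau by (intro mult_left_mono[OF 2]) auto
      finally show ?thesis using True by simp
    qed (simp add: d_def)
  qed (use idX idd iX iD in auto)
  also have "\<dots> = \<epsilon>\<^sup>2 * \<tau> * (3 / (2 * a1) * measure lborel D - a1 / 4 * (\<integral>\<xi>. indicator D \<xi> * (X \<xi>)\<^sup>2 \<partial>lborel))"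
    using iX iD by simp
  finally have fin: "0 \<le> \<epsilon>\<^sup>2 * \<tau> * (3 / (2 * a1) * measure lborel D - a1 / 4 * (\<integral>\<xi>. indicator D \<xi> * (X \<xi>)\<^sup>2 \<partial>lborel))" .
  have "0 \<le> 3 / (2 * a1) * measure lborel D - a1 / 4 * (\<integral>\<xi>. indicator D \<xi> * (X \<xi>)\<^sup>2 \<partial>lborel)"
  proof (rule ccontr)
    assume "\<not> ?thesis"
    then have "\<epsilon>\<^sup>2 * \<tau> * (3 / (2 * a1) * measure lborel D - a1 / 4 * (\<integral>\<xi>. indicator D \<xi> * (X \<xi>)\<^sup>2 \<partial>lborel)) < 0"
      using eps tau by (intro mult_pos_neg) auto
    then show False using fin by linarith
  qed
  then have "a1 / 4 * (\<integral>\<xi>. indicator D \<xi> * (X \<xi>)\<^sup>2 \<partial>lborel) \<le> 3 / (2 * a1) * measure lborel D" by linarith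
  then show ?thesis using a1 by (simp add: X_def field_simps power2_eq_square)
qed

end

subsection \<open>Comparison by duality\<close>

lemma bounded_supp_indicator_compact:
  fixes f :: "'a::euclidean_space \<Rightarrow> real"
  assumes C: "compact C" and f: "continuous_on C f"
  shows "bounded_supp (\<lambda>\<xi>. indicator C \<xi> * f \<xi>)"
proof -
  have "bounded (f ` C)" using compact_continuous_image[OF f C] by (rule compact_imp_bounded)
  then obtain K where K: "K > 0" "\<And>x. x \<in> C \<Longrightarrow> \<bar>f x\<bar> \<le> K" unfolding bounded_pos by auto
  have "(\<lambda>\<xi>. if \<xi> \<in> C then f \<xi> else 0) \<in> borel_measurable borel"
    by (rule borel_measurable_continuous_on_if) (use C f in \<open>auto simp: compact_imp_closed\<close>)
  moreover have "(\<lambda>\<xi>. if \<xi> \<in> C then f \<xi> else 0) = (\<lambda>\<xi>. indicator C \<xi> * f \<xi>)" by (auto simp: indicator_def)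
  ultimately show ?thesis
    by (intro bounded_suppI[of _ K C]) (use K C in \<open>auto simp: indicator_def compact_imp_bounded\<close>)
qed

lemma mollifier_average_le:
  fixes f :: "'a::euclidean_space \<Rightarrow> real"
  assumes f: "bounded_supp f" and t: "test_function (cball 0 \<delta>) \<rho>" and \<rho>: "\<And>x. 0 \<le> \<rho> x"
    "integrable lborel \<rho>" "integral\<^sup>L lborel \<rho> = 1" and u: "\<And>\<xi>. dist \<xi> \<zeta> \<le> \<delta> \<Longrightarrow> f \<xi> \<le> u"
  shows "(\<integral>\<xi>. f \<xi> * \<rho> (\<xi> - \<zeta>) \<partial>lborel) \<le> u"
proof -
  have m: "\<rho> \<in> borel_measurable borel" by (rule test_function_measurable[OF t])
  obtain E where E: "\<And>x. \<bar>\<rho> x\<bar> \<le> E" using test_function_bounded[OF t] by metis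
  have b\<rho>: "bounded_supp (\<lambda>\<xi>. \<rho> (\<xi> - \<zeta>))"
    using bounded_supp_translate[OF test_function_bounded_supp[OF t], of "- \<zeta>"] by simp
  have "(\<integral>\<xi>. f \<xi> * \<rho> (\<xi> - \<zeta>) \<partial>lborel) \<le> (\<integral>\<xi>. u * \<rho> (\<xi> - \<zeta>) \<partial>lborel)"
  proof (rule integral_mono)
    show "integrable lborel (\<lambda>\<xi>. f \<xi> * \<rho> (\<xi> - \<zeta>))"
      by (intro bounded_supp_integrable bounded_supp_mult' f b\<rho>)
    show "integrable lborel (\<lambda>\<xi>. u * \<rho> (\<xi> - \<zeta>))"
      by (intro bounded_supp_integrable bounded_supp_cmult b\<rho>)
    show "f \<xi> * \<rho> (\<xi> - \<zeta>) \<le> u * \<rho> (\<xi> - \<zeta>)" for \<xi>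
    proof (cases "dist \<xi> \<zeta> \<le> \<delta>")
      case True
      then show ?thesis using u \<rho>(1) by (intro mult_right_mono) auto
    next
      case False
      then have "\<xi> - \<zeta> \<notin> cball 0 \<delta>" by (simp add: dist_norm norm_minus_commute)
      then have "\<xi> - \<zeta> \<notin> closure {x. \<rho> x \<noteq> 0}" using t unfolding test_function_def by blast
      from zero_off_support[OF this] show ?thesis by simp
    qed
  qed
  also have "\<dots> = u * (\<integral>\<xi>. \<rho> (\<xi> + (- \<zeta>)) \<partial>lborel)" by simp
  also have "\<dots> = u" by (subst integral_translate[OF m]) (simp add: \<rho>)
  finally show ?thesis .
qed

text \<open>\<open>integral_mult_mollify\<close> summed over the translates in the two difference
  operators: differences of the mollified \<psi> tested against \<open>z\<close> and
  \<open>w\<close> are differences of \<psi> itself, to which the scheme applies, tested against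
  averages of \<open>z\<close> and \<open>w\<close>.\<close>

lemma integral_mult_mollify_differences:
  fixes z w \<psi> :: "'a::euclidean_space \<times> real \<Rightarrow> real"
  assumes z: "bounded_supp z" and w: "bounded_supp w" and \<psi>: "bounded_supp \<psi>" and t: "test_function S \<rho>"
  defines "m \<equiv> \<lambda>f \<zeta>. \<integral>\<xi>. f \<xi> * \<rho> (\<xi> - \<zeta>) \<partial>lborel"
  shows "(\<integral>\<xi>. z \<xi> * ((mollify \<rho> \<psi> (\<xi> + (0, \<tau>)) - mollify \<rho> \<psi> \<xi>) / \<tau>)
        + w \<xi> * second_diff \<epsilon> (mollify \<rho> \<psi>) (\<xi> + (0, \<tau>)) \<partial>lborel) =
      (\<integral>\<zeta>. m z \<zeta> * ((\<psi> (\<zeta> + (0, \<tau>)) - \<psi> \<zeta>) / \<tau>) + m w \<zeta> * second_diff \<epsilon> \<psi> (\<zeta> + (0, \<tau>)) \<partial>lborel)"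
    and "integrable lborel (\<lambda>\<xi>. z \<xi> * ((mollify \<rho> \<psi> (\<xi> + (0, \<tau>)) - mollify \<rho> \<psi> \<xi>) / \<tau>)
        + w \<xi> * second_diff \<epsilon> (mollify \<rho> \<psi>) (\<xi> + (0, \<tau>)))"
    and "integrable lborel (\<lambda>\<zeta>. m z \<zeta> * ((\<psi> (\<zeta> + (0, \<tau>)) - \<psi> \<zeta>) / \<tau>)
        + m w \<zeta> * second_diff \<epsilon> \<psi> (\<zeta> + (0, \<tau>)))"
proof -
  have m: "(\<integral>\<xi>. f \<xi> * \<rho> (\<xi> - \<zeta>) \<partial>lborel) = m f \<zeta>" for f \<zeta> by (simp add: m_def)
  note iz = integral_mult_mollify[OF z \<psi> t, unfolded m]
  note iw = integral_mult_mollify[OF w \<psi> t, unfolded m]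
  note bz = bounded_supp_integrable[OF iz(2)] note bw = bounded_supp_integrable[OF iw(2)]
  have z0: "(\<integral>\<xi>. z \<xi> * mollify \<rho> \<psi> \<xi> \<partial>lborel) = (\<integral>\<zeta>. m z \<zeta> * \<psi> \<zeta> \<partial>lborel)"
    "integrable lborel (\<lambda>\<xi>. z \<xi> * mollify \<rho> \<psi> \<xi>)" "integrable lborel (\<lambda>\<zeta>. m z \<zeta> * \<psi> \<zeta>)"
    using iz(1)[of 0] bz[of 0] iz(3)[of 0] by simp_all
  let ?p = "\<lambda>b::'a. (0, \<tau>) + (\<epsilon> *\<^sub>R b, 0::real)" and ?q = "\<lambda>b::'a. (0, \<tau>) - (\<epsilon> *\<^sub>R b, 0::real)"
  have expand: "f \<xi> * ((h (\<xi> + (0, \<tau>)) - h \<xi>) / \<tau>) + k \<xi> * second_diff \<epsilon> h (\<xi> + (0, \<tau>)) =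
      (f \<xi> * h (\<xi> + (0, \<tau>)) - f \<xi> * h \<xi>) / \<tau> +
      (\<Sum>b\<in>Basis. k \<xi> * h (\<xi> + ?p b) + k \<xi> * h (\<xi> + ?q b) - 2 * (k \<xi> * h (\<xi> + (0, \<tau>)))) / \<epsilon>\<^sup>2"
    for f h k :: "'a \<times> real \<Rightarrow> real" and \<xi>
  proof -
    have "second_diff \<epsilon> h (\<xi> + (0, \<tau>)) = (\<Sum>b\<in>Basis. h (\<xi> + ?p b) + h (\<xi> + ?q b) - 2 * h (\<xi> + (0, \<tau>))) / \<epsilon>\<^sup>2"
      unfolding second_diff_def by (simp only: add.assoc add_diff_eq)
    then have "k \<xi> * second_diff \<epsilon> h (\<xi> + (0, \<tau>)) = (\<Sum>b\<in>Basis. k \<xi> * (h (\<xi> + ?p b) + h (\<xi> + ?q b) - 2 * h (\<xi> + (0, \<tau>)))) / \<epsilon>\<^sup>2"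
      by (simp only: times_divide_eq_right sum_distrib_left)
    also have "\<dots> = (\<Sum>b\<in>Basis. k \<xi> * h (\<xi> + ?p b) + k \<xi> * h (\<xi> + ?q b) - 2 * (k \<xi> * h (\<xi> + (0, \<tau>)))) / \<epsilon>\<^sup>2"
      by (simp only: distrib_left right_diff_distrib mult.left_commute[of "k \<xi>"])
    finally show ?thesis by (simp add: right_diff_distrib)
  qed
  have int1: "integrable lborel (\<lambda>\<xi>. (z \<xi> * mollify \<rho> \<psi> (\<xi> + (0, \<tau>)) - z \<xi> * mollify \<rho> \<psi> \<xi>) / \<tau>)"
    "integrable lborel (\<lambda>\<xi>. (m z \<xi> * \<psi> (\<xi> + (0, \<tau>)) - m z \<xi> * \<psi> \<xi>) / \<tau>)"
    by (intro integrable_divide Bochner_Integration.integrable_diff bz iz(3) z0)+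
  have int2: "integrable lborel (\<lambda>\<xi>. w \<xi> * mollify \<rho> \<psi> (\<xi> + ?p b) + w \<xi> * mollify \<rho> \<psi> (\<xi> + ?q b) - 2 * (w \<xi> * mollify \<rho> \<psi> (\<xi> + (0, \<tau>))))"
    "integrable lborel (\<lambda>\<xi>. m w \<xi> * \<psi> (\<xi> + ?p b) + m w \<xi> * \<psi> (\<xi> + ?q b) - 2 * (m w \<xi> * \<psi> (\<xi> + (0, \<tau>))))" for b
    by (intro Bochner_Integration.integrable_diff Bochner_Integration.integrable_add integrable_mult_right bw iw(3))+
  have int3: "integrable lborel (\<lambda>\<xi>. (\<Sum>b\<in>Basis. w \<xi> * mollify \<rho> \<psi> (\<xi> + ?p b) + w \<xi> * mollify \<rho> \<psi> (\<xi> + ?q b) - 2 * (w \<xi> * mollify \<rho> \<psi> (\<xi> + (0, \<tau>)))) / \<epsilon>\<^sup>2)"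
    "integrable lborel (\<lambda>\<xi>. (\<Sum>b\<in>Basis. m w \<xi> * \<psi> (\<xi> + ?p b) + m w \<xi> * \<psi> (\<xi> + ?q b) - 2 * (m w \<xi> * \<psi> (\<xi> + (0, \<tau>)))) / \<epsilon>\<^sup>2)"
    by (intro integrable_divide Bochner_Integration.integrable_sum int2)+
  show "integrable lborel (\<lambda>\<xi>. z \<xi> * ((mollify \<rho> \<psi> (\<xi> + (0, \<tau>)) - mollify \<rho> \<psi> \<xi>) / \<tau>)
        + w \<xi> * second_diff \<epsilon> (mollify \<rho> \<psi>) (\<xi> + (0, \<tau>)))"
    unfolding expand by (intro Bochner_Integration.integrable_add int1 int3)
  show "integrable lborel (\<lambda>\<zeta>. m z \<zeta> * ((\<psi> (\<zeta> + (0, \<tau>)) - \<psi> \<zeta>) / \<tau>)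
        + m w \<zeta> * second_diff \<epsilon> \<psi> (\<zeta> + (0, \<tau>)))"
    unfolding expand by (intro Bochner_Integration.integrable_add int1 int3)
  have e1: "(\<integral>\<xi>. (z \<xi> * mollify \<rho> \<psi> (\<xi> + (0, \<tau>)) - z \<xi> * mollify \<rho> \<psi> \<xi>) / \<tau> \<partial>lborel)
     = (\<integral>\<xi>. (m z \<xi> * \<psi> (\<xi> + (0, \<tau>)) - m z \<xi> * \<psi> \<xi>) / \<tau> \<partial>lborel)"
    by (simp add: Bochner_Integration.integral_diff[OF bz z0(2)] Bochner_Integration.integral_diff[OF iz(3) z0(3)] iz(1) z0(1))
  have e2: "(\<integral>\<xi>. w \<xi> * mollify \<rho> \<psi> (\<xi> + ?p b) + w \<xi> * mollify \<rho> \<psi> (\<xi> + ?q b) - 2 * (w \<xi> * mollify \<rho> \<psi> (\<xi> + (0, \<tau>))) \<partial>lborel)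
     = (\<integral>\<xi>. m w \<xi> * \<psi> (\<xi> + ?p b) + m w \<xi> * \<psi> (\<xi> + ?q b) - 2 * (m w \<xi> * \<psi> (\<xi> + (0, \<tau>))) \<partial>lborel)" for b
    by (subst Bochner_Integration.integral_diff Bochner_Integration.integral_add,
        (intro Bochner_Integration.integrable_add integrable_mult_right bw iw(3))+)+
       (simp only: integral_mult_right_zero iw(1))
  have e3: "(\<integral>\<xi>. (\<Sum>b\<in>Basis. w \<xi> * mollify \<rho> \<psi> (\<xi> + ?p b) + w \<xi> * mollify \<rho> \<psi> (\<xi> + ?q b) - 2 * (w \<xi> * mollify \<rho> \<psi> (\<xi> + (0, \<tau>)))) / \<epsilon>\<^sup>2 \<partial>lborel)
     = (\<integral>\<xi>. (\<Sum>b\<in>Basis. m w \<xi> * \<psi> (\<xi> + ?p b) + m w \<xi> * \<psi> (\<xi> + ?q b) - 2 * (m w \<xi> * \<psi> (\<xi> + (0, \<tau>)))) / \<epsilon>\<^sup>2 \<partial>lborel)"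
    by (simp only: integral_divide_zero Bochner_Integration.integral_sum[OF int2(1)] Bochner_Integration.integral_sum[OF int2(2)] e2)
  show "(\<integral>\<xi>. z \<xi> * ((mollify \<rho> \<psi> (\<xi> + (0, \<tau>)) - mollify \<rho> \<psi> \<xi>) / \<tau>)
        + w \<xi> * second_diff \<epsilon> (mollify \<rho> \<psi>) (\<xi> + (0, \<tau>)) \<partial>lborel) =
      (\<integral>\<zeta>. m z \<zeta> * ((\<psi> (\<zeta> + (0, \<tau>)) - \<psi> \<zeta>) / \<tau>) + m w \<zeta> * second_diff \<epsilon> \<psi> (\<zeta> + (0, \<tau>)) \<partial>lborel)"
    unfolding expand
    by (simp only: Bochner_Integration.integral_add[OF int1(1) int3(1)] Bochner_Integration.integral_add[OF int1(2) int3(2)] e1 e3)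
qed

lemma bounded_supp_max_0:
  assumes "bounded_supp f" shows "bounded_supp (\<lambda>x. max 0 (f x))"
proof (rule bounded_suppE[OF assms])
  fix C A assume *: "C > 0" "\<And>x. \<bar>f x\<bar> \<le> C" "bounded A" "\<And>x. x \<notin> A \<Longrightarrow> f x = 0" "f \<in> borel_measurable borel"
  show ?thesis
  proof (rule bounded_suppI[of _ C A])
    show "\<bar>max 0 (f x)\<bar> \<le> C" for x using *(1) *(2)[of x] by (auto simp: max_def)
  qed (use * in auto)
qed

lemma mollifier_average_ge:
  fixes f :: "'a::euclidean_space \<Rightarrow> real"
  assumes "bounded_supp f" "test_function (cball 0 \<delta>) \<rho>" "\<And>x. 0 \<le> \<rho> x"
    "integrable lborel \<rho>" "integral\<^sup>L lborel \<rho> = 1" and "\<And>\<xi>. dist \<xi> \<zeta> \<le> \<delta> \<Longrightarrow> l \<le> f \<xi>"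
  shows "l \<le> (\<integral>\<xi>. f \<xi> * \<rho> (\<xi> - \<zeta>) \<partial>lborel)"
  using mollifier_average_le[of "\<lambda>\<xi>. - f \<xi>" \<delta> \<rho> \<zeta> "- l"] assms bounded_supp_cmult[of f "-1"] by simp

section \<open>The duality argument\<close>

text \<open>\<open>ratio\<close> is stated by existence since the quotient has no value where
  \<open>z\<close> vanishes; it also says that \<open>w\<close> vanishes there. \<open>neg\<close>
  is strict so that compactness yields a collar in which \<open>z\<close> is uniformly
  negative.\<close>

locale comparison_pair =
  fixes U :: "'a::euclidean_space set" and t1 t2 a1 a2 :: real and z w :: "'a \<times> real \<Rightarrow> real"
  assumes U: "bounded U" "open U" and a1: "0 < a1"
    and cont: "continuous_on (closure U \<times> {t1..t2}) z" "continuous_on (closure U \<times> {t1..t2}) w"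
    and ratio: "\<And>\<xi>. \<xi> \<in> closure U \<times> {t1..t2} \<Longrightarrow> \<exists>a. a1 \<le> a \<and> a \<le> a2 \<and> w \<xi> = a * z \<xi>"
    and neg: "\<And>\<xi>. \<xi> \<in> parabolic_boundary U t1 t2 \<Longrightarrow> z \<xi> < 0"
    and weak: "\<And>\<eta>. test_function (cylinder U t1 t2) \<eta> \<Longrightarrow> (\<And>\<xi>. 0 \<le> \<eta> \<xi>) \<Longrightarrow>
      0 \<le> (\<integral>\<xi>. indicator (cylinder U t1 t2) \<xi> *
        (z \<xi> * partial_deriv (0, 1) \<eta> \<xi> + w \<xi> * laplacian \<eta> \<xi>) \<partial>lborel)"
begin

abbreviation "C \<equiv> closure U \<times> {t1..t2}"

lemma compact_C: "compact C"
  using U by (intro compact_Times) (auto simp: compact_closure)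

definition "zb = (\<lambda>\<xi>. indicator C \<xi> * z \<xi>)"
definition "wb = (\<lambda>\<xi>. indicator C \<xi> * w \<xi>)"

lemma bounded_supp_zb: "bounded_supp zb" and bounded_supp_wb: "bounded_supp wb"
  unfolding zb_def wb_def by (intro bounded_supp_indicator_compact compact_C cont)+

text \<open>The factor 4 is a budget: the scheme will live at distance at least \<open>2 s\<close>
  from the complement of \<open>U\<close> and from the ends of the time interval, and both the reach
  of one step and the radius of the mollifier stay below \<open>s\<close>.\<close>

lemma negative_near_boundary:
  obtains \<kappa> s where "0 < \<kappa>" "0 < s"
    "\<And>\<xi>. \<xi> \<in> C \<Longrightarrow> snd \<xi> \<le> t1 + 4 * s \<or> infdist (fst \<xi>) (- U) \<le> 4 * s \<Longrightarrow> z \<xi> \<le> - \<kappa>"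
proof -
  \<comment> \<open>The parabolic boundary, with the corner at time \<open>t1\<close> counted twice
    so that both pieces are visibly compact.\<close>
  let ?G = "closure U \<times> {t1} \<union> frontier U \<times> {t1..t2}"
  show thesis
  proof (cases "t1 \<le> t2 \<and> U \<noteq> {}")
    case False
    then show ?thesis by (intro that[of 1 1]) auto
  next
    case ne: True
    have comp: "compact ?G"
      using U by (intro compact_Un compact_Times compact_frontier_bounded) (auto simp: compact_closure)
    have sub: "?G \<subseteq> C" using ne by (auto simp: frontier_def)
    have negG: "z \<xi> < 0" if "\<xi> \<in> ?G" for \<xi>
    proof (rule neg)
      show "\<xi> \<in> parabolic_boundary U t1 t2"
        using that by (cases \<xi>) (auto simp: parabolic_boundary_def frontier_def not_le)
    qed
    have "?G \<noteq> {}" using ne closure_subset by auto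
    then obtain \<zeta> where \<zeta>: "\<zeta> \<in> ?G" "\<And>\<xi>. \<xi> \<in> ?G \<Longrightarrow> z \<xi> \<le> z \<zeta>"
      using continuous_attains_sup[OF comp _ continuous_on_subset[OF cont(1) sub]] by blast
    define \<kappa> where "\<kappa> = - z \<zeta> / 2"
    have \<kappa>: "\<kappa> > 0" using negG[OF \<zeta>(1)] by (simp add: \<kappa>_def)
    obtain d where d: "d > 0" "\<And>\<xi> \<eta>. \<xi> \<in> C \<Longrightarrow> \<eta> \<in> C \<Longrightarrow> dist \<eta> \<xi> < d \<Longrightarrow> dist (z \<eta>) (z \<xi>) < \<kappa>"
      using compact_uniformly_continuous[OF cont(1) compact_C] \<kappa>
      by (elim uniformly_continuous_onE) blast+
    have near: "z \<xi> \<le> - \<kappa>" if "\<xi> \<in> C" "\<eta> \<in> ?G" "dist \<eta> \<xi> < d" for \<xi> \<eta>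
    proof -
      have "dist (z \<eta>) (z \<xi>) < \<kappa>" using d(2) that sub by blast
      moreover have "z \<eta> \<le> - 2 * \<kappa>" using \<zeta>(2)[OF that(2)] by (simp add: \<kappa>_def)
      ultimately show ?thesis by (auto simp: dist_real_def)
    qed
    define s where "s = d / 5"
    have s: "0 < s" "4 * s < d" using d(1) by (auto simp: s_def)
    show ?thesis
    proof (rule that[OF \<kappa> s(1)])
      fix \<xi> assume \<xi>: "\<xi> \<in> C" and close: "snd \<xi> \<le> t1 + 4 * s \<or> infdist (fst \<xi>) (- U) \<le> 4 * s"
      obtain x t where xt: "\<xi> = (x, t)" by (cases \<xi>)
      show "z \<xi> \<le> - \<kappa>"
        using close
      proof
        assume "snd \<xi> \<le> t1 + 4 * s"
        then show ?thesis using \<xi> s xt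
          by (intro near[of \<xi> "(x, t1)"]) (auto simp: dist_Pair_Pair dist_real_def)
      next
        assume "infdist (fst \<xi>) (- U) \<le> 4 * s"
        moreover have "U \<noteq> UNIV" using U(1) not_bounded_UNIV by blast
        then have "- U \<noteq> {}" by auto
        then obtain y where y: "y \<in> - U" "infdist x (- U) = dist x y"
          using infdist_attains_inf[of "- U" x] U(2) by (auto simp: closed_Compl)
        ultimately have dy: "dist x y \<le> 4 * s" using xt by simp
        \<comment> \<open>A frontier point no farther than \<open>y\<close> lies on the segment from
          \<open>x\<close> to \<open>y\<close>, or is \<open>x\<close> itself when \<open>x\<close>
          already lies outside \<open>U\<close>.\<close>
        obtain p where p: "p \<in> frontier U" "dist x p \<le> dist x y"
        proof (cases "x \<in> U")
          case True
          then have "closed_segment x y \<inter> frontier U \<noteq> {}"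
            using y(1) by (intro connected_Int_frontier) auto
          then obtain p where p: "p \<in> closed_segment x y" "p \<in> frontier U" by blast
          moreover have "dist x p \<le> dist x y"
            using segment_bound(1)[OF p(1)] by (simp add: dist_norm norm_minus_commute)
          ultimately show ?thesis using that by blast
        next
          case False
          then have "x \<in> frontier U" using \<xi> xt U(2) by (auto simp: frontier_def interior_open)
          then show ?thesis using that[of x] by simp
        qed
        show ?thesis using \<xi> s xt p dy
          by (intro near[of \<xi> "(p, t)"]) (auto simp: dist_Pair_Pair dist_commute)
      qed
    qed
  qed
qed

text \<open>With the indicator of the set where \<open>z\<close> is positive as the source of the
  dual problem, testing with the dual solution produces the integral of the positive part of
  \<open>z\<close>, up to errors that can be made arbitrarily small.\<close>

lemma dual_bound:
  assumes \<kappa>: "0 < \<kappa>" and s: "0 < s" "t1 + 2 * s < t2 - 2 * s"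
    and near: "\<And>\<xi>. \<xi> \<in> C \<Longrightarrow> snd \<xi> \<le> t1 + 4 * s \<or> infdist (fst \<xi>) (- U) \<le> 4 * s \<Longrightarrow> z \<xi> \<le> - \<kappa>"
  shows "(\<integral>\<xi>. indicator ({x. 2 * s \<le> infdist x (- U)} \<times> {t1 + 2 * s..<t2 - 2 * s}) \<xi> * max 0 (zb \<xi>) \<partial>lborel) \<le> 0"
proof -
  define B where "B = {x. 2 * s \<le> infdist x (- U)}"
  define t0 where "t0 = t1 + 2 * s"
  define T where "T = t2 - 2 * s"
  define D where "D = B \<times> {t0..<T}"
  define G where "G = (\<integral>\<xi>. indicator D \<xi> * max 0 (zb \<xi>) \<partial>lborel)"
  have t0T: "t0 < T" using s by (simp add: t0_def T_def)
  have inU: "x \<in> U" if "0 < infdist x (- U)" for x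
    using that infdist_zero[of x "- U"] by (cases "x \<in> U") auto
  have BU: "B \<subseteq> U" using inU s by (auto simp: B_def)
  have Bclosed: "closed B" unfolding B_def by (intro closed_Collect_le continuous_intros)
  have Bb: "bounded B" "B \<in> sets borel" using BU U(1) bounded_subset Bclosed by (auto intro: borel_closed)
  have Dm: "D \<in> sets borel" unfolding D_def using Bb by (simp add: borel_prod[symmetric])
  have Db: "bounded D" unfolding D_def using Bb by (intro bounded_Times) auto
  have bD: "bounded_supp (indicator D :: 'a \<times> real \<Rightarrow> real)"
    by (rule bounded_suppI[of _ 1 D]) (use Db Dm in \<open>auto simp: indicator_def\<close>)
  define n where "n = real DIM('a)"
  have n: "n > 0" by (simp add: n_def)
  define g where "g = (\<lambda>\<xi>. if 0 < zb \<xi> then 1 else 0 :: real)"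
  \<comment> \<open>The default \<open>a1\<close> keeps the bounds at zeros of \<open>zb\<close>,
    where \<open>wb\<close> vanishes too; thus \<open>wb = aa zb\<close> everywhere, also outside
    the cylinder.\<close>
  define aa where "aa = (\<lambda>\<xi>. if zb \<xi> \<noteq> 0 then wb \<xi> / zb \<xi> else a1)"
  have zm [measurable]: "zb \<in> borel_measurable borel" "wb \<in> borel_measurable borel"
    using bounded_supp_zb bounded_supp_wb by (auto simp: bounded_supp_def)
  obtain W where W: "W > 0" "\<And>\<xi>. \<bar>wb \<xi>\<bar> \<le> W" using bounded_suppE[OF bounded_supp_wb] by metis
  \<comment> \<open>The constants of all error terms, independent of \<epsilon>, \<tau> and
    \<delta>: the first summand comes from the averaging and the energy bound, the second from
    replacing derivatives by differences. Its factor \<open>T - t0 + 1\<close> bounds \<psi>, as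
    \<tau> < 1.\<close>
  define M where "M = measure lborel D * (1 + (1 + a2) * (1 + 6 / a1\<^sup>2))
    + (\<integral>\<xi>. \<bar>zb \<xi>\<bar> + \<bar>wb \<xi>\<bar> \<partial>lborel) * ((T - t0 + 1) * measure lborel D)"
  \<comment> \<open>\<theta> is the common tolerance for the oscillation of \<open>z\<close> and
    \<open>w\<close> and for the difference quotients of the kernel.\<close>
  have est: "G \<le> \<theta> * M" if \<theta>: "\<theta> > 0" and "C \<noteq> {}" for \<theta>
  proof -
    have a12: "a1 \<le> a2" using ratio \<open>C \<noteq> {}\<close> by fastforce
    have aa: "a1 \<le> aa \<xi>" "aa \<xi> \<le> a2" "wb \<xi> = aa \<xi> * zb \<xi>" for \<xi>
    proof -
      have "a1 \<le> aa \<xi> \<and> aa \<xi> \<le> a2 \<and> wb \<xi> = aa \<xi> * zb \<xi>"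
      proof (cases "\<xi> \<in> C")
        case True
        with ratio obtain a where "a1 \<le> a" "a \<le> a2" "w \<xi> = a * z \<xi>" by blast
        then show ?thesis using True a12 by (auto simp: aa_def zb_def wb_def)
      next
        case False
        then show ?thesis using a12 by (simp add: aa_def zb_def wb_def)
      qed
      then show "a1 \<le> aa \<xi>" "aa \<xi> \<le> a2" "wb \<xi> = aa \<xi> * zb \<xi>" by auto
    qed
    have a2: "a2 > 0" using a1 a12 by simp
    obtain dz where dz: "dz > 0" "\<And>\<xi> \<eta>. \<xi> \<in> C \<Longrightarrow> \<eta> \<in> C \<Longrightarrow> dist \<eta> \<xi> < dz \<Longrightarrow> dist (z \<eta>) (z \<xi>) < \<theta>"
      using compact_uniformly_continuous[OF cont(1) compact_C] \<theta>
      by (elim uniformly_continuous_onE) blast+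
    obtain dw where dw: "dw > 0" "\<And>\<xi> \<eta>. \<xi> \<in> C \<Longrightarrow> \<eta> \<in> C \<Longrightarrow> dist \<eta> \<xi> < dw \<Longrightarrow> dist (w \<eta>) (w \<xi>) < \<theta>"
      using compact_uniformly_continuous[OF cont(2) compact_C] \<theta>
      by (elim uniformly_continuous_onE) blast+
    \<comment> \<open>Below \<open>s\<close> to stay inside the cylinder, and below both moduli of
      continuity so that averages of \<open>z\<close> and \<open>w\<close> over a \<delta>-ball are
      within \<theta> of the values at the centre.\<close>
    define \<delta> where "\<delta> = min s (min dz dw) / 2"
    have \<delta>: "0 < \<delta>" "\<delta> < s" "\<delta> < dz" "\<delta> < dw" using s dz(1) dw(1) by (auto simp: \<delta>_def)
    obtain \<rho> :: "'a \<times> real \<Rightarrow> real" where \<rho>: "test_function (cball 0 \<delta>) \<rho>" "\<And>x. 0 \<le> \<rho> x"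
      "integrable lborel \<rho>" "integral\<^sup>L lborel \<rho> = 1"
      using mollifier_exists[OF \<delta>(1)] by metis
    obtain d where d: "d > 0" "\<And>\<epsilon> \<tau> \<psi> \<xi>. 0 < \<epsilon> \<Longrightarrow> \<epsilon> < d \<Longrightarrow> 0 < \<tau> \<Longrightarrow> \<tau> < d \<Longrightarrow> bounded_supp \<psi> \<Longrightarrow>
      \<bar>second_diff \<epsilon> (mollify \<rho> \<psi>) (\<xi> + (0, \<tau>)) - laplacian (mollify \<rho> \<psi>) \<xi>\<bar> \<le> \<theta> * (\<integral>\<zeta>. \<bar>\<psi> \<zeta>\<bar> \<partial>lborel) \<and>
      \<bar>(mollify \<rho> \<psi> (\<xi> + (0, \<tau>)) - mollify \<rho> \<psi> \<xi>) / \<tau> - partial_deriv (0, 1) (mollify \<rho> \<psi>) \<xi>\<bar>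
        \<le> \<theta> * (\<integral>\<zeta>. \<bar>\<psi> \<zeta>\<bar> \<partial>lborel)"
      using mollify_approx[OF \<rho>(1) \<theta>] by metis
    define \<epsilon> where "\<epsilon> = min (min d s) 1 / 2"
    \<comment> \<open>The three entries give, in this order: \<tau> \<le> \<epsilon>^2 \<le>
      \<epsilon>, the step size condition of the scheme, and \<open>side\<close>, by which the terms
      outside \<open>D\<close> get their sign.\<close>
    define c where "c = min 1 (min (1 / (8 * n * a2)) (\<kappa> / (2 * n * W)))"
    define \<tau> where "\<tau> = c * \<epsilon>\<^sup>2"
    have \<epsilon>: "0 < \<epsilon>" "\<epsilon> < d" "\<epsilon> < s" "\<epsilon> < 1" using d(1) s by (auto simp: \<epsilon>_def)
    have c: "0 < c" "c \<le> 1" "c \<le> 1 / (8 * n * a2)" "c \<le> \<kappa> / (2 * n * W)"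
      using n a2 \<kappa> W(1) by (auto simp: c_def)
    have "\<tau> \<le> \<epsilon>"
      using mult_mono[of c 1 "\<epsilon>\<^sup>2" \<epsilon>] c \<epsilon> by (simp add: \<tau>_def power2_eq_square mult_left_le_one_le)
    then have \<tau>: "0 < \<tau>" "\<tau> < d" "\<tau> < s" "\<tau> < 1" using c(1) \<epsilon> by (auto simp: \<tau>_def)
    have "8 * n * a2 * c \<le> 1" using c(3) n a2 by (simp add: field_simps)
    then have cfl: "8 * real DIM('a) * a2 * \<tau> \<le> \<epsilon>\<^sup>2"
      using mult_right_mono[of "8 * n * a2 * c" 1 "\<epsilon>\<^sup>2"] by (simp add: \<tau>_def n_def mult.assoc)
    have "2 * n * W * c \<le> \<kappa>" using c(4) n W by (simp add: field_simps)
    then have side: "2 * n * W * \<tau> \<le> \<kappa> * \<epsilon>\<^sup>2"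
      using mult_right_mono[of "2 * n * W * c" \<kappa> "\<epsilon>\<^sup>2"] by (simp add: \<tau>_def mult.assoc)
    have [measurable]: "aa \<in> borel_measurable borel" "g \<in> borel_measurable borel"
      unfolding aa_def g_def by measurable
    interpret dual_scheme B t0 T \<epsilon> \<tau> a1 a2 aa g
      by unfold_locales (use Bb t0T \<epsilon> \<tau> a1 aa cfl in \<open>auto simp: g_def\<close>)
    obtain \<psi> where \<psi>: "bounded_supp \<psi>" "\<And>\<xi>. 0 \<le> \<psi> \<xi>" "\<And>\<xi>. \<psi> \<xi> \<le> T - t0 + \<tau>"
      "\<And>\<xi>. \<xi> \<notin> B \<times> {t0..<T} \<Longrightarrow> \<psi> \<xi> = 0" "step \<psi> = \<psi>"
      using dual_exists by metis
    have \<psi>D: "\<psi> \<xi> = 0" if "\<xi> \<notin> D" for \<xi> using \<psi>(4) that by (simp add: D_def)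
    define X where "X = (\<lambda>\<xi>. second_diff \<epsilon> \<psi> (\<xi> + (0, \<tau>)))"
    have bX: "bounded_supp X" unfolding X_def by (rule bounded_supp_second_diff[OF \<psi>(1)])
    have energy: "(\<integral>\<xi>. indicator D \<xi> * (X \<xi>)\<^sup>2 \<partial>lborel) \<le> 6 / a1\<^sup>2 * measure lborel D"
      unfolding X_def D_def by (rule energy_estimate[OF \<psi>(1,4,5)])
    have stepD: "\<psi> \<xi> = \<psi> (\<xi> + (0, \<tau>)) + \<tau> * (aa \<xi> * X \<xi> + g \<xi>)" if "\<xi> \<in> D" for \<xi>
      using step_in[of \<xi> \<psi>] that \<psi>(5) by (simp add: D_def X_def)

    define \<eta> where "\<eta> = mollify \<rho> \<psi>"
    define zd where "zd = (\<lambda>\<zeta>. \<integral>\<xi>. zb \<xi> * \<rho> (\<xi> - \<zeta>) \<partial>lborel)"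
    define wd where "wd = (\<lambda>\<zeta>. \<integral>\<xi>. wb \<xi> * \<rho> (\<xi> - \<zeta>) \<partial>lborel)"
    define I where "I = (\<integral>\<zeta>. \<bar>\<psi> \<zeta>\<bar> \<partial>lborel)"
    have I: "0 \<le> I" "I \<le> (T - t0 + 1) * measure lborel D"
    proof -
      show "0 \<le> I" by (simp add: I_def)
      have "I \<le> (\<integral>\<zeta>. (T - t0 + 1) * indicator D \<zeta> \<partial>lborel)"
        unfolding I_def
      proof (rule integral_mono)
        show "\<bar>\<psi> \<zeta>\<bar> \<le> (T - t0 + 1) * indicator D \<zeta>" for \<zeta>
          using \<psi>(2,3)[of \<zeta>] \<psi>D[of \<zeta>] \<tau> by (auto simp: indicator_def)
      qed (use \<psi>(1) bD bounded_supp_integrable in auto)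
      then show "I \<le> (T - t0 + 1) * measure lborel D" using Dm by simp
    qed
    have test: "test_function (cylinder U t1 t2) \<eta>"
      unfolding \<eta>_def
    proof (rule test_function_mollify[OF \<psi>(1) \<rho>(1), where K = "B \<times> {t0..T}"])
      show "compact (B \<times> {t0..T})" using Bclosed Bb by (intro compact_Times) (auto simp: compact_eq_bounded_closed)
      show "\<psi> \<zeta> = 0" if "\<zeta> \<notin> B \<times> {t0..T}" for \<zeta> using that by (intro \<psi>(4)) auto
      fix \<xi> \<zeta> :: "'a \<times> real" assume \<zeta>: "\<zeta> \<in> B \<times> {t0..T}" "dist \<xi> \<zeta> \<le> \<delta>"
      have "infdist (fst \<zeta>) (- U) \<le> infdist (fst \<xi>) (- U) + dist (fst \<zeta>) (fst \<xi>)" by (rule infdist_triangle)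
      moreover have "dist (fst \<zeta>) (fst \<xi>) \<le> \<delta>" "dist (snd \<xi>) (snd \<zeta>) \<le> \<delta>"
        using \<zeta>(2) dist_fst_le[of \<xi> \<zeta>] dist_snd_le[of \<xi> \<zeta>] by (auto simp: dist_commute)
      moreover have "2 * s \<le> infdist (fst \<zeta>) (- U)" "t0 \<le> snd \<zeta>" "snd \<zeta> \<le> T" using \<zeta>(1) by (auto simp: B_def)
      ultimately have "0 < infdist (fst \<xi>) (- U)" "t1 < snd \<xi>" "snd \<xi> < t2"
        using \<delta> s by (auto simp: dist_real_def t0_def T_def)
      then show "\<xi> \<in> cylinder U t1 t2" using inU by (cases \<xi>) (auto simp: cylinder_def)
    qed
    have \<eta>0: "0 \<le> \<eta> \<xi>" for \<xi> unfolding \<eta>_def mollify_def using \<psi>(2) \<rho>(2) by (intro integral_nonneg_AE) auto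
    have cylC: "cylinder U t1 t2 \<subseteq> C" using closure_subset by (auto simp: cylinder_def)
    have t\<eta>: "test_function (cylinder U t1 t2) (partial_deriv (0, 1) \<eta>)"
      by (rule test_function_partial_deriv[OF test Basis_pair_time])
    have off: "partial_deriv (0, 1) \<eta> \<xi> = 0" "laplacian \<eta> \<xi> = 0" if "\<xi> \<notin> cylinder U t1 t2" for \<xi>
    proof -
      have 1: "\<xi> \<notin> closure {x. \<eta> x \<noteq> 0}" using test that by (auto simp: test_function_def)
      then show "partial_deriv (0, 1) \<eta> \<xi> = 0" by (rule partial_deriv_zero_off_support)
      have "partial_deriv (b, 0) (partial_deriv (b, 0) \<eta>) \<xi> = 0" if "b \<in> Basis" for b
      proof -
        have "test_function (cylinder U t1 t2) (partial_deriv (b, 0) \<eta>)"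
          using that by (intro test_function_partial_deriv test Basis_pair_space)
        then have "\<xi> \<notin> closure {x. partial_deriv (b, 0) \<eta> x \<noteq> 0}"
          using \<open>\<xi> \<notin> cylinder U t1 t2\<close> by (auto simp: test_function_def)
        then show ?thesis by (rule partial_deriv_zero_off_support)
      qed
      then show "laplacian \<eta> \<xi> = 0" by (simp add: laplacian_def)
    qed
    \<comment> \<open>The chain of integrands: \<open>f0\<close> is the weak formulation,
      \<open>f1\<close> has differences instead of derivatives, \<open>f2\<close> carries the
      mollification on \<open>z\<close> and \<open>w\<close>, and \<open>f3\<close> is a pointwise
      bound for \<open>f2\<close> in which \<psi> occurs only through \<open>X\<close>.\<close>
    define f0 where "f0 = (\<lambda>\<xi>. zb \<xi> * partial_deriv (0, 1) \<eta> \<xi> + wb \<xi> * laplacian \<eta> \<xi>)"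
    define f1 where "f1 = (\<lambda>\<xi>. zb \<xi> * ((\<eta> (\<xi> + (0, \<tau>)) - \<eta> \<xi>) / \<tau>) + wb \<xi> * second_diff \<epsilon> \<eta> (\<xi> + (0, \<tau>)))"
    define f2 where "f2 = (\<lambda>\<zeta>. zd \<zeta> * ((\<psi> (\<zeta> + (0, \<tau>)) - \<psi> \<zeta>) / \<tau>) + wd \<zeta> * X \<zeta>)"
    define f3 where "f3 = (\<lambda>\<zeta>. indicator D \<zeta> * (- max 0 (zb \<zeta>) + \<theta> + (1 + a2) * \<theta> * (1 + (X \<zeta>)\<^sup>2)))"
    have "0 \<le> (\<integral>\<xi>. indicator (cylinder U t1 t2) \<xi> * (z \<xi> * partial_deriv (0, 1) \<eta> \<xi> + w \<xi> * laplacian \<eta> \<xi>) \<partial>lborel)"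
      by (rule weak[OF test \<eta>0])
    also have "(\<lambda>\<xi>. indicator (cylinder U t1 t2) \<xi> * (z \<xi> * partial_deriv (0, 1) \<eta> \<xi> + w \<xi> * laplacian \<eta> \<xi>)) = f0"
    proof
      fix \<xi> show "indicator (cylinder U t1 t2) \<xi> * (z \<xi> * partial_deriv (0, 1) \<eta> \<xi> + w \<xi> * laplacian \<eta> \<xi>) = f0 \<xi>"
      proof (cases "\<xi> \<in> cylinder U t1 t2")
        case True
        then have "\<xi> \<in> C" using cylC by blast
        then show ?thesis using True by (simp add: f0_def zb_def wb_def)
      qed (simp add: f0_def off)
    qed
    also have "integral\<^sup>L lborel f0 \<le> (\<integral>\<xi>. f1 \<xi> + (\<theta> * I) * (\<bar>zb \<xi>\<bar> + \<bar>wb \<xi>\<bar>) \<partial>lborel)"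
    proof (rule integral_mono)
      show "integrable lborel f0" unfolding f0_def
        by (intro bounded_supp_integrable bounded_supp_add bounded_supp_mult' bounded_supp_zb bounded_supp_wb
            test_function_bounded_supp[OF t\<eta>] laplacian_test_function(1)[OF test])
      show "integrable lborel (\<lambda>\<xi>. f1 \<xi> + (\<theta> * I) * (\<bar>zb \<xi>\<bar> + \<bar>wb \<xi>\<bar>))"
        unfolding f1_def \<eta>_def
        by (intro Bochner_Integration.integrable_add integrable_mult_right integrable_abs bounded_supp_integrable bounded_supp_zb bounded_supp_wb
            integral_mult_mollify_differences(2)[OF bounded_supp_zb bounded_supp_wb \<psi>(1) \<rho>(1)])
      fix \<xi>
      have "zb \<xi> * (p - q) \<le> \<bar>zb \<xi>\<bar> * (\<theta> * I)" if "\<bar>q - p\<bar> \<le> \<theta> * I" for p q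
        using mult_left_mono[OF that, of "\<bar>zb \<xi>\<bar>"] abs_ge_self[of "zb \<xi> * (p - q)"]
        by (simp add: abs_mult abs_minus_commute)
      moreover have "wb \<xi> * (p - q) \<le> \<bar>wb \<xi>\<bar> * (\<theta> * I)" if "\<bar>q - p\<bar> \<le> \<theta> * I" for p q
        using mult_left_mono[OF that, of "\<bar>wb \<xi>\<bar>"] abs_ge_self[of "wb \<xi> * (p - q)"]
        by (simp add: abs_mult abs_minus_commute)
      moreover note d(2)[OF \<epsilon>(1,2) \<tau>(1,2) \<psi>(1), of \<xi>, folded I_def \<eta>_def]
      ultimately have "zb \<xi> * (partial_deriv (0, 1) \<eta> \<xi> - (\<eta> (\<xi> + (0, \<tau>)) - \<eta> \<xi>) / \<tau>) \<le> \<bar>zb \<xi>\<bar> * (\<theta> * I)"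
        "wb \<xi> * (laplacian \<eta> \<xi> - second_diff \<epsilon> \<eta> (\<xi> + (0, \<tau>))) \<le> \<bar>wb \<xi>\<bar> * (\<theta> * I)" by blast+
      then show "f0 \<xi> \<le> f1 \<xi> + (\<theta> * I) * (\<bar>zb \<xi>\<bar> + \<bar>wb \<xi>\<bar>)"
        by (simp add: f0_def f1_def algebra_simps)
    qed
    also have "\<dots> = integral\<^sup>L lborel f1 + (\<theta> * I) * (\<integral>\<xi>. \<bar>zb \<xi>\<bar> + \<bar>wb \<xi>\<bar> \<partial>lborel)"
    proof -
      have "integrable lborel f1" unfolding f1_def \<eta>_def
        by (rule integral_mult_mollify_differences(2)[OF bounded_supp_zb bounded_supp_wb \<psi>(1) \<rho>(1)])
      moreover have "integrable lborel (\<lambda>\<xi>. \<bar>zb \<xi>\<bar> + \<bar>wb \<xi>\<bar>)"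
        by (intro Bochner_Integration.integrable_add integrable_abs bounded_supp_integrable bounded_supp_zb bounded_supp_wb)
      ultimately show ?thesis
        by (subst Bochner_Integration.integral_add) (auto intro: integrable_mult_right)
    qed
    also have "integral\<^sup>L lborel f1 = integral\<^sup>L lborel f2"
      unfolding f1_def f2_def \<eta>_def X_def zd_def wd_def
      by (rule integral_mult_mollify_differences(1)[OF bounded_supp_zb bounded_supp_wb \<psi>(1) \<rho>(1)])
    finally have 1: "0 \<le> integral\<^sup>L lborel f2 + (\<theta> * I) * (\<integral>\<xi>. \<bar>zb \<xi>\<bar> + \<bar>wb \<xi>\<bar> \<partial>lborel)" .
    have imax: "integrable lborel (\<lambda>\<xi>. indicator D \<xi> * max 0 (zb \<xi>))"
      by (intro bounded_supp_integrable bounded_supp_mult' bD bounded_supp_max_0 bounded_supp_zb)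
    have iX: "integrable lborel (\<lambda>\<xi>. indicator D \<xi> * (X \<xi>)\<^sup>2)"
      unfolding power2_eq_square by (intro bounded_supp_integrable bounded_supp_mult' bD bX)
    have iD: "integrable lborel (indicator D :: _ \<Rightarrow> real)" by (rule bounded_supp_integrable[OF bD])
    have f3: "f3 = (\<lambda>\<zeta>. - (indicator D \<zeta> * max 0 (zb \<zeta>)) + (\<theta> + (1 + a2) * \<theta>) * indicator D \<zeta>
        + ((1 + a2) * \<theta>) * (indicator D \<zeta> * (X \<zeta>)\<^sup>2))"
      by (rule ext) (simp add: f3_def algebra_simps)
    have "integral\<^sup>L lborel f2 \<le> integral\<^sup>L lborel f3"
    proof (rule integral_mono)
      show "integrable lborel f2" unfolding f2_def X_def zd_def wd_def
        by (rule integral_mult_mollify_differences(3)[OF bounded_supp_zb bounded_supp_wb \<psi>(1) \<rho>(1)])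
      show "integrable lborel f3" unfolding f3 using imax iX iD by auto
      fix \<zeta> :: "'a \<times> real"
      \<comment> \<open>Points more than \<open>s\<close> inside keep their whole \<delta>-ball in
        the cylinder, so the zero extension of \<open>z\<close> and \<open>w\<close> is never
        averaged in.\<close>
      have inC: "\<xi> \<in> C" and dists: "dist (fst \<zeta>) (fst \<xi>) \<le> \<delta>" "\<bar>snd \<xi> - snd \<zeta>\<bar> \<le> \<delta>"
        if "s < infdist (fst \<zeta>) (- U)" "t1 + s < snd \<zeta>" "snd \<zeta> < t2 - s" "dist \<xi> \<zeta> \<le> \<delta>" for \<xi>
      proof -
        have "infdist (fst \<zeta>) (- U) \<le> infdist (fst \<xi>) (- U) + dist (fst \<zeta>) (fst \<xi>)" by (rule infdist_triangle)
        moreover show d: "dist (fst \<zeta>) (fst \<xi>) \<le> \<delta>" "\<bar>snd \<xi> - snd \<zeta>\<bar> \<le> \<delta>"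
          using that(4) dist_fst_le[of \<xi> \<zeta>] dist_snd_le[of \<xi> \<zeta>] by (auto simp: dist_commute dist_real_def)
        ultimately have "0 < infdist (fst \<xi>) (- U)" using that(1) \<delta> by linarith
        then have "fst \<xi> \<in> closure U" using inU closure_subset by blast
        then show "\<xi> \<in> C" using d(2) that \<delta> by (cases \<xi>) auto
      qed
      show "f2 \<zeta> \<le> f3 \<zeta>"
      proof (cases "\<zeta> \<in> D")
        case True
        then have good: "s < infdist (fst \<zeta>) (- U)" "t1 + s < snd \<zeta>" "snd \<zeta> < t2 - s"
          using s by (auto simp: D_def B_def t0_def T_def)
        have "\<zeta> \<in> C" using inC[OF good, of \<zeta>] \<delta> by simp
        then have zn: "zb \<zeta> - \<theta> \<le> zb \<xi>" "zb \<xi> \<le> zb \<zeta> + \<theta>" "wb \<zeta> - \<theta> \<le> wb \<xi>" "wb \<xi> \<le> wb \<zeta> + \<theta>"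
          if "dist \<xi> \<zeta> \<le> \<delta>" for \<xi>
          using dz(2)[of \<zeta> \<xi>] dw(2)[of \<zeta> \<xi>] inC[OF good that] that \<delta>
          by (auto simp: zb_def wb_def dist_real_def abs_le_iff less_imp_le)
        have zd: "\<bar>zd \<zeta> - zb \<zeta>\<bar> \<le> \<theta>"
        proof -
          have "zd \<zeta> \<le> zb \<zeta> + \<theta>"
            unfolding zd_def by (rule mollifier_average_le[OF bounded_supp_zb \<rho>]) (rule zn(2))
          moreover have "zb \<zeta> - \<theta> \<le> zd \<zeta>"
            unfolding zd_def by (rule mollifier_average_ge[OF bounded_supp_zb \<rho>]) (rule zn(1))
          ultimately show ?thesis by linarith
        qed
        have wd: "\<bar>wd \<zeta> - wb \<zeta>\<bar> \<le> \<theta>"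
        proof -
          have "wd \<zeta> \<le> wb \<zeta> + \<theta>"
            unfolding wd_def by (rule mollifier_average_le[OF bounded_supp_wb \<rho>]) (rule zn(4))
          moreover have "wb \<zeta> - \<theta> \<le> wd \<zeta>"
            unfolding wd_def by (rule mollifier_average_ge[OF bounded_supp_wb \<rho>]) (rule zn(3))
          ultimately show ?thesis by linarith
        qed
        \<comment> \<open>Inserting the scheme leaves the source term and the commutator
          \<open>wd - aa zd\<close>, which would vanish without averaging because
          \<open>wb = aa zb\<close>.\<close>
        have "(\<psi> (\<zeta> + (0, \<tau>)) - \<psi> \<zeta>) / \<tau> = - (aa \<zeta> * X \<zeta> + g \<zeta>)"
          using stepD[OF True] \<tau>(1) by (simp add: field_simps)
        then have f2: "f2 \<zeta> = - (zd \<zeta> * g \<zeta>) + (wd \<zeta> - aa \<zeta> * zd \<zeta>) * X \<zeta>"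
          unfolding f2_def by (simp only:) (simp add: algebra_simps)
        have "- (zd \<zeta> * g \<zeta>) \<le> - max 0 (zb \<zeta>) + \<theta>"
          using zd \<theta> by (auto simp: g_def max_def)
        moreover have "(wd \<zeta> - aa \<zeta> * zd \<zeta>) * X \<zeta> \<le> ((1 + a2) * \<theta>) * (1 + (X \<zeta>)\<^sup>2)"
        proof -
          have "\<bar>wd \<zeta> - aa \<zeta> * zd \<zeta>\<bar> = \<bar>(wd \<zeta> - wb \<zeta>) - aa \<zeta> * (zd \<zeta> - zb \<zeta>)\<bar>"
            by (simp add: aa(3)[of \<zeta>] algebra_simps)
          also have "\<dots> \<le> \<bar>wd \<zeta> - wb \<zeta>\<bar> + aa \<zeta> * \<bar>zd \<zeta> - zb \<zeta>\<bar>"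
            using abs_triangle_ineq4[of "wd \<zeta> - wb \<zeta>" "aa \<zeta> * (zd \<zeta> - zb \<zeta>)"] a_pos[of \<zeta>] by (simp add: abs_mult)
          also have "\<dots> \<le> \<theta> + a2 * \<theta>"
            using zd wd aa(2) a2 by (intro add_mono mult_mono) auto
          finally have "\<bar>wd \<zeta> - aa \<zeta> * zd \<zeta>\<bar> \<le> (1 + a2) * \<theta>" by (simp add: algebra_simps)
          moreover have "\<bar>X \<zeta>\<bar> \<le> 1 + (X \<zeta>)\<^sup>2"
            using zero_le_power2[of "\<bar>X \<zeta>\<bar> - 1"] by (simp add: power2_diff)
          ultimately have "\<bar>wd \<zeta> - aa \<zeta> * zd \<zeta>\<bar> * \<bar>X \<zeta>\<bar> \<le> ((1 + a2) * \<theta>) * (1 + (X \<zeta>)\<^sup>2)"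
            using a2 \<theta> by (intro mult_mono) auto
          then show ?thesis using abs_ge_self[of "(wd \<zeta> - aa \<zeta> * zd \<zeta>) * X \<zeta>"] by (simp add: abs_mult)
        qed
        ultimately show ?thesis using True by (simp add: f2 f3_def)
      next
        case False
        let ?p = "\<psi> (\<zeta> + (0, \<tau>))"
        have f3z: "f3 \<zeta> = 0" using False by (simp add: f3_def)
        show ?thesis
        \<comment> \<open>Off \<open>D\<close> only points whose stencil meets the support of \<psi>
          matter. They lie within one step of \<open>D\<close>, hence in the collar where
          \<open>z \<le> - \<kappa>\<close>, yet still more than \<open>s\<close> inside.\<close>
        proof (cases "?p = 0 \<and> (\<forall>b\<in>Basis. \<psi> (\<zeta> + (0, \<tau>) + (\<epsilon> *\<^sub>R b, 0)) = 0 \<and> \<psi> (\<zeta> + (0, \<tau>) - (\<epsilon> *\<^sub>R b, 0)) = 0)")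
          case True
          then have "X \<zeta> = 0" by (simp add: X_def second_diff_def)
          then show ?thesis using True False \<psi>D f3z by (simp add: f2_def)
        next
          case nz: False
          obtain y where y: "\<psi> y \<noteq> 0" "dist (fst y) (fst \<zeta>) \<le> \<epsilon>" "snd y = snd \<zeta> + \<tau>"
          proof (cases "?p = 0")
            case True
            with nz obtain b where "b \<in> Basis" "\<psi> (\<zeta> + (0, \<tau>) + (\<epsilon> *\<^sub>R b, 0)) \<noteq> 0 \<or> \<psi> (\<zeta> + (0, \<tau>) - (\<epsilon> *\<^sub>R b, 0)) \<noteq> 0"
              by blast
            then show ?thesis using \<epsilon> that[of "\<zeta> + (0, \<tau>) + (\<epsilon> *\<^sub>R b, 0)"] that[of "\<zeta> + (0, \<tau>) - (\<epsilon> *\<^sub>R b, 0)"]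
              by (auto simp: dist_norm)
          next
            case False
            then show ?thesis using \<epsilon> that[of "\<zeta> + (0, \<tau>)"] by simp
          qed
          then have yD: "y \<in> D" using \<psi>D by blast
          have "infdist (fst y) (- U) \<le> infdist (fst \<zeta>) (- U) + dist (fst y) (fst \<zeta>)" by (rule infdist_triangle)
          then have good: "s < infdist (fst \<zeta>) (- U)" "t1 + s < snd \<zeta>" "snd \<zeta> < t2 - s"
            using yD y \<epsilon> \<tau> s by (auto simp: D_def B_def t0_def T_def)
          \<comment> \<open>\<open>\<zeta>\<close> cannot be too late, since the point
            \<open>y\<close> of \<open>D\<close> is later still. So it precedes \<open>t0\<close> or
            is too close to the complement of \<open>U\<close>.\<close>
          have alt: "snd \<zeta> < t0 \<or> infdist (fst \<zeta>) (- U) < 2 * s"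
            using False yD y(3) \<tau> by (cases \<zeta>) (auto simp: D_def B_def)
          have zn: "zb \<xi> \<le> - \<kappa> \<and> wb \<xi> \<le> 0" if "dist \<xi> \<zeta> \<le> \<delta>" for \<xi>
          proof -
            have "infdist (fst \<xi>) (- U) \<le> infdist (fst \<zeta>) (- U) + dist (fst \<xi>) (fst \<zeta>)" by (rule infdist_triangle)
            then have "snd \<xi> \<le> t1 + 4 * s \<or> infdist (fst \<xi>) (- U) \<le> 4 * s"
              using alt dists[OF good that] \<delta> s by (auto simp: t0_def dist_commute)
            then have "zb \<xi> \<le> - \<kappa>" using near[OF inC[OF good that]] inC[OF good that] by (simp add: zb_def)
            moreover have "wb \<xi> \<le> 0" unfolding aa(3) using calculation \<kappa> a_pos[of \<xi>]
              by (intro mult_nonneg_nonpos) auto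
            ultimately show ?thesis ..
          qed
          have zd: "zd \<zeta> \<le> - \<kappa>" unfolding zd_def
            by (rule mollifier_average_le[OF bounded_supp_zb \<rho>]) (use zn in blast)
          have wd: "wd \<zeta> \<le> 0" unfolding wd_def
            by (rule mollifier_average_le[OF bounded_supp_wb \<rho>]) (use zn in blast)
          have wW: "- W \<le> wd \<zeta>" unfolding wd_def
            by (rule mollifier_average_ge[OF bounded_supp_wb \<rho>]) (use W(2) in \<open>simp add: abs_le_iff minus_le_iff\<close>)
          have p: "0 \<le> ?p" by (rule \<psi>(2))
          \<comment> \<open>As \<psi> vanishes at \<open>\<zeta>\<close>, only the later value
            \<open>?p\<close> and its nonnegative neighbours enter. The neighbours help, since
            \<open>wd \<le> 0\<close>; the central value costs at most
            \<open>2 n W ?p/\<epsilon>^2\<close>, and \<open>side\<close> bounds this by the gain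
            \<open>\<kappa> ?p/\<tau>\<close> from the time difference.\<close>
          have "(\<Sum>b\<in>(Basis::'a set). - 2 * ?p) \<le>
             (\<Sum>b\<in>Basis. \<psi> (\<zeta> + (0, \<tau>) + (\<epsilon> *\<^sub>R b, 0)) + \<psi> (\<zeta> + (0, \<tau>) - (\<epsilon> *\<^sub>R b, 0)) - 2 * ?p)"
            using \<psi>(2) by (intro sum_mono) simp
          then have "- (2 * n * ?p / \<epsilon>\<^sup>2) \<le> X \<zeta>"
            unfolding X_def second_diff_def using \<epsilon> by (simp add: n_def field_simps)
          then have "wd \<zeta> * X \<zeta> \<le> wd \<zeta> * (- (2 * n * ?p / \<epsilon>\<^sup>2))"
            using wd by (rule mult_left_mono_neg)
          also have "\<dots> = (- wd \<zeta>) * (2 * n * ?p / \<epsilon>\<^sup>2)" by simp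
          also have "\<dots> \<le> W * (2 * n * ?p / \<epsilon>\<^sup>2)"
            using wW p n by (intro mult_right_mono) auto
          also have "\<dots> \<le> \<kappa> * ?p / \<tau>"
          proof -
            have "2 * n * W * \<tau> * ?p \<le> \<kappa> * \<epsilon>\<^sup>2 * ?p" using side p by (rule mult_right_mono)
            then show ?thesis using \<tau>(1) \<epsilon>(1) by (simp add: field_simps)
          qed
          finally have "wd \<zeta> * X \<zeta> \<le> \<kappa> * ?p / \<tau>" .
          moreover have "zd \<zeta> * (?p / \<tau>) \<le> - \<kappa> * (?p / \<tau>)"
            using zd p \<tau>(1) by (intro mult_right_mono) auto
          ultimately show ?thesis using \<psi>D[OF False] f3z by (simp add: f2_def)
        qed
      qed
    qed
    also have "integral\<^sup>L lborel f3 = - G + (\<theta> + (1 + a2) * \<theta>) * measure lborel D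
        + (1 + a2) * \<theta> * (\<integral>\<xi>. indicator D \<xi> * (X \<xi>)\<^sup>2 \<partial>lborel)"
      unfolding f3 G_def using imax iX iD Dm by simp
    also have "\<dots> \<le> - G + (\<theta> + (1 + a2) * \<theta>) * measure lborel D + (1 + a2) * \<theta> * (6 / a1\<^sup>2 * measure lborel D)"
      using energy a2 \<theta> by (intro add_mono order_refl mult_left_mono) auto
    finally have 2: "integral\<^sup>L lborel f2 \<le> - G + (\<theta> + (1 + a2) * \<theta>) * measure lborel D
       + (1 + a2) * \<theta> * (6 / a1\<^sup>2 * measure lborel D)" .
    have "(\<theta> * I) * (\<integral>\<xi>. \<bar>zb \<xi>\<bar> + \<bar>wb \<xi>\<bar> \<partial>lborel)
      \<le> (\<theta> * ((T - t0 + 1) * measure lborel D)) * (\<integral>\<xi>. \<bar>zb \<xi>\<bar> + \<bar>wb \<xi>\<bar> \<partial>lborel)"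
      using I \<theta> by (intro mult_right_mono mult_left_mono) auto
    with 1 2 show ?thesis by (simp add: M_def algebra_simps)
  qed
  show ?thesis
  proof (cases "C = {}")
    case True
    then have "zb = (\<lambda>_. 0)" unfolding zb_def by (simp only: indicator_def) simp
    then show ?thesis by simp
  next
    case False
    have "G \<le> 0"
    proof (rule ccontr)
      assume "\<not> G \<le> 0"
      then have G: "G > 0" by simp
      \<comment> \<open>\<open>M\<close> does not depend on the tolerance, so this choice yields
        \<open>G \<le> G/2\<close>; the \<open>+ 1\<close> avoids division by zero.\<close>
      then have "G \<le> (G / (2 * (\<bar>M\<bar> + 1))) * M" using False by (intro est) auto
      also have "\<dots> \<le> (G / (2 * (\<bar>M\<bar> + 1))) * (\<bar>M\<bar> + 1)" using G by (intro mult_left_mono) auto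
      also have "\<dots> = G / 2" by (simp add: field_simps)
      finally show False using G by simp
    qed
    then show ?thesis by (simp add: G_def D_def B_def t0_def T_def)
  qed
qed

lemma nonpos:
  assumes "\<zeta> \<in> cylinder U t1 t2"
  shows "z \<zeta> \<le> 0"
proof (rule ccontr)
  assume "\<not> ?thesis"
  then have z\<zeta>: "0 < z \<zeta>" by simp
  obtain \<kappa> s0 where \<kappa>: "0 < \<kappa>" "0 < s0"
    "\<And>\<xi>. \<xi> \<in> C \<Longrightarrow> snd \<xi> \<le> t1 + 4 * s0 \<or> infdist (fst \<xi>) (- U) \<le> 4 * s0 \<Longrightarrow> z \<xi> \<le> - \<kappa>"
    using negative_near_boundary by metis
  have "U \<noteq> UNIV" using U(1) not_bounded_UNIV by blast
  then have pos: "0 < infdist (fst \<zeta>) (- U)"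
    using assms U(2) by (intro infdist_pos_not_in_closed) (auto simp: cylinder_def closed_Compl)
  \<comment> \<open>Shrinking \<open>s0\<close> keeps the collar estimate, and the other three
    entries put \<open>\<zeta>\<close> into the inner region to which \<open>dual_bound\<close>
    applies.\<close>
  define s where "s = min (min s0 (infdist (fst \<zeta>) (- U))) (min (snd \<zeta> - t1) (t2 - snd \<zeta>)) / 4"
  have s: "0 < s" "4 * s \<le> s0" "4 * s \<le> infdist (fst \<zeta>) (- U)" "4 * s \<le> snd \<zeta> - t1" "4 * s \<le> t2 - snd \<zeta>"
    using \<kappa> pos assms by (auto simp: s_def cylinder_def min_def)
  let ?D = "{x. 2 * s \<le> infdist x (- U)} \<times> {t1 + 2 * s..<t2 - 2 * s}"
  let ?O = "{x. 2 * s < infdist x (- U)} \<times> {t1 + 2 * s<..<t2 - 2 * s}"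
  have zero: "(\<integral>\<xi>. indicator ?D \<xi> * max 0 (zb \<xi>) \<partial>lborel) \<le> 0"
    by (rule dual_bound[OF \<kappa>(1) s(1)]) (use s \<kappa> in \<open>auto intro!: \<kappa>(3)\<close>)
  have oO: "open ?O" by (intro open_Times open_Collect_less continuous_intros)
  have \<zeta>O: "\<zeta> \<in> ?O" using s by (cases \<zeta>) auto
  have OC: "?O \<subseteq> C"
  proof -
    have "x \<in> closure U" if "2 * s < infdist x (- U)" for x
      using that s(1) infdist_zero[of x "- U"] closure_subset[of U] by (cases "x \<in> U") auto
    then show ?thesis using s(1) by auto
  qed
  then have "continuous_on ?O z" using cont(1) continuous_on_subset by blast
  then have "isCont z \<zeta>" using oO \<zeta>O continuous_on_eq_continuous_at by blast
  then have "\<forall>\<^sub>F \<xi> in nhds \<zeta>. z \<zeta> / 2 < z \<xi>"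
    using z\<zeta> by (intro order_tendstoD(1)[of z "z \<zeta>"]) (auto simp: isCont_def tendsto_at_iff_tendsto_nhds[symmetric] continuous_at)
  then obtain r1 where r1: "r1 > 0" "\<And>\<xi>. dist \<xi> \<zeta> < r1 \<Longrightarrow> z \<zeta> / 2 < z \<xi>"
    unfolding eventually_nhds_metric by auto
  obtain r2 where r2: "r2 > 0" "ball \<zeta> r2 \<subseteq> ?O" using oO \<zeta>O open_contains_ball by blast
  define r where "r = min r1 r2"
  have r: "r > 0" using r1 r2 by (simp add: r_def)
  have b1: "bounded_supp (indicator (ball \<zeta> r) :: 'a \<times> real \<Rightarrow> real)"
    by (rule bounded_suppI[of _ 1 "ball \<zeta> r"]) (auto intro: borel_measurable_indicator)
  have mD: "?D \<in> sets borel"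
  proof -
    have "closed {x. 2 * s \<le> infdist x (- U)}" by (intro closed_Collect_le continuous_intros)
    then show ?thesis by (simp add: borel_prod[symmetric])
  qed
  have b2: "bounded_supp (\<lambda>\<xi>. indicator ?D \<xi> * max 0 (zb \<xi>))"
    using bounded_supp_mult[OF bounded_supp_max_0[OF bounded_supp_zb] borel_measurable_indicator[OF mD], of 1]
    by (simp add: mult.commute)
  have "(\<integral>\<xi>. z \<zeta> / 2 * indicator (ball \<zeta> r) \<xi> \<partial>lborel) \<le> (\<integral>\<xi>. indicator ?D \<xi> * max 0 (zb \<xi>) \<partial>lborel)"
  proof (rule integral_mono)
    fix \<xi>
    show "z \<zeta> / 2 * indicator (ball \<zeta> r) \<xi> \<le> indicator ?D \<xi> * max 0 (zb \<xi>)"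
    proof (cases "\<xi> \<in> ball \<zeta> r")
      case True
      then have "\<xi> \<in> ?O" "z \<zeta> / 2 < z \<xi>" using r1 r2 by (auto simp: r_def dist_commute)
      moreover from this have "\<xi> \<in> ?D" "\<xi> \<in> C" using OC by auto
      ultimately show ?thesis using True z\<zeta> by (simp add: zb_def)
    qed simp
  qed (intro bounded_supp_integrable bounded_supp_cmult b1 b2)+
  with zero have "z \<zeta> / 2 * measure lborel (ball \<zeta> r) \<le> 0" by simp
  moreover have "measure lborel (ball \<zeta> r) > 0" using content_ball_pos[OF r] by simp
  ultimately show False using z\<zeta> by (simp add: mult_le_0_iff)
qed

end

subsection \<open>Distributional formulations\<close>

text \<open>Difference quotients integrate to zero by translation invariance, and the mean value
  theorem supplies a dominating function. Only a derivative in direction \<open>b\<close> is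
  assumed, as the barriers are described by directional derivatives.\<close>

lemma integral_directional_derivative:
  fixes F F' :: "'a::euclidean_space \<Rightarrow> real"
  assumes F: "bounded_supp F" and F': "bounded_supp F'"
    and D: "\<And>x. ((\<lambda>s. F (x + s *\<^sub>R b)) has_real_derivative F' x) (at 0)"
  shows "(\<integral>x. F' x \<partial>lborel) = 0"
proof -
  obtain K A where K: "K > 0" "\<And>x. \<bar>F' x\<bar> \<le> K" and A: "bounded {x. F x \<noteq> 0}"
    and m: "F \<in> borel_measurable borel" "F' \<in> borel_measurable borel"
    using bounded_suppE[OF F'] F F' unfolding bounded_supp_def by metis
  obtain R where R: "\<And>x. F x \<noteq> 0 \<Longrightarrow> norm x \<le> R" using A unfolding bounded_iff by blast
  have Ds: "((\<lambda>s. F (x + s *\<^sub>R b)) has_real_derivative F' (x + s *\<^sub>R b)) (at s)" for x s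
    using D[of "x + s *\<^sub>R b"] DERIV_shift[of "\<lambda>r. F (x + r *\<^sub>R b)" "F' (x + s *\<^sub>R b)" 0 s]
    by (simp add: scaleR_add_left add.commute add.left_commute)
  define q where "q = (\<lambda>n x. (F (x + (1 / real (Suc n)) *\<^sub>R b) - F x) / (1 / real (Suc n)))"
  have lim: "(\<lambda>n. \<integral>x. q n x \<partial>lborel) \<longlonglongrightarrow> (\<integral>x. F' x \<partial>lborel)"
  proof (rule integral_dominated_convergence)
    show "F' \<in> borel_measurable lborel" using m by simp
    show "q n \<in> borel_measurable lborel" for n unfolding q_def using m by measurable
    \<comment> \<open>The increments are at most \<open>b\<close> in length, so all quotients are
      supported in one ball.\<close>
    show "integrable lborel (\<lambda>x. K * indicator (cball 0 (R + norm b)) x)"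
      by (intro bounded_supp_integrable bounded_supp_cmult bounded_suppI[of _ 1 "cball 0 (R + norm b)"])
        (auto intro: borel_measurable_indicator)
    show "AE x in lborel. (\<lambda>n. q n x) \<longlonglongrightarrow> F' x"
    proof (rule AE_I2)
      fix x
      have "((\<lambda>h. (F (x + h *\<^sub>R b) - F x) / h) \<longlongrightarrow> F' x) (at 0)" using D[of x] by (simp add: DERIV_def)
      moreover have "filterlim (\<lambda>n. 1 / real (Suc n)) (at 0) sequentially"
        unfolding filterlim_at using LIMSEQ_inverse_real_of_nat by (simp add: inverse_eq_divide)
      ultimately show "(\<lambda>n. q n x) \<longlonglongrightarrow> F' x" unfolding q_def by (rule filterlim_compose)
    qed
    show "AE x in lborel. norm (q n x) \<le> K * indicator (cball 0 (R + norm b)) x" for n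
    proof (rule AE_I2)
      fix x
      define h where "h = 1 / real (Suc n)"
      have h: "0 < h" "h \<le> 1" by (auto simp: h_def)
      have "\<exists>s>0. s < h \<and> F (x + h *\<^sub>R b) - F (x + 0 *\<^sub>R b) = (h - 0) * F' (x + s *\<^sub>R b)"
        by (intro MVT2 h Ds)
      then obtain s where "F (x + h *\<^sub>R b) - F x = h * F' (x + s *\<^sub>R b)" by auto
      moreover have qh: "q n x = (F (x + h *\<^sub>R b) - F x) / h" by (simp only: q_def h_def)
      ultimately have q: "q n x = F' (x + s *\<^sub>R b)" using h by simp
      show "norm (q n x) \<le> K * indicator (cball 0 (R + norm b)) x"
      proof (cases "norm x \<le> R + norm b")
        case True
        then show ?thesis using K q by simp
      next
        case False
        have "norm x \<le> norm (x + h *\<^sub>R b) + norm (h *\<^sub>R b)" by (metis add_diff_cancel_right' norm_triangle_ineq4)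
        also have "norm (h *\<^sub>R b) \<le> norm b" using h by (simp add: mult_left_le_one_le)
        finally have "F (x + h *\<^sub>R b) = 0" "F x = 0" using R[of x] R[of "x + h *\<^sub>R b"] False norm_ge_zero[of b] by fastforce+
        then show ?thesis using K by (simp add: qh)
      qed
    qed
  qed
  have "(\<integral>x. q n x \<partial>lborel) = 0" for n
  proof -
    have "(\<integral>x. q n x \<partial>lborel) = ((\<integral>x. F (x + (1 / real (Suc n)) *\<^sub>R b) \<partial>lborel) - (\<integral>x. F x \<partial>lborel)) / (1 / real (Suc n))"
      unfolding q_def by (simp only: integral_divide_zero Bochner_Integration.integral_diff
          bounded_supp_integrable bounded_supp_translate F)
    then show ?thesis using integral_translate[OF m(1)] by simp
  qed
  then show ?thesis using lim LIMSEQ_unique[OF lim, of 0] by simp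
qed

text \<open>The product with \<eta>, extended by zero off the support \<open>K\<close> of \<eta>, is
  differentiable in direction \<open>b\<close> everywhere, although \<open>u\<close> is controlled
  only on \<open>S\<close>.\<close>

lemma integral_by_parts_test_function:
  fixes u u' \<eta> :: "'a::euclidean_space \<Rightarrow> real"
  assumes S: "open S" and u: "continuous_on S u" "continuous_on S u'"
    and D: "\<And>x. x \<in> S \<Longrightarrow> ((\<lambda>s. u (x + s *\<^sub>R b)) has_real_derivative u' x) (at 0)"
    and \<eta>: "test_function S \<eta>" and b: "b \<in> Basis"
  shows "(\<integral>x. indicator S x * (u x * partial_deriv b \<eta> x) \<partial>lborel) = - (\<integral>x. indicator S x * (u' x * \<eta> x) \<partial>lborel)"
    and "integrable lborel (\<lambda>x. indicator S x * (u x * partial_deriv b \<eta> x))"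
    and "integrable lborel (\<lambda>x. indicator S x * (u' x * \<eta> x))"
proof -
  define K where "K = closure {x. \<eta> x \<noteq> 0}"
  have K: "compact K" "K \<subseteq> S" using \<eta> by (auto simp: test_function_def K_def)
  have off: "\<eta> x = 0" "partial_deriv b \<eta> x = 0" if "x \<notin> K" for x
    using that zero_off_support partial_deriv_zero_off_support unfolding K_def by blast+
  have cont: "continuous_on K \<eta>" "continuous_on K (partial_deriv b \<eta>)"
    using test_function_continuous \<eta> test_function_partial_deriv[OF \<eta> b] by blast+
  have uK: "continuous_on K u" "continuous_on K u'" using u K continuous_on_subset by blast+
  have eq: "indicator S x * (f x * \<eta> x) = indicator K x * (f x * \<eta> x)"
    "indicator S x * (f x * partial_deriv b \<eta> x) = indicator K x * (f x * partial_deriv b \<eta> x)" for f x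
    using K off[of x] by (auto simp: indicator_def)
  have bs: "bounded_supp (\<lambda>x. indicator K x * (u x * \<eta> x))" "bounded_supp (\<lambda>x. indicator K x * (u' x * \<eta> x))"
    "bounded_supp (\<lambda>x. indicator K x * (u x * partial_deriv b \<eta> x))"
    by (intro bounded_supp_indicator_compact K continuous_intros cont uK)+
  have "(\<integral>x. indicator K x * (u' x * \<eta> x) + indicator K x * (u x * partial_deriv b \<eta> x) \<partial>lborel) = 0"
  proof (rule integral_directional_derivative[OF bs(1)])
    show "bounded_supp (\<lambda>x. indicator K x * (u' x * \<eta> x) + indicator K x * (u x * partial_deriv b \<eta> x))"
      by (intro bounded_supp_add bs)
    fix x
    let ?F = "\<lambda>x. indicator K x * (u x * \<eta> x)"
    have tend: "((\<lambda>s. x + s *\<^sub>R b) \<longlongrightarrow> x) (nhds 0)"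
      by (rule tendsto_eq_intros filterlim_ident refl | simp)+
    show "((\<lambda>s. ?F (x + s *\<^sub>R b)) has_real_derivative
       indicator K x * (u' x * \<eta> x) + indicator K x * (u x * partial_deriv b \<eta> x)) (at 0)"
    proof (cases "x \<in> K")
      case True
      then have xS: "x \<in> S" using K by blast
      have "((\<lambda>s. u (x + s *\<^sub>R b) * \<eta> (x + s *\<^sub>R b)) has_real_derivative
         u' x * \<eta> (x + 0 *\<^sub>R b) + partial_deriv b \<eta> (x + 0 *\<^sub>R b) * u (x + 0 *\<^sub>R b)) (at 0)"
        by (intro DERIV_mult D xS has_real_derivative_along test_function_differentiable[OF \<eta>])
      moreover have "\<forall>\<^sub>F s in nhds 0. ?F (x + s *\<^sub>R b) = u (x + s *\<^sub>R b) * \<eta> (x + s *\<^sub>R b)"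
        using off by (intro always_eventually) (auto simp: indicator_def)
      ultimately show ?thesis using True
        by (subst DERIV_cong_ev[OF refl _ refl]) (simp_all add: algebra_simps)
    next
      case False
      have "\<forall>\<^sub>F y in nhds x. y \<in> - K" using False K by (intro eventually_nhds_in_open) (auto simp: compact_imp_closed)
      then have "\<forall>\<^sub>F s in nhds 0. x + s *\<^sub>R b \<in> - K" using tend by (rule eventually_compose_filterlim)
      then have "\<forall>\<^sub>F s in nhds 0. ?F (x + s *\<^sub>R b) = 0" by (rule eventually_mono) simp
      then have "((\<lambda>s. ?F (x + s *\<^sub>R b)) has_real_derivative 0) (at 0)"
        by (rule DERIV_cong_ev[OF refl _ refl, THEN iffD2]) simp
      then show ?thesis using False by simp
    qed
  qed
  then show "(\<integral>x. indicator S x * (u x * partial_deriv b \<eta> x) \<partial>lborel) = - (\<integral>x. indicator S x * (u' x * \<eta> x) \<partial>lborel)"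
    unfolding eq using bs[THEN bounded_supp_integrable] by simp
  show "integrable lborel (\<lambda>x. indicator S x * (u x * partial_deriv b \<eta> x))"
    "integrable lborel (\<lambda>x. indicator S x * (u' x * \<eta> x))"
    unfolding eq using bs[THEN bounded_supp_integrable] by auto
qed

text \<open>One integration by parts in time and two in space. \<open>p\<close> and \<open>q\<close>
  are separate because in the application \<open>q\<close> is the power \<open>p^m\<close>, the
  quantity that is differentiated in space.\<close>

lemma classical_imp_distributional:
  fixes p q pt :: "'a::euclidean_space \<times> real \<Rightarrow> real" and q1 q2 :: "'a \<Rightarrow> 'a \<times> real \<Rightarrow> real"
  assumes S: "open S" and \<eta>: "test_function S \<eta>"
    and p: "continuous_on S p" "continuous_on S pt"
      "\<And>\<xi>. \<xi> \<in> S \<Longrightarrow> ((\<lambda>s. p (\<xi> + s *\<^sub>R (0, 1))) has_real_derivative pt \<xi>) (at 0)"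
    and q: "continuous_on S q" "\<And>b. b \<in> Basis \<Longrightarrow> continuous_on S (q1 b)" "\<And>b. b \<in> Basis \<Longrightarrow> continuous_on S (q2 b)"
      "\<And>b \<xi>. b \<in> Basis \<Longrightarrow> \<xi> \<in> S \<Longrightarrow> ((\<lambda>s. q (\<xi> + s *\<^sub>R (b, 0))) has_real_derivative q1 b \<xi>) (at 0)"
      "\<And>b \<xi>. b \<in> Basis \<Longrightarrow> \<xi> \<in> S \<Longrightarrow> ((\<lambda>s. q1 b (\<xi> + s *\<^sub>R (b, 0))) has_real_derivative q2 b \<xi>) (at 0)"
  shows "(\<integral>\<xi>. indicator S \<xi> * (p \<xi> * partial_deriv (0, 1) \<eta> \<xi> + q \<xi> * laplacian \<eta> \<xi>) \<partial>lborel)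
    = (\<integral>\<xi>. indicator S \<xi> * (((\<Sum>b\<in>Basis. q2 b \<xi>) - pt \<xi>) * \<eta> \<xi>) \<partial>lborel)"
    "integrable lborel (\<lambda>\<xi>. indicator S \<xi> * (p \<xi> * partial_deriv (0, 1) \<eta> \<xi> + q \<xi> * laplacian \<eta> \<xi>))"
proof -
  have P: "(\<integral>\<xi>. indicator S \<xi> * (p \<xi> * partial_deriv (0, 1) \<eta> \<xi>) \<partial>lborel) = - (\<integral>\<xi>. indicator S \<xi> * (pt \<xi> * \<eta> \<xi>) \<partial>lborel)"
    "integrable lborel (\<lambda>\<xi>. indicator S \<xi> * (p \<xi> * partial_deriv (0, 1) \<eta> \<xi>))"
    "integrable lborel (\<lambda>\<xi>. indicator S \<xi> * (pt \<xi> * \<eta> \<xi>))"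
    using integral_by_parts_test_function[OF S p \<eta> Basis_pair_time] by auto
  have e1: "indicator S \<xi> * (p \<xi> * partial_deriv (0, 1) \<eta> \<xi> + q \<xi> * laplacian \<eta> \<xi>) =
     indicator S \<xi> * (p \<xi> * partial_deriv (0, 1) \<eta> \<xi>)
     + (\<Sum>b\<in>Basis. indicator S \<xi> * (q \<xi> * partial_deriv (b, 0) (partial_deriv (b, 0) \<eta>) \<xi>))" for \<xi>
    by (simp add: laplacian_def distrib_left sum_distrib_left)
  have e2: "indicator S \<xi> * (((\<Sum>b\<in>Basis. q2 b \<xi>) - pt \<xi>) * \<eta> \<xi>) =
     (\<Sum>b\<in>Basis. indicator S \<xi> * (q2 b \<xi> * \<eta> \<xi>)) - indicator S \<xi> * (pt \<xi> * \<eta> \<xi>)" for \<xi>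
    by (simp add: left_diff_distrib right_diff_distrib sum_distrib_left sum_distrib_right)
  have j: "integrable lborel (\<lambda>\<xi>. indicator S \<xi> * (q \<xi> * partial_deriv (b, 0) (partial_deriv (b, 0) \<eta>) \<xi>))"
    "integrable lborel (\<lambda>\<xi>. indicator S \<xi> * (q2 b \<xi> * \<eta> \<xi>))"
    "(\<integral>\<xi>. indicator S \<xi> * (q \<xi> * partial_deriv (b, 0) (partial_deriv (b, 0) \<eta>) \<xi>) \<partial>lborel)
      = (\<integral>\<xi>. indicator S \<xi> * (q2 b \<xi> * \<eta> \<xi>) \<partial>lborel)" if "b \<in> Basis" for b
  proof -
    note B = Basis_pair_space[OF that]
    note Q1 = integral_by_parts_test_function[OF S q(1) q(2)[OF that] q(4)[OF that] test_function_partial_deriv[OF \<eta> B] B]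
    note Q2 = integral_by_parts_test_function[OF S q(2)[OF that] q(3)[OF that] q(5)[OF that] \<eta> B]
    show "integrable lborel (\<lambda>\<xi>. indicator S \<xi> * (q \<xi> * partial_deriv (b, 0) (partial_deriv (b, 0) \<eta>) \<xi>))"
      "integrable lborel (\<lambda>\<xi>. indicator S \<xi> * (q2 b \<xi> * \<eta> \<xi>))"
      "(\<integral>\<xi>. indicator S \<xi> * (q \<xi> * partial_deriv (b, 0) (partial_deriv (b, 0) \<eta>) \<xi>) \<partial>lborel)
      = (\<integral>\<xi>. indicator S \<xi> * (q2 b \<xi> * \<eta> \<xi>) \<partial>lborel)"
      using Q1(1,2) Q2(1,3) by auto
  qed
  have i1: "integrable lborel (\<lambda>\<xi>. \<Sum>b\<in>Basis. indicator S \<xi> * (q \<xi> * partial_deriv (b, 0) (partial_deriv (b, 0) \<eta>) \<xi>))"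
    by (intro Bochner_Integration.integrable_sum j(1))
  have i2: "integrable lborel (\<lambda>\<xi>. \<Sum>b\<in>Basis. indicator S \<xi> * (q2 b \<xi> * \<eta> \<xi>))"
    by (intro Bochner_Integration.integrable_sum j(2))
  from j(3) have s: "(\<Sum>b\<in>Basis. \<integral>\<xi>. indicator S \<xi> * (q \<xi> * partial_deriv (b, 0) (partial_deriv (b, 0) \<eta>) \<xi>) \<partial>lborel)
     = (\<Sum>b\<in>Basis. \<integral>\<xi>. indicator S \<xi> * (q2 b \<xi> * \<eta> \<xi>) \<partial>lborel)" by (rule sum.cong[OF refl])
  show "integrable lborel (\<lambda>\<xi>. indicator S \<xi> * (p \<xi> * partial_deriv (0, 1) \<eta> \<xi> + q \<xi> * laplacian \<eta> \<xi>))"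
    unfolding e1 by (intro Bochner_Integration.integrable_add P(2) i1)
  show "(\<integral>\<xi>. indicator S \<xi> * (p \<xi> * partial_deriv (0, 1) \<eta> \<xi> + q \<xi> * laplacian \<eta> \<xi>) \<partial>lborel)
    = (\<integral>\<xi>. indicator S \<xi> * (((\<Sum>b\<in>Basis. q2 b \<xi>) - pt \<xi>) * \<eta> \<xi>) \<partial>lborel)"
  proof -
    have "(\<integral>\<xi>. indicator S \<xi> * (p \<xi> * partial_deriv (0, 1) \<eta> \<xi> + q \<xi> * laplacian \<eta> \<xi>) \<partial>lborel)
      = (\<integral>\<xi>. indicator S \<xi> * (p \<xi> * partial_deriv (0, 1) \<eta> \<xi>) \<partial>lborel) +
        (\<integral>\<xi>. (\<Sum>b\<in>Basis. indicator S \<xi> * (q \<xi> * partial_deriv (b, 0) (partial_deriv (b, 0) \<eta>) \<xi>)) \<partial>lborel)"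
      unfolding e1 by (rule Bochner_Integration.integral_add[OF P(2) i1])
    also have "(\<integral>\<xi>. (\<Sum>b\<in>Basis. indicator S \<xi> * (q \<xi> * partial_deriv (b, 0) (partial_deriv (b, 0) \<eta>) \<xi>)) \<partial>lborel)
      = (\<Sum>b\<in>Basis. \<integral>\<xi>. indicator S \<xi> * (q2 b \<xi> * \<eta> \<xi>) \<partial>lborel)"
      unfolding s[symmetric] by (rule Bochner_Integration.integral_sum[OF j(1)])
    also have "\<dots> = (\<integral>\<xi>. (\<Sum>b\<in>Basis. indicator S \<xi> * (q2 b \<xi> * \<eta> \<xi>)) \<partial>lborel)"
      by (rule Bochner_Integration.integral_sum[OF j(2), symmetric])
    finally show ?thesis unfolding e2 P(1) Bochner_Integration.integral_diff[OF i2 P(3)] by linarith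
  qed
qed

section \<open>Time slices\<close>

text \<open>Fubini for a function that is only Lebesgue measurable on the product, as a weak
  gradient is. It passes to a Borel representative; the exceptional set is enclosed in a Borel null
  set, almost all of whose time slices are null.\<close>

lemma integral_lebesgue_zero_slices:
  fixes P :: "'a::euclidean_space \<times> real \<Rightarrow> real"
  assumes int: "integrable lebesgue P"
    and slices: "AE t in lborel. (\<lambda>x. P (x, t)) \<in> borel_measurable lebesgue \<and> (\<integral>x. P (x, t) \<partial>lebesgue) = 0"
  shows "(\<integral>\<xi>. P \<xi> \<partial>lebesgue) = 0"
proof -
  obtain Q where Q: "Q \<in> borel_measurable lborel" "AE \<xi> in lborel. P \<xi> = Q \<xi>"
    using completion_ex_borel_measurable_real[of P lborel] int by auto
  have AE_leb: "AE \<xi> in lebesgue. P \<xi> = Q \<xi>" using Q(2) by (rule AE_completion)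
  have Ql: "Q \<in> borel_measurable lebesgue" using Q(1) by (rule measurable_completion)
  have eq: "(\<integral>\<xi>. P \<xi> \<partial>lebesgue) = (\<integral>\<xi>. Q \<xi> \<partial>lborel)"
    using integral_cong_AE[OF _ Ql AE_leb] int integral_completion[OF Q(1)] by auto
  have "integrable lebesgue Q" using integrable_cong_AE_imp[OF int Ql] AE_leb by (auto elim!: eventually_mono)
  then have Qi: "integrable lborel Q" using integrable_completion[OF Q(1)] by simp
  then have Qp: "integrable (lborel \<Otimes>\<^sub>M lborel) (\<lambda>(x, t). Q (x, t))" by (simp add: lborel_prod)
  obtain N where N: "N \<in> null_sets lborel" "{\<xi>. P \<xi> \<noteq> Q \<xi>} \<subseteq> N"
    using Q(2) unfolding eventually_ae_filter by auto
  have Ns: "N \<in> sets (lborel \<Otimes>\<^sub>M lborel)" "N \<in> null_sets (lborel \<Otimes>\<^sub>M lborel)" unfolding lborel_prod using N(1) by auto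
  have "AE \<xi> in lborel \<Otimes>\<^sub>M lborel. \<xi> \<notin> N" using Ns by (simp add: AE_not_in)
  then have "AE x in lborel. AE t in lborel. (x, t) \<notin> N" by (rule lborel_pair.AE_pair)
  moreover have "{\<xi> \<in> space (lborel \<Otimes>\<^sub>M lborel). (fst \<xi>, snd \<xi>) \<notin> N} \<in> sets (lborel \<Otimes>\<^sub>M lborel)"
  proof -
    have "{\<xi> \<in> space (lborel \<Otimes>\<^sub>M lborel). (fst \<xi>, snd \<xi>) \<notin> N} = space (lborel \<Otimes>\<^sub>M lborel) - N" by auto
    then show ?thesis using sets.compl_sets[OF Ns(1)] by (simp only:)
  qed
  ultimately have "AE t in lborel. AE x in lborel. (x, t) \<notin> N"
    using lborel_pair.AE_commute[of "\<lambda>x t. (x, t) \<notin> N"] by simp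
  with slices have "AE t in lborel. (\<integral>x. Q (x, t) \<partial>lborel) = 0"
  proof eventually_elim
    case (elim t)
    have m: "(\<lambda>x. Q (x, t)) \<in> borel_measurable lborel" using Q(1) by simp
    have "AE x in lborel. P (x, t) = Q (x, t)" using elim(2) by eventually_elim (use N(2) in blast)
    then have "AE x in lebesgue. P (x, t) = Q (x, t)" by (rule AE_completion)
    then have "(\<integral>x. P (x, t) \<partial>lebesgue) = (\<integral>x. Q (x, t) \<partial>lebesgue)"
      using elim(1) measurable_completion[OF m] by (intro integral_cong_AE) auto
    then show ?case using elim(1) integral_completion[OF m] by simp
  qed
  then have "(\<integral>t. (\<integral>x. Q (x, t) \<partial>lborel) \<partial>lborel) = 0"
    by (rule integral_eq_zero_AE)
  then show ?thesis using eq lborel_pair.integral_snd[OF Qp] by (simp add: lborel_prod)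
qed

lemma partial_deriv_slice:
  fixes f :: "'a::euclidean_space \<times> real \<Rightarrow> real"
  assumes "f differentiable (at (x, t))"
  shows "(\<lambda>x. f (x, t)) differentiable (at x)" "partial_deriv b (\<lambda>x. f (x, t)) x = partial_deriv (b, 0) f (x, t)"
proof -
  have "((\<lambda>x. (x, t)) has_derivative (\<lambda>h. (h, 0))) (at x)"
    by (auto intro!: derivative_eq_intros)
  from diff_chain_at[OF this] have d: "((\<lambda>x. f (x, t)) has_derivative (\<lambda>h. frechet_derivative f (at (x, t)) (h, 0))) (at x)"
    using assms frechet_derivative_works by (auto simp: o_def)
  then show "(\<lambda>x. f (x, t)) differentiable (at x)" by (auto simp: differentiable_def)
  show "partial_deriv b (\<lambda>x. f (x, t)) x = partial_deriv (b, 0) f (x, t)"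
    using partial_deriv_eqI[OF d, of b] by (simp add: partial_deriv_def)
qed

lemma Ck_slice:
  fixes f :: "'a::euclidean_space \<times> real \<Rightarrow> real"
  shows "Ck k f \<Longrightarrow> Ck k (\<lambda>x. f (x, t))"
proof (induction k arbitrary: f)
  case 0
  then show ?case by (auto intro!: continuous_on_compose2[of UNIV f] continuous_intros)
next
  case (Suc k)
  have "Ck k (partial_deriv b (\<lambda>x. f (x, t)))" if "b \<in> Basis" for b
  proof -
    have "partial_deriv b (\<lambda>x. f (x, t)) = (\<lambda>x. partial_deriv (b, 0) f (x, t))"
      using Suc.prems by (auto simp: partial_deriv_slice(2))
    then show ?thesis using Suc Basis_pair_space[OF that] by auto
  qed
  moreover have "f differentiable (at (x, t))" for x using Suc.prems by simp
  ultimately show ?case by (simp add: partial_deriv_slice(1))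
qed

lemma test_function_slice:
  fixes \<eta> :: "'a::euclidean_space \<times> real \<Rightarrow> real"
  assumes t: "test_function S \<eta>" and S: "\<And>x. (x, t) \<in> S \<Longrightarrow> x \<in> U"
  shows "test_function U (\<lambda>x. \<eta> (x, t))"
proof -
  define K where "K = closure {\<xi>. \<eta> \<xi> \<noteq> 0}"
  define L where "L = (\<lambda>x. (x, t)) -` K"
  have K: "compact K" "K \<subseteq> S" using t by (auto simp: test_function_def K_def)
  have closed: "closed L"
    unfolding L_def by (intro closed_vimage continuous_intros) (simp add: K_def)
  have "{x. \<eta> (x, t) \<noteq> 0} \<subseteq> L" using closure_subset[of "{\<xi>. \<eta> \<xi> \<noteq> 0}"] by (auto simp: L_def K_def)
  then have sub: "closure {x. \<eta> (x, t) \<noteq> 0} \<subseteq> L" using closed by (rule closure_minimal)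
  have "L \<subseteq> fst ` K" unfolding L_def by (auto intro: rev_image_eqI)
  moreover have "compact (fst ` K)" by (intro compact_continuous_image continuous_intros K)
  ultimately have "bounded L" using compact_imp_bounded bounded_subset by blast
  then have "bounded {x. \<eta> (x, t) \<noteq> 0}"
    using \<open>{x. \<eta> (x, t) \<noteq> 0} \<subseteq> L\<close> bounded_subset by blast
  then have "compact (closure {x. \<eta> (x, t) \<noteq> 0})" by simp
  moreover have "closure {x. \<eta> (x, t) \<noteq> 0} \<subseteq> U" using sub K(2) S by (auto simp: L_def)
  moreover have "Ck k (\<lambda>x. \<eta> (x, t))" for k using t by (intro Ck_slice) (simp add: test_function_def)
  ultimately show ?thesis unfolding test_function_def by blast
qed

lemma in_Lp_2_imp_integrable:
  fixes f :: "'a::euclidean_space \<Rightarrow> 'b::euclidean_space"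
  assumes f: "in_Lp 2 S f" and S: "S \<in> sets lebesgue" "bounded S"
  shows "integrable (lebesgue_on S) f"
proof (rule Bochner_Integration.integrable_bound)
  show "f \<in> borel_measurable (lebesgue_on S)" using f by (simp add: in_Lp_def)
  have "S \<in> lmeasurable" using S by (simp add: bounded_set_imp_lmeasurable)
  then have "integrable (lebesgue_on S) (\<lambda>x. 1 :: real)"
    using S(1) by (simp add: integrable_restrict_space lmeasurable_iff_integrable)
  then show "integrable (lebesgue_on S) (\<lambda>x. 1 + norm (f x) powr 2)" using f by (simp add: in_Lp_def)
  have "norm (f x) \<le> 1 + norm (f x) powr 2" for x
  proof -
    have "2 * norm (f x) \<le> (norm (f x))\<^sup>2 + 1"
      using zero_le_power2[of "norm (f x) - 1"] by (simp add: power2_diff)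
    then have "norm (f x) \<le> 1 + (norm (f x))\<^sup>2" using norm_ge_zero[of "f x"] by linarith
    then show ?thesis by (simp add: powr_numeral)
  qed
  then show "AE x in lebesgue_on S. norm (f x) \<le> norm (1 + norm (f x) powr 2)"
    by (intro AE_I2) simp
qed

lemma comparison_function_continuous:
  assumes h: "comparison_function m U t1 t2 h" and m: "0 < m"
  shows "continuous_on (closure (cylinder U t1 t2)) (\<lambda>\<xi>. enn2real (h \<xi>))"
    "continuous_on (closure (cylinder U t1 t2)) (\<lambda>\<xi>. enn2real (h \<xi>) powr m)"
proof -
  have "((\<lambda>\<xi>. enn2real (h \<xi>)) \<longlongrightarrow> enn2real (h \<xi>)) (at \<xi> within closure (cylinder U t1 t2))"
    if "\<xi> \<in> closure (cylinder U t1 t2)" for \<xi>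
    using h that by (intro tendsto_enn2real) (auto simp: comparison_function_def continuous_on_def less_top)
  then show c: "continuous_on (closure (cylinder U t1 t2)) (\<lambda>\<xi>. enn2real (h \<xi>))"
    by (simp add: continuous_on_def)
  show "continuous_on (closure (cylinder U t1 t2)) (\<lambda>\<xi>. enn2real (h \<xi>) powr m)"
    using m by (intro continuous_on_powr' c continuous_on_const) auto
qed

text \<open>The weak formulation contains the gradient of \<open>h^m\<close> and is available on
  compactly contained cylinders only. So the cylinder is shrunk around the support of \<eta>, and on
  almost every time slice the definition of the weak gradient, tested with a spatial derivative of
  \<eta>, moves the remaining derivative to \<eta>. The result no longer mentions a gradient of
  \<open>h^m\<close>.\<close>

lemma comparison_function_distributional:
  fixes U :: "(real ^ 'n) set"
  assumes U: "bounded U" "open U" and h: "comparison_function m U t1 t2 h" and m: "0 < m"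
    and \<eta>: "test_function (cylinder U t1 t2) \<eta>"
  defines "v \<equiv> \<lambda>\<xi>. enn2real (h \<xi>) powr m"
  shows "(\<integral>\<xi>. indicator (cylinder U t1 t2) \<xi> *
      (enn2real (h \<xi>) * partial_deriv (0, 1) \<eta> \<xi> + v \<xi> * laplacian \<eta> \<xi>) \<partial>lborel) = 0"
    and "integrable lborel (\<lambda>\<xi>. indicator (cylinder U t1 t2) \<xi> *
      (enn2real (h \<xi>) * partial_deriv (0, 1) \<eta> \<xi> + v \<xi> * laplacian \<eta> \<xi>))"
proof -
  define K where "K = closure {\<xi>. \<eta> \<xi> \<noteq> 0}"
  have K: "compact K" "K \<subseteq> cylinder U t1 t2" using \<eta> by (auto simp: test_function_def K_def)
  have offK: "partial_deriv b \<eta> \<xi> = 0" "partial_deriv c (partial_deriv b \<eta>) \<xi> = 0" if "\<xi> \<notin> K" for \<xi> b c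
  proof -
    show "partial_deriv b \<eta> \<xi> = 0" using that partial_deriv_zero_off_support unfolding K_def by blast
    have "{x. partial_deriv b \<eta> x \<noteq> 0} \<subseteq> K"
      using partial_deriv_zero_off_support[of _ \<eta> b] unfolding K_def by blast
    then have "closure {x. partial_deriv b \<eta> x \<noteq> 0} \<subseteq> K"
      by (rule closure_minimal) (simp add: K_def)
    then show "partial_deriv c (partial_deriv b \<eta>) \<xi> = 0"
      using that partial_deriv_zero_off_support by blast
  qed
  have offL: "laplacian \<eta> \<xi> = 0" if "\<xi> \<notin> K" for \<xi> using offK(2)[OF that] by (simp add: laplacian_def)
  note t\<eta> = test_function_partial_deriv[OF \<eta> Basis_pair_time]
  note cont = comparison_function_continuous[OF h m, folded v_def]
  let ?u = "\<lambda>\<xi>. enn2real (h \<xi>)"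
  have contK: "continuous_on K ?u" "continuous_on K v"
    using cont[THEN continuous_on_subset, OF order_trans[OF K(2) closure_subset]] by auto
  define f where "f = (\<lambda>\<xi>. ?u \<xi> * partial_deriv (0, 1) \<eta> \<xi> + v \<xi> * laplacian \<eta> \<xi>)"
  have bs: "bounded_supp (\<lambda>\<xi>. indicator K \<xi> * (?u \<xi> * partial_deriv (0, 1) \<eta> \<xi>))"
    "bounded_supp (\<lambda>\<xi>. indicator K \<xi> * (v \<xi> * laplacian \<eta> \<xi>))"
    by (intro bounded_supp_indicator_compact K continuous_on_mult contK test_function_continuous[OF t\<eta>]
        laplacian_test_function(2)[OF \<eta>])+
  have ind: "indicator S \<xi> * (?u \<xi> * partial_deriv (0, 1) \<eta> \<xi>) = indicator K \<xi> * (?u \<xi> * partial_deriv (0, 1) \<eta> \<xi>)"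
    "indicator S \<xi> * (v \<xi> * laplacian \<eta> \<xi>) = indicator K \<xi> * (v \<xi> * laplacian \<eta> \<xi>)" if "K \<subseteq> S" for S \<xi>
    using that offK(1)[of \<xi>] offL[of \<xi>] by (auto simp: indicator_def)
  have feq: "indicator (cylinder U t1 t2) \<xi> * f \<xi> = indicator K \<xi> * (?u \<xi> * partial_deriv (0, 1) \<eta> \<xi>)
      + indicator K \<xi> * (v \<xi> * laplacian \<eta> \<xi>)" for \<xi>
    unfolding f_def distrib_left ind[OF K(2)] ..
  show "integrable lborel (\<lambda>\<xi>. indicator (cylinder U t1 t2) \<xi> *
      (enn2real (h \<xi>) * partial_deriv (0, 1) \<eta> \<xi> + v \<xi> * laplacian \<eta> \<xi>))"
    unfolding f_def[THEN fun_cong, symmetric] feq by (intro Bochner_Integration.integrable_add bounded_supp_integrable bs)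
  have main: "(\<integral>\<xi>. indicator K \<xi> * (?u \<xi> * partial_deriv (0, 1) \<eta> \<xi>) \<partial>lborel)
      + (\<integral>\<xi>. indicator K \<xi> * (v \<xi> * laplacian \<eta> \<xi>) \<partial>lborel) = 0"
  proof (cases "K = {}")
    case True
    then show ?thesis by simp
  next
    case False
    \<comment> \<open>The distance to the complement of \<open>U\<close> and to both time ends. Its
      minimum over \<open>K\<close> is positive, and half of it is the amount by which the cylinder
      shrinks.\<close>
    define r where "r = (\<lambda>\<xi>::(real ^ 'n) \<times> real. min (infdist (fst \<xi>) (- U)) (min (snd \<xi> - t1) (t2 - snd \<xi>)))"
    have "continuous_on K r" unfolding r_def by (intro continuous_intros)
    then obtain \<zeta> where \<zeta>: "\<zeta> \<in> K" "\<And>\<xi>. \<xi> \<in> K \<Longrightarrow> r \<zeta> \<le> r \<xi>"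
      using continuous_attains_inf[OF K(1) False] by blast
    have "U \<noteq> UNIV" using U(1) not_bounded_UNIV by blast
    then have "0 < infdist (fst \<zeta>) (- U)"
      using \<zeta>(1) K(2) U(2) by (intro infdist_pos_not_in_closed) (auto simp: cylinder_def closed_Compl)
    then have r0: "0 < r \<zeta>" using \<zeta>(1) K(2) by (auto simp: r_def cylinder_def)
    define s where "s = r \<zeta> / 2"
    have s: "0 < s" "s < r \<zeta>" using r0 by (auto simp: s_def)
    define U' where "U' = {x. s < infdist x (- U)}"
    define s1 where "s1 = t1 + s"
    define s2 where "s2 = t2 - s"
    let ?Q = "cylinder U' s1 s2"
    have inU: "x \<in> U" if "s \<le> infdist x (- U)" for x
      using that s(1) infdist_zero[of x "- U"] by (cases "x \<in> U") auto
    have U': "open U'" unfolding U'_def by (intro open_Collect_less continuous_intros)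
    have U'b: "bounded U'" using U(1) by (rule bounded_subset) (use inU in \<open>auto simp: U'_def\<close>)
    have KQ: "K \<subseteq> ?Q"
    proof
      fix \<xi> assume "\<xi> \<in> K"
      then have "s < r \<xi>" using \<zeta>(2) s by fastforce
      then show "\<xi> \<in> ?Q" by (cases \<xi>) (auto simp: r_def cylinder_def U'_def s1_def s2_def)
    qed
    then have "s1 < s2" using False by (auto simp: cylinder_def)
    have "closed {x. s \<le> infdist x (- U)}" by (intro closed_Collect_le continuous_intros)
    then have "closure U' \<subseteq> {x. s \<le> infdist x (- U)}" by (intro closure_minimal) (auto simp: U'_def)
    then have "closure U' \<subseteq> U" using inU by blast
    then have clQ: "closure ?Q \<subseteq> cylinder U t1 t2"
      using \<open>s1 < s2\<close> s(1) by (auto simp: cylinder_def closure_Times s1_def s2_def)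
    have bQ: "bounded ?Q" unfolding cylinder_def by (intro bounded_Times U'b) auto
    have oQ: "open ?Q" unfolding cylinder_def by (intro open_Times U') auto
    then have Ql: "?Q \<in> sets lebesgue" by (auto intro: borel_open sets_completionI_sets)
    have "cylinder_in (cylinder U t1 t2) U' s1 s2"
      using U' U'b \<open>s1 < s2\<close> clQ bQ by (auto simp: cylinder_in_def compactly_contained_def compact_closure)
    then obtain G where G: "in_L2_W12 U' s1 s2 v G"
      and eqn: "\<And>\<phi>. test_function ?Q \<phi> \<Longrightarrow>
        (\<integral>\<xi>. G \<xi> \<bullet> spatial_grad \<phi> \<xi> \<partial>lebesgue_on ?Q) - (\<integral>\<xi>. ?u \<xi> * time_deriv \<phi> \<xi> \<partial>lebesgue_on ?Q) = 0"
      using h unfolding comparison_function_def parabolic_def weak_solution_def v_def by blast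
    have \<eta>Q: "test_function ?Q \<eta>" using \<eta> KQ by (simp add: test_function_def K_def)
    \<comment> \<open>The two summands cancel on almost every time slice: this is the weak gradient
      identity summed over the coordinate directions.\<close>
    define P where "P = (\<lambda>\<xi>. G \<xi> \<bullet> spatial_grad \<eta> \<xi> + v \<xi> * laplacian \<eta> \<xi>)"
    have GP: "G \<xi> \<bullet> spatial_grad \<eta> \<xi> = (\<Sum>b\<in>Basis. (G \<xi> \<bullet> b) * partial_deriv (b, 0) \<eta> \<xi>)" for \<xi>
    proof -
      have "(\<Sum>b\<in>(Basis :: (real ^ 'n) set). (G \<xi> \<bullet> b) * partial_deriv (b, 0) \<eta> \<xi>)
        = (\<Sum>i\<in>UNIV. (G \<xi> \<bullet> axis i 1) * partial_deriv (axis i 1, 0) \<eta> \<xi>)"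
        by (rule sum.reindex_bij_betw[symmetric, of "\<lambda>i. axis i 1"])
          (auto simp: bij_betw_def inj_on_def axis_eq_axis Basis_vec_def)
      then show ?thesis
        unfolding inner_vec_def[of "G \<xi>" "spatial_grad \<eta> \<xi>"] by (simp add: spatial_grad_def inner_axis)
    qed
    have GL: "integrable (lebesgue_on ?Q) G" and vL: "integrable (lebesgue_on ?Q) v"
      using G Ql bQ by (auto simp: in_L2_W12_def intro!: in_Lp_2_imp_integrable)
    have mult: "integrable (lebesgue_on S) (\<lambda>x. k x * g x)"
      if "integrable (lebesgue_on S) k" "continuous_on UNIV g" "\<And>x. \<bar>g x\<bar> \<le> c" "S \<in> sets lebesgue"
      for S :: "'c::euclidean_space set" and k g :: "'c \<Rightarrow> real" and c
    proof (rule Bochner_Integration.integrable_bound)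
      show "integrable (lebesgue_on S) (\<lambda>x. c * k x)" using that(1) by simp
      have "g \<in> borel_measurable (lebesgue_on S)"
        using that(4) by (intro continuous_imp_measurable_on_sets_lebesgue continuous_on_subset[OF that(2)]) auto
      then show "(\<lambda>x. k x * g x) \<in> borel_measurable (lebesgue_on S)"
        using that(1) by (intro borel_measurable_times) auto
      have "\<bar>k x * g x\<bar> \<le> \<bar>c * k x\<bar>" for x
        using mult_left_mono[OF that(3)[of x], of "\<bar>k x\<bar>"] that(3)[of x] by (simp add: abs_mult mult.commute)
      then show "AE x in lebesgue_on S. norm (k x * g x) \<le> norm (c * k x)" by simp
    qed
    have sb: "\<exists>c. \<forall>x. \<bar>partial_deriv (b, 0) \<eta> x\<bar> \<le> c" "continuous_on UNIV (partial_deriv (b, 0) \<eta>)"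
      "\<exists>c. \<forall>x. \<bar>partial_deriv (b, 0) (partial_deriv (b, 0) \<eta>) x\<bar> \<le> c"
      "continuous_on UNIV (partial_deriv (b, 0) (partial_deriv (b, 0) \<eta>))" if "b \<in> Basis" for b
    proof -
      note t1 = test_function_partial_deriv[OF \<eta> Basis_pair_space[OF that]]
      note t2 = test_function_partial_deriv[OF t1 Basis_pair_space[OF that]]
      show "\<exists>c. \<forall>x. \<bar>partial_deriv (b, 0) \<eta> x\<bar> \<le> c"
        "\<exists>c. \<forall>x. \<bar>partial_deriv (b, 0) (partial_deriv (b, 0) \<eta>) x\<bar> \<le> c"
        by (rule test_function_bounded[OF t1], blast) (rule test_function_bounded[OF t2], blast)
      show "continuous_on UNIV (partial_deriv (b, 0) \<eta>)"
        "continuous_on UNIV (partial_deriv (b, 0) (partial_deriv (b, 0) \<eta>))"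
        using test_function_continuous t1 t2 by blast+
    qed
    have iG: "integrable (lebesgue_on ?Q) (\<lambda>\<xi>. G \<xi> \<bullet> spatial_grad \<eta> \<xi>)"
      unfolding GP
    proof (rule Bochner_Integration.integrable_sum)
      fix b :: "real ^ 'n" assume b: "b \<in> Basis"
      obtain c where "\<And>x. \<bar>partial_deriv (b, 0) \<eta> x\<bar> \<le> c" using sb(1)[OF b] by blast
      then show "integrable (lebesgue_on ?Q) (\<lambda>\<xi>. (G \<xi> \<bullet> b) * partial_deriv (b, 0) \<eta> \<xi>)"
        using GL sb(2)[OF b] Ql by (intro mult) auto
    qed
    have iv: "integrable (lebesgue_on ?Q) (\<lambda>\<xi>. v \<xi> * laplacian \<eta> \<xi>)"
    proof -
      obtain c where "\<And>x. \<bar>laplacian \<eta> x\<bar> \<le> c" using bounded_suppE[OF laplacian_test_function(1)[OF \<eta>]] by metis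
      then show ?thesis using vL laplacian_test_function(2)[OF \<eta>] Ql by (intro mult) auto
    qed
    have PL: "integrable lebesgue (\<lambda>\<xi>. indicator ?Q \<xi> * P \<xi>)"
      using Bochner_Integration.integrable_add[OF iG iv] Ql by (simp add: integrable_restrict_space P_def)
    have "AE t in lebesgue_on {s1<..<s2}. in_W12 U' (\<lambda>x. v (x, t)) (\<lambda>x. G (x, t))"
      using G by (simp add: in_L2_W12_def)
    then have "AE t in lborel. t \<in> {s1<..<s2} \<longrightarrow> in_W12 U' (\<lambda>x. v (x, t)) (\<lambda>x. G (x, t))"
      by (subst (asm) AE_restrict_space_iff) (auto simp: AE_completion_iff)
    then have slices: "AE t in lborel. (\<lambda>x. indicator ?Q (x, t) * P (x, t)) \<in> borel_measurable lebesgue \<and>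
       (\<integral>x. indicator ?Q (x, t) * P (x, t) \<partial>lebesgue) = 0"
    proof eventually_elim
      case (elim t)
      show ?case
      proof (cases "t \<in> {s1<..<s2}")
        case False
        then have "(\<lambda>x. indicator ?Q (x, t) * P (x, t)) = (\<lambda>x. 0)" by (auto simp: cylinder_def indicator_def)
        then show ?thesis by simp
      next
        case True
        then have W: "in_W12 U' (\<lambda>x. v (x, t)) (\<lambda>x. G (x, t))" using elim by blast
        have U'l: "U' \<in> sets lebesgue" using U' by (auto intro: borel_open sets_completionI_sets)
        have Gt: "integrable (lebesgue_on U') (\<lambda>x. G (x, t))" and vt: "integrable (lebesgue_on U') (\<lambda>x. v (x, t))"
          using W U'l U'b by (auto simp: in_W12_def intro!: in_Lp_2_imp_integrable)
        have each: "(\<integral>x. v (x, t) * partial_deriv (b, 0) (partial_deriv (b, 0) \<eta>) (x, t) \<partial>lebesgue_on U')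
            = - (\<integral>x. (G (x, t) \<bullet> b) * partial_deriv (b, 0) \<eta> (x, t) \<partial>lebesgue_on U')"
          "integrable (lebesgue_on U') (\<lambda>x. v (x, t) * partial_deriv (b, 0) (partial_deriv (b, 0) \<eta>) (x, t))"
          "integrable (lebesgue_on U') (\<lambda>x. (G (x, t) \<bullet> b) * partial_deriv (b, 0) \<eta> (x, t))"
          if b: "b \<in> Basis" for b
        proof -
          note tb = test_function_partial_deriv[OF \<eta>Q Basis_pair_space[OF b]]
          have "test_function U' (\<lambda>x. partial_deriv (b, 0) \<eta> (x, t))"
            by (rule test_function_slice[OF tb]) (auto simp: cylinder_def)
          then have "(\<integral>x. v (x, t) * partial_deriv b (\<lambda>x. partial_deriv (b, 0) \<eta> (x, t)) x \<partial>lebesgue_on U')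
            = - (\<integral>x. (G (x, t) \<bullet> b) * partial_deriv (b, 0) \<eta> (x, t) \<partial>lebesgue_on U')"
            using W b unfolding in_W12_def by blast
          then show "(\<integral>x. v (x, t) * partial_deriv (b, 0) (partial_deriv (b, 0) \<eta>) (x, t) \<partial>lebesgue_on U')
            = - (\<integral>x. (G (x, t) \<bullet> b) * partial_deriv (b, 0) \<eta> (x, t) \<partial>lebesgue_on U')"
            by (simp add: partial_deriv_slice(2)[OF test_function_differentiable[OF tb]])
          have pc: "continuous_on UNIV (\<lambda>x. g (x, t))" if "continuous_on UNIV g" for g :: "(real ^ 'n) \<times> real \<Rightarrow> real"
            using that by (rule continuous_on_compose2) (auto intro!: continuous_intros)
          show "integrable (lebesgue_on U') (\<lambda>x. v (x, t) * partial_deriv (b, 0) (partial_deriv (b, 0) \<eta>) (x, t))"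
            using sb(3)[OF b] by (elim exE, intro mult vt U'l pc[OF sb(4)[OF b]]) blast
          show "integrable (lebesgue_on U') (\<lambda>x. (G (x, t) \<bullet> b) * partial_deriv (b, 0) \<eta> (x, t))"
            using sb(1)[OF b] Gt by (elim exE, intro mult U'l pc[OF sb(2)[OF b]]) auto
        qed
        have Pt: "P (x, t) = (\<Sum>b\<in>Basis. (G (x, t) \<bullet> b) * partial_deriv (b, 0) \<eta> (x, t)
           + v (x, t) * partial_deriv (b, 0) (partial_deriv (b, 0) \<eta>) (x, t))" for x
          by (simp add: P_def GP laplacian_def sum.distrib sum_distrib_left)
        have iP: "integrable (lebesgue_on U') (\<lambda>x. P (x, t))"
          unfolding Pt by (intro Bochner_Integration.integrable_sum Bochner_Integration.integrable_add each)
        have "(\<integral>x. P (x, t) \<partial>lebesgue_on U') = (\<Sum>b\<in>Basis. \<integral>x. (G (x, t) \<bullet> b) * partial_deriv (b, 0) \<eta> (x, t)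
           + v (x, t) * partial_deriv (b, 0) (partial_deriv (b, 0) \<eta>) (x, t) \<partial>lebesgue_on U')"
          unfolding Pt by (intro Bochner_Integration.integral_sum Bochner_Integration.integrable_add each)
        also have "\<dots> = 0"
          by (intro sum.neutral ballI) (simp add: Bochner_Integration.integral_add each)
        finally have 0: "(\<integral>x. P (x, t) \<partial>lebesgue_on U') = 0" .
        have e: "indicator ?Q (x, t) * P (x, t) = indicator U' x *\<^sub>R P (x, t)" for x
          using True by (simp add: cylinder_def indicator_def)
        have "integrable lebesgue (\<lambda>x. indicator U' x *\<^sub>R P (x, t))"
          using iP U'l by (simp add: integrable_restrict_space)
        moreover have "(\<integral>x. indicator U' x *\<^sub>R P (x, t) \<partial>lebesgue) = 0"
          using 0 U'l by (simp add: integral_restrict_space)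
        ultimately show ?thesis unfolding e by auto
      qed
    qed
    have "(\<integral>\<xi>. P \<xi> \<partial>lebesgue_on ?Q) = 0"
      using integral_lebesgue_zero_slices[OF PL slices] Ql by (simp add: integral_restrict_space)
    then have 1: "(\<integral>\<xi>. G \<xi> \<bullet> spatial_grad \<eta> \<xi> \<partial>lebesgue_on ?Q) + (\<integral>\<xi>. v \<xi> * laplacian \<eta> \<xi> \<partial>lebesgue_on ?Q) = 0"
      unfolding P_def Bochner_Integration.integral_add[OF iG iv] .
    have 2: "(\<integral>\<xi>. G \<xi> \<bullet> spatial_grad \<eta> \<xi> \<partial>lebesgue_on ?Q) = (\<integral>\<xi>. ?u \<xi> * partial_deriv (0, 1) \<eta> \<xi> \<partial>lebesgue_on ?Q)"
      using eqn[OF \<eta>Q] by (simp add: time_deriv_def)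
    \<comment> \<open>The test function and its derivatives vanish off \<open>K\<close>, so the
      Lebesgue integrals over the smaller cylinder agree with Borel integrals over
      \<open>K\<close>.\<close>
    have conv: "(\<integral>\<xi>. k \<xi> \<partial>lebesgue_on ?Q) = (\<integral>\<xi>. indicator K \<xi> * k \<xi> \<partial>lborel)"
      if "bounded_supp (\<lambda>\<xi>. indicator K \<xi> * k \<xi>)" "\<And>\<xi>. indicator ?Q \<xi> * k \<xi> = indicator K \<xi> * k \<xi>" for k
    proof -
      have "(\<integral>\<xi>. k \<xi> \<partial>lebesgue_on ?Q) = (\<integral>\<xi>. indicator K \<xi> * k \<xi> \<partial>lebesgue)"
        by (subst integral_restrict_space) (use Ql in simp, simp only: real_scaleR_def that(2))
      also have "\<dots> = (\<integral>\<xi>. indicator K \<xi> * k \<xi> \<partial>lborel)"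
        by (rule integral_completion) (use that(1) in \<open>simp add: bounded_supp_def\<close>)
      finally show ?thesis .
    qed
    show ?thesis using 1 2 conv[OF bs(1) ind(1)[OF KQ]] conv[OF bs(2) ind(2)[OF KQ]] by simp
  qed
  show "(\<integral>\<xi>. indicator (cylinder U t1 t2) \<xi> *
      (enn2real (h \<xi>) * partial_deriv (0, 1) \<eta> \<xi> + v \<xi> * laplacian \<eta> \<xi>) \<partial>lborel) = 0"
    unfolding f_def[THEN fun_cong, symmetric] feq
    using main bs[THEN bounded_supp_integrable] by simp
qed

subsection \<open>Comparison for the porous medium equation\<close>

text \<open>Above, the slope is a value of the derivative. Below, with \<open>q\<close> the larger
  argument, \<open>p^m \<le> p q^(m-1)\<close> gives a slope of at least \<open>q^(m-1)\<close>. The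
  smaller argument may be zero, where the derivative itself would give no positive bound for
  \<open>m > 1\<close>.\<close>

lemma powr_difference_quotient:
  fixes x y :: real
  assumes m: "1 \<le> m" and xy: "0 \<le> x" "0 \<le> y" "x \<le> H" "y \<le> H" and c: "0 < c" "c \<le> max x y"
  shows "\<exists>a. c powr (m - 1) \<le> a \<and> a \<le> m * H powr (m - 1) \<and> x powr m - y powr m = a * (x - y)"
proof -
  have less: "\<exists>a. c powr (m - 1) \<le> a \<and> a \<le> m * H powr (m - 1) \<and> q powr m - p powr m = a * (q - p)"
    if pq: "0 \<le> p" "p < q" "q \<le> H" "c \<le> q" for p q
  proof -
    have "continuous_on {p..q} (\<lambda>s. s powr m)"
      using pq m by (intro continuous_on_powr' continuous_intros) auto
    moreover have "((\<lambda>s. s powr m) has_real_derivative m * s powr (m - 1)) (at s)" if "p < s" "s < q" for s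
      using that pq by (intro has_real_derivative_powr) auto
    ultimately obtain s where s: "p < s" "s < q" "q powr m - p powr m = (q - p) * (m * s powr (m - 1))"
      using MVT[OF pq(2), of "\<lambda>s. s powr m"] by (metis DERIV_unique real_differentiable_def)
    have "s powr (m - 1) \<le> H powr (m - 1)" using s pq m by (intro powr_mono2) auto
    then have up: "m * s powr (m - 1) \<le> m * H powr (m - 1)" using m by simp
    have "q powr m = q * q powr (m - 1)" using pq by (simp add: powr_mult_base)
    moreover have "p powr m \<le> p * q powr (m - 1)"
    proof (cases "p = 0")
      case False
      then have "p powr m = p * p powr (m - 1)" using pq by (simp add: powr_mult_base)
      then show ?thesis using pq m by (simp add: mult_left_mono powr_mono2)
    qed simp
    ultimately have "(q - p) * q powr (m - 1) \<le> q powr m - p powr m" by (simp add: algebra_simps)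
    then have "q powr (m - 1) \<le> m * s powr (m - 1)" using s pq by (simp add: mult_le_cancel_left)
    moreover have "c powr (m - 1) \<le> q powr (m - 1)" using pq c m by (intro powr_mono2) auto
    ultimately show ?thesis using up s(3) by (intro exI[of _ "m * s powr (m - 1)"]) auto
  qed
  consider "x < y" | "y < x" | "x = y" by linarith
  then show ?thesis
  proof cases
    case 1
    then obtain a where "c powr (m - 1) \<le> a" "a \<le> m * H powr (m - 1)" "y powr m - x powr m = a * (y - x)"
      using less[of x y] xy c by auto
    then show ?thesis by (intro exI[of _ a]) (auto simp: algebra_simps)
  next
    case 2
    then show ?thesis using less[of y x] xy c by auto
  next
    case 3
    have "c powr (m - 1) \<le> H powr (m - 1)" using xy c m 3 by (intro powr_mono2) auto
    moreover have "1 * H powr (m - 1) \<le> m * H powr (m - 1)" using m by (intro mult_right_mono) auto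
    ultimately have "c powr (m - 1) \<le> m * H powr (m - 1)" by linarith
    then show ?thesis using 3 by auto
  qed
qed

lemma distributional_comparison:
  fixes U :: "'a::euclidean_space set" and p q :: "'a \<times> real \<Rightarrow> real"
  assumes U: "bounded U" "open U" and m: "1 \<le> m" and c: "0 < c"
    and cont: "continuous_on (closure U \<times> {t1..t2}) p" "continuous_on (closure U \<times> {t1..t2}) q"
    and range: "\<And>\<xi>. \<xi> \<in> closure U \<times> {t1..t2} \<Longrightarrow> 0 \<le> p \<xi> \<and> 0 \<le> q \<xi> \<and> c \<le> max (p \<xi>) (q \<xi>)"
    and bdry: "\<And>\<xi>. \<xi> \<in> parabolic_boundary U t1 t2 \<Longrightarrow> p \<xi> < q \<xi>"
    and sub: "\<And>\<eta>. test_function (cylinder U t1 t2) \<eta> \<Longrightarrow> (\<And>\<xi>. 0 \<le> \<eta> \<xi>) \<Longrightarrow>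
      integrable lborel (\<lambda>\<xi>. indicator (cylinder U t1 t2) \<xi> * (p \<xi> * partial_deriv (0, 1) \<eta> \<xi> + p \<xi> powr m * laplacian \<eta> \<xi>)) \<and>
      0 \<le> (\<integral>\<xi>. indicator (cylinder U t1 t2) \<xi> * (p \<xi> * partial_deriv (0, 1) \<eta> \<xi> + p \<xi> powr m * laplacian \<eta> \<xi>) \<partial>lborel)"
    and super: "\<And>\<eta>. test_function (cylinder U t1 t2) \<eta> \<Longrightarrow> (\<And>\<xi>. 0 \<le> \<eta> \<xi>) \<Longrightarrow>
      integrable lborel (\<lambda>\<xi>. indicator (cylinder U t1 t2) \<xi> * (q \<xi> * partial_deriv (0, 1) \<eta> \<xi> + q \<xi> powr m * laplacian \<eta> \<xi>)) \<and>
      (\<integral>\<xi>. indicator (cylinder U t1 t2) \<xi> * (q \<xi> * partial_deriv (0, 1) \<eta> \<xi> + q \<xi> powr m * laplacian \<eta> \<xi>) \<partial>lborel) \<le> 0"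
    and \<zeta>: "\<zeta> \<in> cylinder U t1 t2"
  shows "p \<zeta> \<le> q \<zeta>"
proof -
  let ?C = "closure U \<times> {t1..t2}"
  have C: "compact ?C" using U by (intro compact_Times) (auto simp: compact_closure)
  have "bounded (p ` ?C)" "bounded (q ` ?C)"
    using compact_continuous_image[OF cont(1) C] compact_continuous_image[OF cont(2) C] compact_imp_bounded by blast+
  then obtain H1 H2 where "\<And>\<xi>. \<xi> \<in> ?C \<Longrightarrow> p \<xi> \<le> H1" "\<And>\<xi>. \<xi> \<in> ?C \<Longrightarrow> q \<xi> \<le> H2"
    unfolding bounded_iff by (metis abs_le_D1 imageI real_norm_def)
  then have H: "\<And>\<xi>. \<xi> \<in> ?C \<Longrightarrow> p \<xi> \<le> max H1 H2 \<and> q \<xi> \<le> max H1 H2" by fastforce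
  have cp: "continuous_on ?C (\<lambda>\<xi>. p \<xi> powr m)" "continuous_on ?C (\<lambda>\<xi>. q \<xi> powr m)"
    using range m by (auto intro!: continuous_on_powr' cont continuous_on_const)
  interpret comparison_pair U t1 t2 "c powr (m - 1)" "m * max H1 H2 powr (m - 1)"
    "\<lambda>\<xi>. p \<xi> - q \<xi>" "\<lambda>\<xi>. p \<xi> powr m - q \<xi> powr m"
  proof
    fix \<xi> assume "\<xi> \<in> ?C"
    then show "\<exists>a. c powr (m - 1) \<le> a \<and> a \<le> m * max H1 H2 powr (m - 1) \<and>
        p \<xi> powr m - q \<xi> powr m = a * (p \<xi> - q \<xi>)"
      using range[of \<xi>] H[of \<xi>] by (intro powr_difference_quotient m c) auto
  next
    fix \<eta> assume \<eta>: "test_function (cylinder U t1 t2) \<eta>" "\<And>\<xi>. 0 \<le> \<eta> \<xi>"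
    let ?I = "\<lambda>r \<xi>. indicator (cylinder U t1 t2) \<xi> * (r \<xi> * partial_deriv (0, 1) \<eta> \<xi> + r \<xi> powr m * laplacian \<eta> \<xi>)"
    have "(\<integral>\<xi>. indicator (cylinder U t1 t2) \<xi> * ((p \<xi> - q \<xi>) * partial_deriv (0, 1) \<eta> \<xi>
         + (p \<xi> powr m - q \<xi> powr m) * laplacian \<eta> \<xi>) \<partial>lborel) = (\<integral>\<xi>. ?I p \<xi> - ?I q \<xi> \<partial>lborel)"
      by (rule Bochner_Integration.integral_cong) (simp_all add: algebra_simps)
    also have "\<dots> = (\<integral>\<xi>. ?I p \<xi> \<partial>lborel) - (\<integral>\<xi>. ?I q \<xi> \<partial>lborel)"
      using sub[OF \<eta>] super[OF \<eta>] by (intro Bochner_Integration.integral_diff) auto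
    finally show "0 \<le> (\<integral>\<xi>. indicator (cylinder U t1 t2) \<xi> * ((p \<xi> - q \<xi>) * partial_deriv (0, 1) \<eta> \<xi>
         + (p \<xi> powr m - q \<xi> powr m) * laplacian \<eta> \<xi>) \<partial>lborel)"
      using sub[OF \<eta>] super[OF \<eta>] by linarith
  next
    show "p \<xi> - q \<xi> < 0" if "\<xi> \<in> parabolic_boundary U t1 t2" for \<xi> using bdry[OF that] by simp
  qed (use U c cont cp in \<open>auto intro: continuous_on_diff\<close>)
  show ?thesis using nonpos[OF \<zeta>] by simp
qed

lemma closure_cylinder: "t1 < t2 \<Longrightarrow> closure (cylinder U t1 t2) = closure U \<times> {t1..t2}"
  by (simp add: cylinder_def closure_Times)

lemma parabolic_boundary_subset: "t1 < t2 \<Longrightarrow> parabolic_boundary U t1 t2 \<subseteq> closure U \<times> {t1..t2}"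
  by (auto simp: parabolic_boundary_def frontier_def)

text \<open>The pointwise condition is the differential inequality \<open>\<partial>\<^sub>t p \<ge> \<Delta>(p\<^sup>m)\<close>, with \<open>pt\<close> the time
  derivative of \<open>p\<close> and \<open>q1 b\<close>, \<open>q2 b\<close> the first and second derivatives of \<open>p\<^sup>m\<close> in direction \<open>b\<close>.\<close>

lemma classical_comparison:
  fixes U :: "(real ^ 'n) set" and q1 q2 :: "real ^ 'n \<Rightarrow> (real ^ 'n) \<times> real \<Rightarrow> real"
  assumes U: "bounded U" "open U" and t12: "t1 < t2" and m: "1 \<le> m" and c: "0 < c"
    and h: "comparison_function m U t1 t2 h"
    and p: "continuous_on (closure U \<times> {t1..t2}) p" "\<And>\<xi>. \<xi> \<in> closure U \<times> {t1..t2} \<Longrightarrow> c \<le> p \<xi>"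
      "continuous_on (cylinder U t1 t2) pt"
      "\<And>\<xi>. \<xi> \<in> cylinder U t1 t2 \<Longrightarrow> ((\<lambda>s. p (\<xi> + s *\<^sub>R (0, 1))) has_real_derivative pt \<xi>) (at 0)"
    and q: "\<And>b. b \<in> Basis \<Longrightarrow> continuous_on (cylinder U t1 t2) (q1 b)"
      "\<And>b. b \<in> Basis \<Longrightarrow> continuous_on (cylinder U t1 t2) (q2 b)"
      "\<And>b \<xi>. b \<in> Basis \<Longrightarrow> \<xi> \<in> cylinder U t1 t2 \<Longrightarrow>
        ((\<lambda>s. p (\<xi> + s *\<^sub>R (b, 0)) powr m) has_real_derivative q1 b \<xi>) (at 0)"
      "\<And>b \<xi>. b \<in> Basis \<Longrightarrow> \<xi> \<in> cylinder U t1 t2 \<Longrightarrow>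
        ((\<lambda>s. q1 b (\<xi> + s *\<^sub>R (b, 0))) has_real_derivative q2 b \<xi>) (at 0)"
  shows "(\<And>\<xi>. \<xi> \<in> cylinder U t1 t2 \<Longrightarrow> (\<Sum>b\<in>Basis. q2 b \<xi>) \<le> pt \<xi>) \<Longrightarrow>
      (\<And>\<xi>. \<xi> \<in> parabolic_boundary U t1 t2 \<Longrightarrow> enn2real (h \<xi>) < p \<xi>) \<Longrightarrow>
      \<zeta> \<in> cylinder U t1 t2 \<Longrightarrow> enn2real (h \<zeta>) \<le> p \<zeta>"
    and "(\<And>\<xi>. \<xi> \<in> cylinder U t1 t2 \<Longrightarrow> pt \<xi> \<le> (\<Sum>b\<in>Basis. q2 b \<xi>)) \<Longrightarrow>
      (\<And>\<xi>. \<xi> \<in> parabolic_boundary U t1 t2 \<Longrightarrow> p \<xi> < enn2real (h \<xi>)) \<Longrightarrow>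
      \<zeta> \<in> cylinder U t1 t2 \<Longrightarrow> p \<zeta> \<le> enn2real (h \<zeta>)"
proof -
  let ?S = "cylinder U t1 t2" and ?C = "closure U \<times> {t1..t2}"
  have m0: "0 < m" using m by simp
  have S: "open ?S" unfolding cylinder_def using U by (intro open_Times) auto
  have SC: "?S \<subseteq> ?C" using closure_subset by (auto simp: cylinder_def)
  have pS: "continuous_on ?S p" using p(1) SC continuous_on_subset by blast
  have pmS: "continuous_on ?S (\<lambda>\<xi>. p \<xi> powr m)"
    using p(2) SC c m0 by (intro continuous_on_powr' pS continuous_on_const) force
  have hc: "continuous_on ?C (\<lambda>\<xi>. enn2real (h \<xi>))"
    using comparison_function_continuous(1)[OF h m0] by (simp add: closure_cylinder[OF t12])
  have hD: "integrable lborel (\<lambda>\<xi>. indicator ?S \<xi> * (enn2real (h \<xi>) * partial_deriv (0, 1) \<eta> \<xi> + enn2real (h \<xi>) powr m * laplacian \<eta> \<xi>))"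
    "(\<integral>\<xi>. indicator ?S \<xi> * (enn2real (h \<xi>) * partial_deriv (0, 1) \<eta> \<xi> + enn2real (h \<xi>) powr m * laplacian \<eta> \<xi>) \<partial>lborel) = 0"
    if "test_function ?S \<eta>" for \<eta>
    using comparison_function_distributional[OF U h m0 that] by auto
  have pD: "integrable lborel (\<lambda>\<xi>. indicator ?S \<xi> * (p \<xi> * partial_deriv (0, 1) \<eta> \<xi> + p \<xi> powr m * laplacian \<eta> \<xi>))"
    "(\<integral>\<xi>. indicator ?S \<xi> * (p \<xi> * partial_deriv (0, 1) \<eta> \<xi> + p \<xi> powr m * laplacian \<eta> \<xi>) \<partial>lborel)
      = (\<integral>\<xi>. indicator ?S \<xi> * (((\<Sum>b\<in>Basis. q2 b \<xi>) - pt \<xi>) * \<eta> \<xi>) \<partial>lborel)"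
    if "test_function ?S \<eta>" for \<eta>
    using classical_imp_distributional[OF S that pS p(3,4) pmS q(1,2)] q(3,4) by auto
  {
    assume ineq: "\<And>\<xi>. \<xi> \<in> ?S \<Longrightarrow> (\<Sum>b\<in>Basis. q2 b \<xi>) \<le> pt \<xi>"
      and b: "\<And>\<xi>. \<xi> \<in> parabolic_boundary U t1 t2 \<Longrightarrow> enn2real (h \<xi>) < p \<xi>" and \<zeta>: "\<zeta> \<in> ?S"
    show "enn2real (h \<zeta>) \<le> p \<zeta>"
    proof (rule distributional_comparison[OF U m c hc p(1) _ b _ _ \<zeta>])
      show "0 \<le> enn2real (h \<xi>) \<and> 0 \<le> p \<xi> \<and> c \<le> max (enn2real (h \<xi>)) (p \<xi>)" if "\<xi> \<in> ?C" for \<xi>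
        using p(2)[OF that] c by auto
      fix \<eta> assume \<eta>: "test_function ?S \<eta>" "\<And>\<xi>. 0 \<le> \<eta> \<xi>"
      have "0 \<le> (\<integral>\<xi>. - (indicator ?S \<xi> * (((\<Sum>b\<in>Basis. q2 b \<xi>) - pt \<xi>) * \<eta> \<xi>)) \<partial>lborel)"
        using ineq \<eta>(2) by (intro integral_nonneg_AE AE_I2) (auto simp: indicator_def mult_nonpos_nonneg)
      then show "integrable lborel (\<lambda>\<xi>. indicator ?S \<xi> * (p \<xi> * partial_deriv (0, 1) \<eta> \<xi> + p \<xi> powr m * laplacian \<eta> \<xi>)) \<and>
        (\<integral>\<xi>. indicator ?S \<xi> * (p \<xi> * partial_deriv (0, 1) \<eta> \<xi> + p \<xi> powr m * laplacian \<eta> \<xi>) \<partial>lborel) \<le> 0"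
        using pD[OF \<eta>(1)] by simp
    qed (use hD in auto)
  }
  {
    assume ineq: "\<And>\<xi>. \<xi> \<in> ?S \<Longrightarrow> pt \<xi> \<le> (\<Sum>b\<in>Basis. q2 b \<xi>)"
      and b: "\<And>\<xi>. \<xi> \<in> parabolic_boundary U t1 t2 \<Longrightarrow> p \<xi> < enn2real (h \<xi>)" and \<zeta>: "\<zeta> \<in> ?S"
    show "p \<zeta> \<le> enn2real (h \<zeta>)"
    proof (rule distributional_comparison[OF U m c p(1) hc _ b _ _ \<zeta>])
      show "0 \<le> p \<xi> \<and> 0 \<le> enn2real (h \<xi>) \<and> c \<le> max (p \<xi>) (enn2real (h \<xi>))" if "\<xi> \<in> ?C" for \<xi>
        using p(2)[OF that] c by auto
      fix \<eta> assume \<eta>: "test_function ?S \<eta>" "\<And>\<xi>. 0 \<le> \<eta> \<xi>"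
      have "0 \<le> (\<integral>\<xi>. indicator ?S \<xi> * (((\<Sum>b\<in>Basis. q2 b \<xi>) - pt \<xi>) * \<eta> \<xi>) \<partial>lborel)"
        using ineq \<eta>(2) by (intro integral_nonneg_AE AE_I2) (auto simp: indicator_def)
      then show "integrable lborel (\<lambda>\<xi>. indicator ?S \<xi> * (p \<xi> * partial_deriv (0, 1) \<eta> \<xi> + p \<xi> powr m * laplacian \<eta> \<xi>)) \<and>
        0 \<le> (\<integral>\<xi>. indicator ?S \<xi> * (p \<xi> * partial_deriv (0, 1) \<eta> \<xi> + p \<xi> powr m * laplacian \<eta> \<xi>) \<partial>lborel)"
        using pD[OF \<eta>(1)] by simp
    qed (use hD in auto)
  }
qed

section \<open>Comparison with explicit functions\<close>

text \<open>The general comparison needs strict inequality on the parabolic boundary. So the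
  constant is moved slightly, up for a majorant and down, staying positive, for a minorant, and the
  limit is taken at the end.\<close>

lemma constant_comparison:
  fixes U :: "(real ^ 'n) set"
  assumes U: "bounded U" "open U" and t12: "t1 < t2" and m: "1 \<le> m" and M: "0 < M"
    and h: "comparison_function m U t1 t2 h"
  shows "(\<And>\<xi>. \<xi> \<in> parabolic_boundary U t1 t2 \<Longrightarrow> enn2real (h \<xi>) \<le> M) \<Longrightarrow>
      \<zeta> \<in> cylinder U t1 t2 \<Longrightarrow> enn2real (h \<zeta>) \<le> M"
    and "(\<And>\<xi>. \<xi> \<in> parabolic_boundary U t1 t2 \<Longrightarrow> M \<le> enn2real (h \<xi>)) \<Longrightarrow>
      \<zeta> \<in> cylinder U t1 t2 \<Longrightarrow> M \<le> enn2real (h \<zeta>)"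
proof -
  note comp = classical_comparison[OF U t12 m _ h, where pt = "\<lambda>_. 0" and ?q1.0 = "\<lambda>_ _. 0" and ?q2.0 = "\<lambda>_ _. 0"]
  {
    assume b: "\<And>\<xi>. \<xi> \<in> parabolic_boundary U t1 t2 \<Longrightarrow> enn2real (h \<xi>) \<le> M" and \<zeta>: "\<zeta> \<in> cylinder U t1 t2"
    show "enn2real (h \<zeta>) \<le> M"
    proof (rule field_le_epsilon)
      fix e :: real assume "0 < e"
      then show "enn2real (h \<zeta>) \<le> M + e"
        using M by (intro comp(1)[where p = "\<lambda>_. M + e" and c = M] \<zeta>) (auto dest!: b)
    qed
  }
  {
    assume b: "\<And>\<xi>. \<xi> \<in> parabolic_boundary U t1 t2 \<Longrightarrow> M \<le> enn2real (h \<xi>)" and \<zeta>: "\<zeta> \<in> cylinder U t1 t2"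
    show "M \<le> enn2real (h \<zeta>)"
    proof (rule dense_le_bounded[OF M])
      fix c assume "0 < c" "c < M"
      then show "c \<le> enn2real (h \<zeta>)"
        by (intro comp(2)[where p = "\<lambda>_. c" and c = c] \<zeta>) (auto dest!: b)
    qed
  }
qed

text \<open>The \<open>m\<close>-th power of the comparison function is a quadratic polynomial with
  Laplacian \<open>2 \<beta> CARD('n)\<close>, so \<open>super\<close> is the supersolution
  inequality. It is asked for with \<open>a + \<kappa>\<close> in place of \<open>a\<close>, since
  the extra \<kappa> makes the boundary inequality strict.\<close>

lemma quadratic_comparison:
  fixes U :: "(real ^ 'n) set" and m a \<beta> K :: real
  assumes U: "bounded U" "open U" and t12: "0 \<le> t1" "t1 < t2" and m: "1 \<le> m"
    and abK: "0 < a" "0 \<le> \<beta>" "0 \<le> K" and h: "comparison_function m U t1 t2 h"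
    and super: "\<And>x t \<kappa>. (x, t) \<in> cylinder U t1 t2 \<Longrightarrow> 0 < \<kappa> \<Longrightarrow> \<kappa> < 1 \<Longrightarrow>
      2 * \<beta> * CARD('n) \<le> (1 / m) * (a + \<kappa> + \<beta> * (x \<bullet> x) + K * t) powr (1 / m - 1) * K"
    and bdry: "\<And>x t. (x, t) \<in> parabolic_boundary U t1 t2 \<Longrightarrow>
      enn2real (h (x, t)) \<le> (a + \<beta> * (x \<bullet> x) + K * t) powr (1 / m)"
    and \<zeta>: "(y, s) \<in> cylinder U t1 t2"
  shows "enn2real (h (y, s)) \<le> (a + \<beta> * (y \<bullet> y) + K * s) powr (1 / m)"
proof -
  have m0: "m \<noteq> 0" using m by simp
  have est: "enn2real (h (y, s)) \<le> (a + \<kappa> + \<beta> * (y \<bullet> y) + K * s) powr (1 / m)" if \<kappa>: "0 < \<kappa>" "\<kappa> < 1" for \<kappa>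
  proof -
    let ?w = "\<lambda>\<xi>::(real ^ 'n) \<times> real. a + \<kappa> + \<beta> * (fst \<xi> \<bullet> fst \<xi>) + K * snd \<xi>"
    have wa: "a \<le> ?w \<xi>" if "0 \<le> snd \<xi>" for \<xi>
      using that abK \<kappa> by (simp add: add_nonneg_nonneg)
    have "enn2real (h (y, s)) \<le> ?w (y, s) powr (1 / m)"
    proof (rule classical_comparison(1)[OF U t12(2) m _ h _ _ _ _ _ _ _ _ _ _ \<zeta>, where p = "\<lambda>\<xi>. ?w \<xi> powr (1 / m)"
        and pt = "\<lambda>\<xi>. (1 / m) * ?w \<xi> powr (1 / m - 1) * K" and ?q1.0 = "\<lambda>b \<xi>. 2 * \<beta> * (fst \<xi> \<bullet> b)"
        and ?q2.0 = "\<lambda>_ _. 2 * \<beta>" and c = "a powr (1 / m)"])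
      show "0 < a powr (1 / m)" using abK by simp
      show "a powr (1 / m) \<le> ?w \<xi> powr (1 / m)" if "\<xi> \<in> closure U \<times> {t1..t2}" for \<xi>
        using that t12 m abK wa[of \<xi>] by (intro powr_mono2) auto
      have pos: "0 < ?w \<xi>" if "\<xi> \<in> closure U \<times> {t1..t2}" for \<xi> using that t12 wa[of \<xi>] abK by auto
      have pos': "0 < ?w \<xi>" if "\<xi> \<in> cylinder U t1 t2" for \<xi> using that t12 wa[of \<xi>] abK by (auto simp: cylinder_def)
      show "continuous_on (closure U \<times> {t1..t2}) (\<lambda>\<xi>. ?w \<xi> powr (1 / m))"
        using pos by (intro continuous_intros) force
      show "continuous_on (cylinder U t1 t2) (\<lambda>\<xi>. (1 / m) * ?w \<xi> powr (1 / m - 1) * K)"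
        using pos' by (intro continuous_intros) force
      show "((\<lambda>s. ?w (\<xi> + s *\<^sub>R (0, 1)) powr (1 / m)) has_real_derivative (1 / m) * ?w \<xi> powr (1 / m - 1) * K) (at 0)"
        if "\<xi> \<in> cylinder U t1 t2" for \<xi>
        using pos'[OF that] by (auto intro!: derivative_eq_intros)
      show "((\<lambda>s. (?w (\<xi> + s *\<^sub>R (b, 0)) powr (1 / m)) powr m) has_real_derivative 2 * \<beta> * (fst \<xi> \<bullet> b)) (at 0)"
        if "\<xi> \<in> cylinder U t1 t2" for b \<xi>
      proof -
        have "0 \<le> ?w (\<xi> + s *\<^sub>R (b, 0))" for s
          using that t12 abK wa[of "\<xi> + s *\<^sub>R (b, 0)"] by (auto simp: cylinder_def)
        then have "(?w (\<xi> + s *\<^sub>R (b, 0)) powr (1 / m)) powr m = ?w (\<xi> + s *\<^sub>R (b, 0))" for s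
          using m0 by (simp only: powr_powr) simp
        moreover have "((\<lambda>s. ?w (\<xi> + s *\<^sub>R (b, 0))) has_real_derivative 2 * \<beta> * (fst \<xi> \<bullet> b)) (at 0)"
          by (simp add: inner_add_left inner_add_right) (auto intro!: derivative_eq_intros simp: inner_commute)
        ultimately show ?thesis by simp
      qed
      show "((\<lambda>s. 2 * \<beta> * (fst (\<xi> + s *\<^sub>R (b, 0)) \<bullet> b)) has_real_derivative 2 * \<beta>) (at 0)" if "b \<in> Basis" for b :: "real ^ 'n" and \<xi>
        using that by (auto simp: inner_add_left intro!: derivative_eq_intros)
      show "(\<Sum>b\<in>(Basis :: (real ^ 'n) set). 2 * \<beta>) \<le> (1 / m) * ?w \<xi> powr (1 / m - 1) * K" if "\<xi> \<in> cylinder U t1 t2" for \<xi>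
        using super[of "fst \<xi>" "snd \<xi>", OF _ \<kappa>] that by (simp add: mult_ac)
      show "enn2real (h \<xi>) < ?w \<xi> powr (1 / m)" if "\<xi> \<in> parabolic_boundary U t1 t2" for \<xi>
      proof -
        have "\<xi> \<in> closure U \<times> {t1..t2}" using parabolic_boundary_subset[OF t12(2)] that by blast
        then have "0 \<le> a + \<beta> * (fst \<xi> \<bullet> fst \<xi>) + K * snd \<xi>" using t12 abK by (auto intro!: add_nonneg_nonneg)
        then have "(a + \<beta> * (fst \<xi> \<bullet> fst \<xi>) + K * snd \<xi>) powr (1 / m) < ?w \<xi> powr (1 / m)"
          using \<kappa> m by (intro powr_less_mono2) auto
        then show ?thesis using bdry[of "fst \<xi>" "snd \<xi>"] that by simp
      qed
    qed (auto intro!: continuous_intros)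
    then show ?thesis by simp
  qed
  let ?v = "a + \<beta> * (y \<bullet> y) + K * s"
  have s0: "0 \<le> s" using \<zeta> t12 by (auto simp: cylinder_def)
  have v0: "0 \<le> ?v" using s0 abK by (auto intro!: add_nonneg_nonneg)
  \<comment> \<open>The limit \<kappa> \<rightarrow> 0 is taken for \<open>m\<close>-th powers,
    where the bound is linear in \<kappa>.\<close>
  have "enn2real (h (y, s)) powr m \<le> ?v"
  proof (rule field_le_epsilon)
    fix e :: real assume "0 < e"
    define \<kappa> where "\<kappa> = min e (1/2)"
    have \<kappa>: "0 < \<kappa>" "\<kappa> < 1" "\<kappa> \<le> e" using \<open>0 < e\<close> by (auto simp: \<kappa>_def)
    have "enn2real (h (y, s)) powr m \<le> ((a + \<kappa> + \<beta> * (y \<bullet> y) + K * s) powr (1 / m)) powr m"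
      using est[OF \<kappa>(1,2)] m by (intro powr_mono2) auto
    also have "\<dots> = ?v + \<kappa>" using m0 v0 \<kappa> by (simp add: powr_powr)
    finally show "enn2real (h (y, s)) powr m \<le> ?v + e" using \<kappa> by simp
  qed
  then have "(enn2real (h (y, s)) powr m) powr (1 / m) \<le> ?v powr (1 / m)"
    using m by (intro powr_mono2) auto
  then show ?thesis using m0 by (simp add: powr_powr)
qed

text \<open>Let \<open>p\<close> be the Gaussian. In the Laplacian of \<open>p^m\<close> the squares
  from differentiating the exponent have the right sign and are dropped; what remains is at least
  \<open>- 2 m \<beta> CARD('n) p^m\<close>, and \<open>p^m \<le> A^(m-1) p\<close> at times
  \<open>t \<ge> 0\<close>. This dictates the lower bound on \<open>K\<close>.\<close>

lemma gaussian_comparison: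
  fixes U :: "(real ^ 'n) set" and m A \<beta> K :: real
  assumes U: "bounded U" "open U" and t12: "0 \<le> t1" "t1 < t2" and m: "1 \<le> m"
    and AbK: "0 < A" "0 \<le> \<beta>" "2 * m * \<beta> * CARD('n) * A powr (m - 1) \<le> K" and h: "comparison_function m U t1 t2 h"
    and bdry: "\<And>x t. (x, t) \<in> parabolic_boundary U t1 t2 \<Longrightarrow> A * exp (- \<beta> * (x \<bullet> x) - K * t) \<le> enn2real (h (x, t))"
    and \<zeta>: "(y, s) \<in> cylinder U t1 t2"
  shows "A * exp (- \<beta> * (y \<bullet> y) - K * s) \<le> enn2real (h (y, s))"
proof (rule dense_le_bounded)
  let ?E = "\<lambda>\<xi>::(real ^ 'n) \<times> real. exp (- \<beta> * (fst \<xi> \<bullet> fst \<xi>) - K * snd \<xi>)"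
  have "0 \<le> 2 * m * \<beta> * CARD('n) * A powr (m - 1)" using m AbK by simp
  then have K: "0 \<le> K" using AbK(3) by linarith
  show "0 < A * exp (- \<beta> * (y \<bullet> y) - K * s)" using AbK by simp
  fix d assume d: "0 < d" "d < A * exp (- \<beta> * (y \<bullet> y) - K * s)"
  \<comment> \<open>Lowering the amplitude gives the strict boundary inequality; \<open>A'\<close>
    is the amplitude for which the value at \<open>(y, s)\<close> is \<open>d\<close>.\<close>
  define A' where "A' = d / exp (- \<beta> * (y \<bullet> y) - K * s)"
  have A': "0 < A'" "A' < A" using d by (auto simp: A'_def field_simps)
  let ?p = "\<lambda>\<xi>. A' * ?E \<xi>"
  have pm: "?p \<xi> powr m = A' powr m * exp (m * (- \<beta> * (fst \<xi> \<bullet> fst \<xi>) - K * snd \<xi>))" for \<xi>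
    using A' by (simp add: powr_mult exp_powr_real mult.commute)
  have C: "compact (closure U \<times> {t1..t2})" using U by (intro compact_Times) (auto simp: compact_closure)
  have ne: "closure U \<times> {t1..t2} \<noteq> {}" using \<zeta> closure_subset by (auto simp: cylinder_def)
  have "continuous_on (closure U \<times> {t1..t2}) ?p" by (intro continuous_intros)
  \<comment> \<open>The positive lower bound that \<open>classical_comparison\<close> asks for comes
    from compactness of the closed cylinder.\<close>
  from continuous_attains_inf[OF C ne this] obtain \<xi>0
    where c: "\<And>\<xi>. \<xi> \<in> closure U \<times> {t1..t2} \<Longrightarrow> ?p \<xi>0 \<le> ?p \<xi>" by blast
  have c0: "0 < ?p \<xi>0" using A' by simp
  have "?p (y, s) \<le> enn2real (h (y, s))"
  proof (rule classical_comparison(2)[where p = ?p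
      and pt = "\<lambda>\<xi>. - K * ?p \<xi>" and ?q1.0 = "\<lambda>b \<xi>. A' powr m * exp (m * (- \<beta> * (fst \<xi> \<bullet> fst \<xi>) - K * snd \<xi>)) * (- 2 * m * \<beta> * (fst \<xi> \<bullet> b))"
      and ?q2.0 = "\<lambda>b \<xi>. A' powr m * exp (m * (- \<beta> * (fst \<xi> \<bullet> fst \<xi>) - K * snd \<xi>)) * ((2 * m * \<beta> * (fst \<xi> \<bullet> b))\<^sup>2 - 2 * m * \<beta>)",
      OF U t12(2) m c0 h _ c _ _ _ _ _ _ _ _ \<zeta>])
    show "((\<lambda>s. ?p (\<xi> + s *\<^sub>R (0, 1))) has_real_derivative - K * ?p \<xi>) (at 0)" for \<xi>
      by (auto intro!: derivative_eq_intros)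
    let ?P = "\<lambda>\<xi>::(real ^ 'n) \<times> real. A' powr m * exp (m * (- \<beta> * (fst \<xi> \<bullet> fst \<xi>) - K * snd \<xi>))"
    have D1: "((\<lambda>s. ?P (\<xi> + s *\<^sub>R (b, 0))) has_real_derivative ?P \<xi> * (- 2 * m * \<beta> * (fst \<xi> \<bullet> b))) (at 0)" for b \<xi>
    proof -
      have "((\<lambda>s. m * (- \<beta> * (fst \<xi> \<bullet> fst \<xi> + 2 * s * (fst \<xi> \<bullet> b) + s * s * (b \<bullet> b)) - K * snd \<xi>))
          has_real_derivative - 2 * m * \<beta> * (fst \<xi> \<bullet> b)) (at 0)"
        by (auto intro!: derivative_eq_intros)
      from DERIV_cmult[OF DERIV_fun_exp[OF this], of "A' powr m"]
      show ?thesis by (simp add: inner_add_left inner_add_right inner_commute mult.assoc add.assoc)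
    qed
    then show "((\<lambda>s. ?p (\<xi> + s *\<^sub>R (b, 0)) powr m) has_real_derivative ?P \<xi> * (- 2 * m * \<beta> * (fst \<xi> \<bullet> b))) (at 0)" for b \<xi>
      unfolding pm .
    show "((\<lambda>s. ?P (\<xi> + s *\<^sub>R (b, 0)) * (- 2 * m * \<beta> * (fst (\<xi> + s *\<^sub>R (b, 0)) \<bullet> b))) has_real_derivative
       ?P \<xi> * ((2 * m * \<beta> * (fst \<xi> \<bullet> b))\<^sup>2 - 2 * m * \<beta>)) (at 0)"
      if b: "b \<in> Basis" for b \<xi>
    proof -
      have "((\<lambda>s. - 2 * m * \<beta> * (fst (\<xi> + s *\<^sub>R (b, 0)) \<bullet> b)) has_real_derivative - 2 * m * \<beta>) (at 0)"
        using b by (auto simp: inner_add_left intro!: derivative_eq_intros)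
      from DERIV_mult[OF D1 this, of \<xi> b]
      have "((\<lambda>s. ?P (\<xi> + s *\<^sub>R (b, 0)) * (- 2 * m * \<beta> * (fst (\<xi> + s *\<^sub>R (b, 0)) \<bullet> b))) has_real_derivative
        ?P \<xi> * (- 2 * m * \<beta> * (fst \<xi> \<bullet> b)) * (- 2 * m * \<beta> * (fst \<xi> \<bullet> b)) + - 2 * m * \<beta> * ?P \<xi>) (at 0)"
        by simp
      moreover have "P * (- 2 * m * \<beta> * d) * (- 2 * m * \<beta> * d) + - 2 * m * \<beta> * P
          = P * ((2 * m * \<beta> * d)\<^sup>2 - 2 * m * \<beta>)" for P d :: real
        by (simp add: power2_eq_square algebra_simps)
      ultimately show ?thesis by (simp only:)
    qed
    show "?p \<xi> < enn2real (h \<xi>)" if "\<xi> \<in> parabolic_boundary U t1 t2" for \<xi>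
    proof -
      have "?p \<xi> < A * ?E \<xi>" using A' by simp
      also have "A * ?E \<xi> \<le> enn2real (h \<xi>)" using bdry[of "fst \<xi>" "snd \<xi>"] that by simp
      finally show ?thesis .
    qed
    fix \<xi> assume \<xi>: "\<xi> \<in> cylinder U t1 t2"
    have p0: "0 < ?p \<xi>" using A' by simp
    have "0 \<le> \<beta> * (fst \<xi> \<bullet> fst \<xi>)" "0 \<le> K * snd \<xi>"
      using AbK K \<xi> t12 by (auto simp: cylinder_def)
    then have "- \<beta> * (fst \<xi> \<bullet> fst \<xi>) - K * snd \<xi> \<le> 0" by simp
    then have "?p \<xi> \<le> A" using A' mult_mono[of A' A "?E \<xi>" 1] by simp
    then have "?p \<xi> powr (m - 1) \<le> A powr (m - 1)" using p0 m by (intro powr_mono2) auto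
    then have "?P \<xi> \<le> ?p \<xi> * A powr (m - 1)"
    proof -
      have "?P \<xi> = ?p \<xi> * ?p \<xi> powr (m - 1)" unfolding pm[symmetric] using p0 powr_mult_base[of "?p \<xi>" "m - 1"] by simp
      then show ?thesis using mult_left_mono[OF \<open>?p \<xi> powr (m - 1) \<le> A powr (m - 1)\<close> less_imp_le[OF p0]] by simp
    qed
    then have "2 * m * \<beta> * CARD('n) * ?P \<xi> \<le> 2 * m * \<beta> * CARD('n) * (?p \<xi> * A powr (m - 1))"
      using m AbK by (intro mult_left_mono) auto
    also have "\<dots> = ?p \<xi> * (2 * m * \<beta> * CARD('n) * A powr (m - 1))" by (simp add: mult_ac)
    also have "\<dots> \<le> ?p \<xi> * K" using AbK(3) p0 by (intro mult_left_mono) auto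
    finally have "- K * ?p \<xi> \<le> (\<Sum>b\<in>(Basis :: (real ^ 'n) set). ?P \<xi> * (- 2 * m * \<beta>))" by (simp add: mult_ac)
    also have "\<dots> \<le> (\<Sum>b\<in>Basis. ?P \<xi> * ((2 * m * \<beta> * (fst \<xi> \<bullet> b))\<^sup>2 - 2 * m * \<beta>))"
      by (intro sum_mono mult_left_mono) auto
    finally show "- K * ?p \<xi> \<le> (\<Sum>b\<in>Basis. ?P \<xi> * ((2 * m * \<beta> * (fst \<xi> \<bullet> b))\<^sup>2 - 2 * m * \<beta>))" .
  qed (auto intro!: continuous_intros)
  then show "d \<le> enn2real (h (y, s))" by (simp add: A'_def)
qed

subsection \<open>Barriers and regularity\<close>

text \<open>If the cylinder begins before time 0 and has a point \<open>(x, t)\<close> near the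
  origin, then \<open>t > 0\<close>, and the vertical segment below that point passes through
  \<open>(x, 0)\<close>, which is at least as near to the origin and so would have to have positive
  time. Cylinders that begin before time 0 thus meet a barrier only where it is constant.\<close>

lemma cylinder_future_or_far:
  fixes \<Theta> :: "('a::euclidean_space \<times> real) set"
  assumes fut: "\<And>\<xi>. \<xi> \<in> \<Theta> \<Longrightarrow> norm \<xi> < r \<Longrightarrow> 0 < snd \<xi>"
    and sub: "closure U \<times> {t1..t2} \<subseteq> \<Theta>"
  shows "0 \<le> t1 \<or> (\<forall>\<xi>\<in>closure U \<times> {t1..t2}. r \<le> norm \<xi>)"
proof (rule ccontr)
  assume "\<not> ?thesis"
  then obtain x t where *: "t1 < 0" "(x, t) \<in> closure U \<times> {t1..t2}" "norm (x, t) < r" by (auto simp: not_le)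
  then have "0 < t" using fut[of "(x, t)"] subsetD[OF sub] by simp
  then have "(x, 0) \<in> closure U \<times> {t1..t2}" using * by auto
  moreover have "norm (x, 0::real) \<le> norm (x, t)" by (simp add: norm_Pair)
  ultimately show False using fut[of "(x, 0)"] subsetD[OF sub] * by simp
qed

text \<open>The barriers depend on a sum of multiples of \<open>|x|^2\<close> and
  \<open>|t|\<close>, and for the truncation to take over it suffices that one of the two terms is
  large.\<close>

lemma far_cases:
  fixes x :: "'a::euclidean_space"
  assumes "0 < r" "r \<le> norm (x, t)"
  shows "r\<^sup>2 / 2 \<le> x \<bullet> x \<or> r / 2 \<le> \<bar>t\<bar>"
proof (rule ccontr)
  assume *: "\<not> ?thesis"
  have "r\<^sup>2 \<le> (norm (x, t))\<^sup>2" using assms by (intro power_mono) auto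
  also have "\<dots> = x \<bullet> x + \<bar>t\<bar>\<^sup>2" by (simp add: norm_Pair dot_square_norm)
  also have "\<bar>t\<bar>\<^sup>2 \<le> (r / 2)\<^sup>2" using * by (intro power_mono) auto
  finally have "r\<^sup>2 \<le> x \<bullet> x + r\<^sup>2 / 4" by (simp add: power_divide)
  moreover have "0 < r\<^sup>2" using assms by simp
  ultimately show False using * by argo
qed

lemma comparison_function_le_iff:
  assumes "comparison_function m U t1 t2 h" "\<xi> \<in> closure (cylinder U t1 t2)" "0 \<le> c"
  shows "h \<xi> \<le> ennreal c \<longleftrightarrow> enn2real (h \<xi>) \<le> c" "ennreal c \<le> h \<xi> \<longleftrightarrow> c \<le> enn2real (h \<xi>)"
proof -
  have "h \<xi> < \<infinity>" using assms(1,2) by (simp add: comparison_function_def)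
  then obtain r where "0 \<le> r" "h \<xi> = ennreal r" by (cases "h \<xi>") auto
  then show "h \<xi> \<le> ennreal c \<longleftrightarrow> enn2real (h \<xi>) \<le> c" "ennreal c \<le> h \<xi> \<longleftrightarrow> c \<le> enn2real (h \<xi>)"
    using assms(3) by simp_all
qed

text \<open>For a finite continuous function lower semicontinuity and density are automatic, and the
  comparison is restated for real values so that the lemmas above apply.\<close>

lemma superparabolicI:
  fixes \<Theta> :: "((real ^ 'n) \<times> real) set"
  assumes \<Theta>: "open \<Theta>" and u: "continuous_on UNIV u" "\<And>\<xi>. 0 \<le> u \<xi>"
    and comp: "\<And>U t1 t2 h \<zeta>. bounded U \<Longrightarrow> open U \<Longrightarrow> t1 < t2 \<Longrightarrow> closure U \<times> {t1..t2} \<subseteq> \<Theta> \<Longrightarrow>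
      comparison_function m U t1 t2 h \<Longrightarrow>
      (\<And>\<xi>. \<xi> \<in> parabolic_boundary U t1 t2 \<Longrightarrow> enn2real (h \<xi>) \<le> u \<xi>) \<Longrightarrow>
      \<zeta> \<in> cylinder U t1 t2 \<Longrightarrow> enn2real (h \<zeta>) \<le> u \<zeta>"
  shows "superparabolic m \<alpha> \<Theta> (\<lambda>\<xi>. ennreal (u \<xi>))"
  unfolding superparabolic_def
proof (intro conjI allI impI ballI)
  show "lsc_on \<Theta> (\<lambda>\<xi>. ennreal (u \<xi>))"
    unfolding lsc_on_def
  proof
    fix \<xi> assume \<xi>: "\<xi> \<in> \<Theta>"
    have nb: "at \<xi> within \<Theta> \<noteq> bot" unfolding at_within_open[OF \<xi> \<Theta>] by (rule at_neq_bot)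
    have "((\<lambda>\<xi>. ennreal (u \<xi>)) \<longlongrightarrow> ennreal (u \<xi>)) (at \<xi> within \<Theta>)"
      using continuous_on_subset[OF u(1), of \<Theta>] \<xi> unfolding continuous_on_def by (intro tendsto_ennrealI) simp
    from lim_imp_Liminf[OF nb this] show "ennreal (u \<xi>) \<le> Liminf (at \<xi> within \<Theta>) (\<lambda>\<xi>. ennreal (u \<xi>))"
      by simp
  qed
  show "\<Theta> \<subseteq> closure {\<xi> \<in> \<Theta>. ennreal (u \<xi>) < \<infinity>}" using closure_subset by auto
  fix U t1 t2 h \<zeta>
  assume *: "cylinder_in \<Theta> U t1 t2 \<and> C2_Holder_domain \<alpha> U \<and> comparison_function m U t1 t2 h \<and>
      (\<forall>\<xi>\<in>parabolic_boundary U t1 t2. h \<xi> \<le> ennreal (u \<xi>))" and \<zeta>: "\<zeta> \<in> cylinder U t1 t2"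
  then have U: "bounded U" "open U" "t1 < t2" "closure U \<times> {t1..t2} \<subseteq> \<Theta>"
    by (auto simp: cylinder_in_def compactly_contained_def closure_cylinder)
  have h: "comparison_function m U t1 t2 h" using * by blast
  have cl: "\<xi> \<in> closure (cylinder U t1 t2)" if "\<xi> \<in> parabolic_boundary U t1 t2" for \<xi>
    using parabolic_boundary_subset[OF U(3)] that closure_cylinder[OF U(3)] by blast
  have "enn2real (h \<zeta>) \<le> u \<zeta>"
    using * comparison_function_le_iff(1)[OF h cl u(2)] by (intro comp[OF U h _ \<zeta>]) auto
  then show "h \<zeta> \<le> ennreal (u \<zeta>)"
    using comparison_function_le_iff(1)[OF h _ u(2)] \<zeta> closure_subset by blast
qed

lemma subparabolicI:
  fixes \<Theta> :: "((real ^ 'n) \<times> real) set"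
  assumes \<Theta>: "open \<Theta>" and u: "continuous_on UNIV u" "\<And>\<xi>. 0 \<le> u \<xi>"
    and comp: "\<And>U t1 t2 h \<zeta>. bounded U \<Longrightarrow> open U \<Longrightarrow> t1 < t2 \<Longrightarrow> closure U \<times> {t1..t2} \<subseteq> \<Theta> \<Longrightarrow>
      comparison_function m U t1 t2 h \<Longrightarrow>
      (\<And>\<xi>. \<xi> \<in> parabolic_boundary U t1 t2 \<Longrightarrow> u \<xi> \<le> enn2real (h \<xi>)) \<Longrightarrow>
      \<zeta> \<in> cylinder U t1 t2 \<Longrightarrow> u \<zeta> \<le> enn2real (h \<zeta>)"
  shows "subparabolic m \<alpha> \<Theta> (\<lambda>\<xi>. ennreal (u \<xi>))"
  unfolding subparabolic_def
proof (intro conjI allI impI ballI)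
  show "ennreal (u \<xi>) < \<infinity>" for \<xi> by simp
  show "usc_on \<Theta> (\<lambda>\<xi>. ennreal (u \<xi>))"
    unfolding usc_on_def
  proof
    fix \<xi> assume \<xi>: "\<xi> \<in> \<Theta>"
    have nb: "at \<xi> within \<Theta> \<noteq> bot" unfolding at_within_open[OF \<xi> \<Theta>] by (rule at_neq_bot)
    have "((\<lambda>\<xi>. ennreal (u \<xi>)) \<longlongrightarrow> ennreal (u \<xi>)) (at \<xi> within \<Theta>)"
      using continuous_on_subset[OF u(1), of \<Theta>] \<xi> unfolding continuous_on_def by (intro tendsto_ennrealI) simp
    from lim_imp_Limsup[OF nb this] show "Limsup (at \<xi> within \<Theta>) (\<lambda>\<xi>. ennreal (u \<xi>)) \<le> ennreal (u \<xi>)"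
      by simp
  qed
  fix U t1 t2 h \<zeta>
  assume *: "cylinder_in \<Theta> U t1 t2 \<and> C2_Holder_domain \<alpha> U \<and> comparison_function m U t1 t2 h \<and>
      (\<forall>\<xi>\<in>parabolic_boundary U t1 t2. ennreal (u \<xi>) \<le> h \<xi>)" and \<zeta>: "\<zeta> \<in> cylinder U t1 t2"
  then have U: "bounded U" "open U" "t1 < t2" "closure U \<times> {t1..t2} \<subseteq> \<Theta>"
    by (auto simp: cylinder_in_def compactly_contained_def closure_cylinder)
  have h: "comparison_function m U t1 t2 h" using * by blast
  have cl: "\<xi> \<in> closure (cylinder U t1 t2)" if "\<xi> \<in> parabolic_boundary U t1 t2" for \<xi>
    using parabolic_boundary_subset[OF U(3)] that closure_cylinder[OF U(3)] by blast
  have "u \<zeta> \<le> enn2real (h \<zeta>)"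
    using * comparison_function_le_iff(2)[OF h cl u(2)] by (intro comp[OF U h _ \<zeta>]) auto
  then show "ennreal (u \<zeta>) \<le> h \<zeta>"
    using comparison_function_le_iff(2)[OF h _ u(2)] \<zeta> closure_subset by blast
qed

lemma frontier_limits:
  fixes u :: "'a::euclidean_space \<Rightarrow> real"
  assumes "open \<Theta>" "\<zeta> \<in> frontier \<Theta>" "continuous_on UNIV u"
  shows "Liminf (at \<zeta> within \<Theta>) (\<lambda>\<xi>. ennreal (u \<xi>)) = ennreal (u \<zeta>)"
    "Limsup (at \<zeta> within \<Theta>) (\<lambda>\<xi>. ennreal (u \<xi>)) = ennreal (u \<zeta>)"
proof -
  have "\<zeta> islimpt \<Theta>" using assms(1,2) by (auto simp: frontier_def closure_def interior_open)
  then have nb: "at \<zeta> within \<Theta> \<noteq> bot" by (simp add: trivial_limit_within)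
  have "(u \<longlongrightarrow> u \<zeta>) (at \<zeta> within \<Theta>)"
    using assms(3) by (auto simp: continuous_on_def intro: tendsto_within_subset)
  then have "((\<lambda>\<xi>. ennreal (u \<xi>)) \<longlongrightarrow> ennreal (u \<zeta>)) (at \<zeta> within \<Theta>)" by (rule tendsto_ennrealI)
  then show "Liminf (at \<zeta> within \<Theta>) (\<lambda>\<xi>. ennreal (u \<xi>)) = ennreal (u \<zeta>)"
    "Limsup (at \<zeta> within \<Theta>) (\<lambda>\<xi>. ennreal (u \<xi>)) = ennreal (u \<zeta>)"
    using lim_imp_Liminf[OF nb] lim_imp_Limsup[OF nb] by auto
qed

text \<open>The constant \<open>M\<close> and the power function are compared with \<open>h\<close>
  separately: the former on every cylinder, the latter only if \<open>t1 \<ge> 0\<close>, where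
  \<open>|t| = t\<close>. On the remaining cylinders the power function is at least
  \<open>M\<close>.\<close>

lemma upper_barrier:
  fixes \<Theta> :: "((real ^ 'n) \<times> real) set"
  assumes m: "1 \<le> m" and \<Theta>: "open \<Theta>" "\<And>\<xi>. \<xi> \<in> \<Theta> \<Longrightarrow> norm \<xi> \<le> R"
    and fut: "0 < r" "\<And>\<xi>. \<xi> \<in> \<Theta> \<Longrightarrow> norm \<xi> < r \<Longrightarrow> 0 < snd \<xi>" and AM: "0 < A" "A \<le> M"
  shows "\<exists>u. superparabolic m \<alpha> \<Theta> (\<lambda>\<xi>. ennreal (u \<xi>)) \<and> continuous_on UNIV u \<and> u 0 = A \<and>
    (\<forall>\<xi>. A \<le> u \<xi>) \<and> (\<forall>\<xi>. r \<le> norm \<xi> \<longrightarrow> u \<xi> = M)"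
proof -
  have m0: "0 < m" "m \<noteq> 0" using m by auto
  have M: "0 < M" using AM by simp
  define a where "a = A powr m"
  have a: "0 < a" "a powr (1 / m) = A" using AM m0 by (auto simp: a_def powr_powr)
  \<comment> \<open>At distance at least \<open>r\<close> either \<open>|x|^2 \<ge> r^2/2\<close> or
    \<open>|t| \<ge> r/2\<close>; \<beta> and the second entry of \<open>K\<close> are such that
    each alternative alone gives \<open>w \<ge> M^m\<close>.\<close>
  define \<beta> where "\<beta> = M powr m / (r\<^sup>2 / 2)"
  have \<beta>: "0 \<le> \<beta>" "\<beta> * (r\<^sup>2 / 2) = M powr m" using fut M by (auto simp: \<beta>_def)
  define R' where "R' = max R 0"
  \<comment> \<open>On \<Theta> at times \<open>t \<ge> 0\<close> the base of the power, with the
    extra \<kappa> < 1, is at most \<open>K c\<close>, as \<open>K \<ge> 1\<close>.\<close>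
  define c where "c = a + 1 + \<beta> * R'\<^sup>2 + R'"
  have c: "0 < c" using a \<beta> by (simp add: c_def R'_def add_pos_nonneg)
  define N where "N = real CARD('n)"
  \<comment> \<open>Enlarging \<open>K\<close> also enlarges the base of the nonpositive power in
    the time derivative. It still helps: by the choice of \<open>c\<close> the time derivative is at
    least \<open>(1/m) c^(1/m - 1) K^(1/m)\<close>, which grows with \<open>K\<close>, and the third
    entry makes it at least \<open>2 \<beta> N\<close>.\<close>
  define K where "K = max 1 (max (M powr m / (r / 2)) ((2 * \<beta> * N * m * c powr (1 - 1 / m)) powr m))"
  have K: "1 \<le> K" "M powr m / (r / 2) \<le> K" "(2 * \<beta> * N * m * c powr (1 - 1 / m)) powr m \<le> K" by (auto simp: K_def)
  have Kr: "M powr m \<le> K * (r / 2)" using K(2) fut(1) by (simp add: field_simps)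
  define w where "w = (\<lambda>\<xi>::(real ^ 'n) \<times> real. a + \<beta> * (fst \<xi> \<bullet> fst \<xi>) + K * \<bar>snd \<xi>\<bar>)"
  define u where "u = (\<lambda>\<xi>. min M (w \<xi> powr (1 / m)))"
  have wa: "a \<le> w \<xi>" for \<xi> using \<beta> K by (simp add: w_def add_nonneg_nonneg)
  have wpos: "0 < w \<xi>" for \<xi> using wa[of \<xi>] a by simp
  have uA: "A \<le> u \<xi>" for \<xi>
    using powr_mono2[of "1 / m" a "w \<xi>"] wa[of \<xi>] a m0 AM by (simp add: u_def)
  have far: "M \<le> w \<xi> powr (1 / m)" if "r \<le> norm \<xi>" for \<xi>
  proof -
    have "r\<^sup>2 / 2 \<le> fst \<xi> \<bullet> fst \<xi> \<or> r / 2 \<le> \<bar>snd \<xi>\<bar>" using far_cases[of r "fst \<xi>" "snd \<xi>"] fut that by simp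
    then have "M powr m \<le> \<beta> * (fst \<xi> \<bullet> fst \<xi>) \<or> M powr m \<le> K * \<bar>snd \<xi>\<bar>"
    proof
      assume "r\<^sup>2 / 2 \<le> fst \<xi> \<bullet> fst \<xi>"
      then show ?thesis using mult_left_mono[of "r\<^sup>2 / 2" "fst \<xi> \<bullet> fst \<xi>" \<beta>] \<beta> by simp
    next
      assume "r / 2 \<le> \<bar>snd \<xi>\<bar>"
      then have "K * (r / 2) \<le> K * \<bar>snd \<xi>\<bar>" using K(1) by (intro mult_left_mono) auto
      then show ?thesis using Kr by simp
    qed
    moreover have "0 \<le> \<beta> * (fst \<xi> \<bullet> fst \<xi>)" "0 \<le> K * \<bar>snd \<xi>\<bar>" using \<beta> K by auto
    ultimately have "M powr m \<le> w \<xi>" using a unfolding w_def by linarith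
    then have "(M powr m) powr (1 / m) \<le> w \<xi> powr (1 / m)" using m0 by (intro powr_mono2) auto
    then show ?thesis using m0 M by (simp add: powr_powr)
  qed
  have uM: "u \<xi> = M" if "r \<le> norm \<xi>" for \<xi> using far[OF that] by (simp add: u_def)
  have contu: "continuous_on UNIV u"
    unfolding u_def w_def using wpos[unfolded w_def] by (intro continuous_intros) (auto simp: less_imp_neq[symmetric])
  have u0: "u 0 = A" using a AM by (simp add: u_def w_def)
  have "superparabolic m \<alpha> \<Theta> (\<lambda>\<xi>. ennreal (u \<xi>))"
  proof (rule superparabolicI[OF \<Theta>(1) contu])
    show "0 \<le> u \<xi>" for \<xi> using uA[of \<xi>] AM by simp
    fix U :: "(real ^ 'n) set" and t1 t2 h \<zeta>
    assume U: "bounded U" "open U" "t1 < t2" "closure U \<times> {t1..t2} \<subseteq> \<Theta>"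
      and h: "comparison_function m U t1 t2 h"
      and b: "\<And>\<xi>. \<xi> \<in> parabolic_boundary U t1 t2 \<Longrightarrow> enn2real (h \<xi>) \<le> u \<xi>" and \<zeta>: "\<zeta> \<in> cylinder U t1 t2"
    have SC: "cylinder U t1 t2 \<subseteq> closure U \<times> {t1..t2}" using closure_subset by (auto simp: cylinder_def)
    have "enn2real (h \<zeta>) \<le> M"
      using b by (intro constant_comparison(1)[OF U(1,2,3) m M h _ \<zeta>]) (auto simp: u_def)
    moreover have "enn2real (h \<zeta>) \<le> w \<zeta> powr (1 / m)"
      using cylinder_future_or_far[OF fut(2) U(4)]
    proof
      assume far': "\<forall>\<xi>\<in>closure U \<times> {t1..t2}. r \<le> norm \<xi>"
      have "enn2real (h \<zeta>) \<le> M" by fact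
      also have "M \<le> w \<zeta> powr (1 / m)" using far' SC \<zeta> by (intro far) auto
      finally show ?thesis .
    next
      assume t1: "0 \<le> t1"
      obtain y s where ys: "\<zeta> = (y, s)" by (cases \<zeta>)
      have "enn2real (h (y, s)) \<le> (a + \<beta> * (y \<bullet> y) + K * s) powr (1 / m)"
      proof (rule quadratic_comparison[OF U(1,2) t1 U(3) m a(1) \<beta>(1) _ h _ _ \<zeta>[unfolded ys]])
        show "0 \<le> K" using K by simp
        show "enn2real (h (x, t)) \<le> (a + \<beta> * (x \<bullet> x) + K * t) powr (1 / m)"
          if "(x, t) \<in> parabolic_boundary U t1 t2" for x t
        proof -
          have "0 \<le> t" using subsetD[OF parabolic_boundary_subset[OF U(3)] that] t1 by simp
          then show ?thesis using b[OF that] by (simp add: u_def w_def)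
        qed
        fix x t \<kappa> assume xt: "(x, t) \<in> cylinder U t1 t2" and \<kappa>: "0 < \<kappa>" "\<kappa> < (1::real)"
        have t: "0 \<le> t" using xt t1 by (auto simp: cylinder_def)
        have "(x, t) \<in> \<Theta>" using U(4) SC xt by blast
        from \<Theta>(2)[OF this] have "norm (x, t) \<le> R'" by (simp add: R'_def le_max_iff_disj)
        then have n: "norm x \<le> R'" "t \<le> R'"
          using norm_fst_le[of x t] norm_snd_le[of t x] by auto
        let ?W = "a + \<kappa> + \<beta> * (x \<bullet> x) + K * t"
        have "x \<bullet> x \<le> R'\<^sup>2" using n(1) by (simp add: dot_square_norm power_mono)
        then have "?W \<le> a + 1 + \<beta> * R'\<^sup>2 + K * R'"
          using \<kappa> n(2) \<beta>(1) K(1) by (intro add_mono mult_left_mono) auto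
        also have "\<dots> \<le> K * c"
        proof -
          have "0 \<le> a + 1 + \<beta> * R'\<^sup>2" using a \<beta> by simp
          then have "1 * (a + 1 + \<beta> * R'\<^sup>2) \<le> K * (a + 1 + \<beta> * R'\<^sup>2)" using K(1) by (intro mult_right_mono) auto
          then show ?thesis by (simp add: c_def distrib_left)
        qed
        finally have W: "?W \<le> K * c" .
        have "0 \<le> \<beta> * (x \<bullet> x)" "0 \<le> K * t" using \<beta>(1) K(1) t by auto
        then have Wp: "0 < ?W" using a(1) \<kappa>(1) by linarith
        have "2 * \<beta> * N * m * c powr (1 - 1 / m) = ((2 * \<beta> * N * m * c powr (1 - 1 / m)) powr m) powr (1 / m)"
          using m0 \<beta>(1) by (simp add: powr_powr N_def)
        also have "\<dots> \<le> K powr (1 / m)" using K(3) m0 by (intro powr_mono2) auto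
        finally have k: "2 * \<beta> * N * m * c powr (1 - 1 / m) \<le> K powr (1 / m)" .
        have "2 * \<beta> * N * m = (2 * \<beta> * N * m * c powr (1 - 1 / m)) * c powr (1 / m - 1)"
          using c by (simp add: mult.assoc powr_add[symmetric])
        also have "\<dots> \<le> K powr (1 / m) * c powr (1 / m - 1)" using k by (intro mult_right_mono) auto
        also have "\<dots> = (K * c) powr (1 / m - 1) * K"
        proof -
          have "K powr (1 / m) = K powr (1 / m - 1) * K" using K(1) powr_mult_base[of K "1 / m - 1"] by (simp add: mult.commute)
          then show ?thesis using K(1) c by (simp add: powr_mult)
        qed
        also have "\<dots> \<le> ?W powr (1 / m - 1) * K"
          using W Wp K(1) m by (intro mult_right_mono powr_mono2') auto
        finally have "2 * \<beta> * N * m \<le> ?W powr (1 / m - 1) * K" .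
        then show "2 * \<beta> * real CARD('n) \<le> 1 / m * ?W powr (1 / m - 1) * K"
          using m0 by (simp add: N_def field_simps)
      qed
      moreover have "0 \<le> s" using \<zeta> ys t1 by (auto simp: cylinder_def)
      ultimately show ?thesis by (simp add: ys w_def)
    qed
    ultimately show "enn2real (h \<zeta>) \<le> u \<zeta>" by (simp add: u_def)
  qed
  then show ?thesis using contu u0 uA uM by blast
qed

text \<open>An exponential decreases away from the origin and in time and yet stays positive, so
  \<open>classical_comparison\<close> applies to it before truncation; the two functions in the
  maximum are compared with \<open>h\<close> separately.\<close>

lemma lower_barrier:
  fixes \<Theta> :: "((real ^ 'n) \<times> real) set"
  assumes m: "1 \<le> m" and \<Theta>: "open \<Theta>"
    and fut: "0 < r" "\<And>\<xi>. \<xi> \<in> \<Theta> \<Longrightarrow> norm \<xi> < r \<Longrightarrow> 0 < snd \<xi>" and AM: "0 < \<delta>" "\<delta> \<le> A"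
  shows "\<exists>u. subparabolic m \<alpha> \<Theta> (\<lambda>\<xi>. ennreal (u \<xi>)) \<and> continuous_on UNIV u \<and> u 0 = A \<and>
    (\<forall>\<xi>. u \<xi> \<le> A) \<and> (\<forall>\<xi>. r \<le> norm \<xi> \<longrightarrow> u \<xi> = \<delta>)"
proof -
  have A: "0 < A" using AM by simp
  \<comment> \<open>\<open>L \<le> exp L\<close> gives
    \<open>A exp(- L) \<le> A/L = \<delta>\<close>: an exponent of \<open>- L\<close> brings the
    Gaussian down to \<delta>.\<close>
  define L where "L = A / \<delta>"
  have L: "0 < L" using AM A by (simp add: L_def)
  have "L \<le> exp L" using exp_ge_add_one_self[of L] by linarith
  then have expL: "A * exp (- L) \<le> \<delta>"
    using AM A by (simp add: L_def exp_minus field_simps)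
  define \<beta> where "\<beta> = L / (r\<^sup>2 / 2)"
  have \<beta>: "0 \<le> \<beta>" "\<beta> * (r\<^sup>2 / 2) = L" using fut L by (auto simp: \<beta>_def)
  \<comment> \<open>The first entry gives the exponent \<open>- L\<close> at times
    \<open>|t| \<ge> r/2\<close>, the second is the subsolution inequality.\<close>
  define K where "K = max (L / (r / 2)) (2 * m * \<beta> * CARD('n) * A powr (m - 1))"
  have K: "L / (r / 2) \<le> K" "2 * m * \<beta> * CARD('n) * A powr (m - 1) \<le> K" by (auto simp: K_def)
  have Kr: "L \<le> K * (r / 2)" using K(1) fut(1) by (simp add: field_simps)
  have "0 < L / (r / 2)" using L fut(1) by simp
  then have K0: "0 < K" using K(1) by linarith
  define w where "w = (\<lambda>\<xi>::(real ^ 'n) \<times> real. A * exp (- \<beta> * (fst \<xi> \<bullet> fst \<xi>) - K * \<bar>snd \<xi>\<bar>))"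
  define u where "u = (\<lambda>\<xi>. max \<delta> (w \<xi>))"
  have nn: "0 \<le> \<beta> * (fst \<xi> \<bullet> fst \<xi>)" "0 \<le> K * \<bar>snd \<xi>\<bar>" for \<xi> :: "(real ^ 'n) \<times> real"
    using \<beta> K0 by auto
  have wA: "w \<xi> \<le> A" for \<xi>
  proof -
    have "- \<beta> * (fst \<xi> \<bullet> fst \<xi>) - K * \<bar>snd \<xi>\<bar> \<le> 0" using nn[of \<xi>] by simp
    then show ?thesis using A by (simp add: w_def)
  qed
  have far: "w \<xi> \<le> \<delta>" if "r \<le> norm \<xi>" for \<xi>
  proof -
    have "r\<^sup>2 / 2 \<le> fst \<xi> \<bullet> fst \<xi> \<or> r / 2 \<le> \<bar>snd \<xi>\<bar>" using far_cases[of r "fst \<xi>" "snd \<xi>"] fut that by simp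
    then have "L \<le> \<beta> * (fst \<xi> \<bullet> fst \<xi>) \<or> L \<le> K * \<bar>snd \<xi>\<bar>"
    proof
      assume "r\<^sup>2 / 2 \<le> fst \<xi> \<bullet> fst \<xi>"
      then show ?thesis using mult_left_mono[of "r\<^sup>2 / 2" "fst \<xi> \<bullet> fst \<xi>" \<beta>] \<beta> by simp
    next
      assume "r / 2 \<le> \<bar>snd \<xi>\<bar>"
      then have "K * (r / 2) \<le> K * \<bar>snd \<xi>\<bar>" using K0 by (intro mult_left_mono) auto
      then show ?thesis using Kr by simp
    qed
    then have "- \<beta> * (fst \<xi> \<bullet> fst \<xi>) - K * \<bar>snd \<xi>\<bar> \<le> - L" using nn[of \<xi>] by auto
    then have "w \<xi> \<le> A * exp (- L)" unfolding w_def using A by (intro mult_left_mono) auto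
    then show ?thesis using expL by simp
  qed
  have u\<delta>: "u \<xi> = \<delta>" if "r \<le> norm \<xi>" for \<xi> using far[OF that] by (simp add: u_def)
  have uA: "u \<xi> \<le> A" for \<xi> using wA AM by (simp add: u_def)
  have contu: "continuous_on UNIV u" unfolding u_def w_def by (intro continuous_intros)
  have u0: "u 0 = A" using AM by (simp add: u_def w_def)
  have "subparabolic m \<alpha> \<Theta> (\<lambda>\<xi>. ennreal (u \<xi>))"
  proof (rule subparabolicI[OF \<Theta> contu])
    show "0 \<le> u \<xi>" for \<xi> using AM by (simp add: u_def)
    fix U :: "(real ^ 'n) set" and t1 t2 h \<zeta>
    assume U: "bounded U" "open U" "t1 < t2" "closure U \<times> {t1..t2} \<subseteq> \<Theta>"
      and h: "comparison_function m U t1 t2 h"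
      and b: "\<And>\<xi>. \<xi> \<in> parabolic_boundary U t1 t2 \<Longrightarrow> u \<xi> \<le> enn2real (h \<xi>)" and \<zeta>: "\<zeta> \<in> cylinder U t1 t2"
    have SC: "cylinder U t1 t2 \<subseteq> closure U \<times> {t1..t2}" using closure_subset by (auto simp: cylinder_def)
    have "\<delta> \<le> enn2real (h \<zeta>)"
      using b by (intro constant_comparison(2)[OF U(1,2,3) m AM(1) h _ \<zeta>]) (auto simp: u_def)
    moreover have "w \<zeta> \<le> enn2real (h \<zeta>)"
      using cylinder_future_or_far[OF fut(2) U(4)]
    proof
      assume far': "\<forall>\<xi>\<in>closure U \<times> {t1..t2}. r \<le> norm \<xi>"
      have "w \<zeta> \<le> \<delta>" using far' SC \<zeta> by (intro far) auto
      also have "\<delta> \<le> enn2real (h \<zeta>)" by fact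
      finally show ?thesis .
    next
      assume t1: "0 \<le> t1"
      obtain y s where ys: "\<zeta> = (y, s)" by (cases \<zeta>)
      have "A * exp (- \<beta> * (y \<bullet> y) - K * s) \<le> enn2real (h (y, s))"
      proof (rule gaussian_comparison[OF U(1,2) t1 U(3) m A \<beta>(1) K(2) h _ \<zeta>[unfolded ys]])
        show "A * exp (- \<beta> * (x \<bullet> x) - K * t) \<le> enn2real (h (x, t))"
          if "(x, t) \<in> parabolic_boundary U t1 t2" for x t
        proof -
          have "0 \<le> t" using subsetD[OF parabolic_boundary_subset[OF U(3)] that] t1 by simp
          then show ?thesis using b[OF that] by (simp add: u_def w_def)
        qed
      qed
      moreover have "0 \<le> s" using \<zeta> ys t1 by (auto simp: cylinder_def)
      ultimately show ?thesis by (simp add: ys w_def)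
    qed
    ultimately show "u \<zeta> \<le> enn2real (h \<zeta>)" by (simp add: u_def)
  qed
  then show ?thesis using contu u0 uA u\<delta> by blast
qed

text \<open>Points at negative times keep a distance from the origin because the origin is not in
  their closure. Points at time exactly 0 are excluded by openness of \<Theta>: moving one slightly
  backwards would give a past point still near the origin.\<close>

lemma open_past_free_future:
  fixes \<Theta> :: "('a::euclidean_space \<times> real) set"
  assumes "open \<Theta>" "(0, 0) \<notin> frontier (past_part \<Theta>)"
  obtains r where "0 < r" "\<And>\<xi>. \<xi> \<in> \<Theta> \<Longrightarrow> norm \<xi> < r \<Longrightarrow> 0 < snd \<xi>"
proof -
  have "(0, 0) \<notin> past_part \<Theta>" by (simp add: past_part_def)
  then have "(0, 0) \<notin> closure (past_part \<Theta>)"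
    using assms(2) interior_subset unfolding frontier_def by blast
  moreover have "open (- closure (past_part \<Theta>))" by (intro open_Compl closed_closure)
  ultimately obtain r where r: "0 < r" "ball (0, 0) r \<subseteq> - closure (past_part \<Theta>)"
    unfolding open_contains_ball by blast
  have "0 < snd \<xi>" if "\<xi> \<in> \<Theta>" "norm \<xi> < r" for \<xi>
  proof (rule ccontr)
    assume le: "\<not> ?thesis"
    have "open (\<Theta> \<inter> ball 0 r)" "\<xi> \<in> \<Theta> \<inter> ball 0 r" using assms(1) that by auto
    then obtain e where e: "0 < e" "ball \<xi> e \<subseteq> \<Theta> \<inter> ball 0 r" using open_contains_ball by blast
    let ?y = "\<xi> - (0, e / 2)"
    have "?y \<in> ball \<xi> e" using e by (simp add: dist_norm norm_Pair)
    then have "?y \<in> \<Theta>" "?y \<in> ball 0 r" using e(2) by blast+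
    moreover have "snd ?y < 0" using le e by simp
    ultimately have "?y \<in> ball (0, 0) r \<inter> past_part \<Theta>" by (cases \<xi>) (auto simp: past_part_def zero_prod_def)
    then show False using r(2) closure_subset[of "past_part \<Theta>"] by blast
  qed
  with r(1) show ?thesis by (rule that)
qed

theorem proposition9p1:
  fixes m \<alpha> :: real and \<Theta> :: "((real ^ 'n) \<times> real) set"
  assumes "CARD('n) \<ge> 2" and "m \<ge> 1" and "0 < \<alpha>" and "\<alpha> < 1"
    and "bounded \<Theta>" and "open \<Theta>" and "(0, 0) \<in> frontier \<Theta>"
  shows "((0, 0) \<notin> frontier (past_part \<Theta>) \<longrightarrow> regular_positive m \<alpha> \<Theta> (0, 0)) \<and>
         (past_part \<Theta> = {} \<longrightarrow> (0, 0) \<notin> frontier (past_part \<Theta>))"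
proof (intro conjI impI)
  show "(0, 0) \<notin> frontier (past_part \<Theta>)" if "past_part \<Theta> = {}" using that by simp
  assume "(0, 0) \<notin> frontier (past_part \<Theta>)"
  then obtain r0 where r0: "0 < r0" "\<And>\<xi>. \<xi> \<in> \<Theta> \<Longrightarrow> norm \<xi> < r0 \<Longrightarrow> 0 < snd \<xi>"
    using open_past_free_future[OF assms(6)] by metis
  have zF: "0 \<in> frontier \<Theta>" using assms(7) by (simp add: zero_prod_def)
  obtain R where R: "\<And>\<xi>. \<xi> \<in> \<Theta> \<Longrightarrow> norm \<xi> \<le> R" using assms(5) bounded_iff by blast
  have near: "\<exists>r. 0 < r \<and> r \<le> r0 \<and> (\<forall>\<zeta>\<in>frontier \<Theta>. norm \<zeta> < r \<longrightarrow> \<bar>f \<zeta> - f 0\<bar> < e)"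
    if fe: "continuous_on (frontier \<Theta>) f" "0 < e" for f :: "(real ^ 'n) \<times> real \<Rightarrow> real" and e
  proof -
    obtain d where d: "0 < d" "\<And>\<zeta>. \<zeta> \<in> frontier \<Theta> \<Longrightarrow> dist \<zeta> 0 < d \<Longrightarrow> dist (f \<zeta>) (f 0) < e"
      using bspec[OF fe(1)[unfolded continuous_on_iff] zF] fe(2) by blast
    then show ?thesis using r0 by (intro exI[of _ "min d r0"]) (auto simp: dist_real_def)
  qed
  have comp: "compact (frontier \<Theta>)" using assms(5) by (rule compact_frontier_bounded)
  have "upper_regular m \<alpha> \<Theta> 0"
    unfolding upper_regular_def
  proof (intro allI impI)
    fix f :: "(real ^ 'n) \<times> real \<Rightarrow> real"
    assume f: "continuous_on (frontier \<Theta>) f \<and> (\<forall>\<zeta>\<in>frontier \<Theta>. 0 < f \<zeta>)"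
    obtain \<zeta>1 where "\<zeta>1 \<in> frontier \<Theta>" and fmax: "\<And>\<zeta>. \<zeta> \<in> frontier \<Theta> \<Longrightarrow> f \<zeta> \<le> f \<zeta>1"
      using continuous_attains_sup[OF comp _ conjunct1[OF f]] zF by blast
    have f0: "0 < f 0" using f zF by blast
    show "Limsup (at 0 within \<Theta>) (upper_perron m \<alpha> \<Theta> f) \<le> ennreal (f 0)"
    proof (rule ennreal_le_epsilon)
      fix e :: real assume e: "0 < e"
      obtain r where r: "0 < r" "r \<le> r0" "\<And>\<zeta>. \<zeta> \<in> frontier \<Theta> \<Longrightarrow> norm \<zeta> < r \<Longrightarrow> \<bar>f \<zeta> - f 0\<bar> < e"
        using near[OF conjunct1[OF f] e] by blast
      have fut: "0 < snd \<xi>" if "\<xi> \<in> \<Theta>" "norm \<xi> < r" for \<xi> using r0(2)[OF that(1)] that(2) r(2) by simp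
      \<comment> \<open>The lower bound \<open>f 0 + e\<close> covers the boundary data near the
        origin, by continuity, and the plateau covers the rest; the maximum keeps the plateau from
        falling below the value at the origin.\<close>
      have "\<exists>u. superparabolic m \<alpha> \<Theta> (\<lambda>\<xi>. ennreal (u \<xi>)) \<and> continuous_on UNIV u \<and> u 0 = f 0 + e \<and>
        (\<forall>\<xi>. f 0 + e \<le> u \<xi>) \<and> (\<forall>\<xi>. r \<le> norm \<xi> \<longrightarrow> u \<xi> = max (f \<zeta>1) (f 0 + e))"
        by (rule upper_barrier[OF assms(2,6)]) (use R fut r(1) f0 e in auto)
      then obtain u where u: "superparabolic m \<alpha> \<Theta> (\<lambda>\<xi>. ennreal (u \<xi>))" "continuous_on UNIV u" "u 0 = f 0 + e"
        "\<And>\<xi>. f 0 + e \<le> u \<xi>" "\<And>\<xi>. r \<le> norm \<xi> \<Longrightarrow> u \<xi> = max (f \<zeta>1) (f 0 + e)"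
        by blast
      have "ennreal (f \<zeta>) \<le> Liminf (at \<zeta> within \<Theta>) (\<lambda>\<xi>. ennreal (u \<xi>))" if "\<zeta> \<in> frontier \<Theta>" for \<zeta>
      proof -
        have "f \<zeta> \<le> u \<zeta>"
        proof (cases "norm \<zeta> < r")
          case True
          then show ?thesis using r(3)[OF that True] u(4)[of \<zeta>] by linarith
        next
          case False
          then show ?thesis using u(5)[of \<zeta>] fmax[OF that] by simp
        qed
        then show ?thesis using frontier_limits(1)[OF assms(6) that u(2)] by (simp add: ennreal_leI)
      qed
      then have "upper_perron m \<alpha> \<Theta> f \<xi> \<le> ennreal (u \<xi>)" for \<xi>
        unfolding upper_perron_def using u(1) by (intro INF_lower2[of "\<lambda>\<xi>. ennreal (u \<xi>)"]) auto
      then have "Limsup (at 0 within \<Theta>) (upper_perron m \<alpha> \<Theta> f) \<le> Limsup (at 0 within \<Theta>) (\<lambda>\<xi>. ennreal (u \<xi>))"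
        by (intro Limsup_mono always_eventually allI)
      also have "\<dots> = ennreal (f 0) + ennreal e"
        using frontier_limits(2)[OF assms(6) zF u(2)] u(3) f0 e by simp
      finally show "Limsup (at 0 within \<Theta>) (upper_perron m \<alpha> \<Theta> f) \<le> ennreal (f 0) + ennreal e" .
    qed
  qed
  moreover have "lower_regular_positive m \<alpha> \<Theta> 0"
    unfolding lower_regular_positive_def
  proof (intro allI impI)
    fix f :: "(real ^ 'n) \<times> real \<Rightarrow> real"
    assume f: "continuous_on (frontier \<Theta>) f \<and> (\<forall>\<zeta>\<in>frontier \<Theta>. 0 < f \<zeta>)"
    obtain \<zeta>1 where \<zeta>1: "\<zeta>1 \<in> frontier \<Theta>" and fmin: "\<And>\<zeta>. \<zeta> \<in> frontier \<Theta> \<Longrightarrow> f \<zeta>1 \<le> f \<zeta>"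
      using continuous_attains_inf[OF comp _ conjunct1[OF f]] zF by blast
    have f0: "0 < f 0" using f zF by blast
    show "ennreal (f 0) \<le> Liminf (at 0 within \<Theta>) (lower_perron m \<alpha> \<Theta> f)"
    proof (rule ennreal_le_epsilon)
      fix e :: real assume e: "0 < e"
      obtain r where r: "0 < r" "r \<le> r0" "\<And>\<zeta>. \<zeta> \<in> frontier \<Theta> \<Longrightarrow> norm \<zeta> < r \<Longrightarrow> \<bar>f \<zeta> - f 0\<bar> < e"
        using near[OF conjunct1[OF f] e] by blast
      \<comment> \<open>\<open>f 0 - e\<close> may be negative. The maximum with the least boundary
        value \<open>f \<zeta>1\<close>, which is also the height of the plateau, keeps the barrier
        positive and still below \<open>f\<close> near the origin.\<close>
      define A where "A = max (f \<zeta>1) (f 0 - e)"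
      have A: "0 < f \<zeta>1" "f \<zeta>1 \<le> A" using f \<zeta>1 by (auto simp: A_def)
      have fut: "0 < snd \<xi>" if "\<xi> \<in> \<Theta>" "norm \<xi> < r" for \<xi> using r0(2)[OF that(1)] that(2) r(2) by simp
      have "\<exists>u. subparabolic m \<alpha> \<Theta> (\<lambda>\<xi>. ennreal (u \<xi>)) \<and> continuous_on UNIV u \<and> u 0 = A \<and>
        (\<forall>\<xi>. u \<xi> \<le> A) \<and> (\<forall>\<xi>. r \<le> norm \<xi> \<longrightarrow> u \<xi> = f \<zeta>1)"
        by (rule lower_barrier[OF assms(2,6) r(1)]) (use fut A in auto)
      then obtain u where u: "subparabolic m \<alpha> \<Theta> (\<lambda>\<xi>. ennreal (u \<xi>))" "continuous_on UNIV u" "u 0 = A"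
        "\<And>\<xi>. u \<xi> \<le> A" "\<And>\<xi>. r \<le> norm \<xi> \<Longrightarrow> u \<xi> = f \<zeta>1"
        by blast
      have "Limsup (at \<zeta> within \<Theta>) (\<lambda>\<xi>. ennreal (u \<xi>)) \<le> ennreal (f \<zeta>)" if "\<zeta> \<in> frontier \<Theta>" for \<zeta>
      proof -
        have "u \<zeta> \<le> f \<zeta>"
        proof (cases "norm \<zeta> < r")
          case True
          then show ?thesis using r(3)[OF that True] u(4)[of \<zeta>] fmin[OF that] by (auto simp: A_def max_def split: if_splits)
        next
          case False
          then show ?thesis using u(5)[of \<zeta>] fmin[OF that] by simp
        qed
        then show ?thesis using frontier_limits(2)[OF assms(6) that u(2)] by (simp add: ennreal_leI)
      qed
      moreover have "\<exists>C::real. \<forall>\<eta>\<in>\<Theta>. ennreal (u \<eta>) \<le> ennreal C" using u(4) by (intro exI[of _ A] ballI ennreal_leI)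
      ultimately have "ennreal (u \<xi>) \<le> lower_perron m \<alpha> \<Theta> f \<xi>" for \<xi>
        unfolding lower_perron_def using u(1) by (intro SUP_upper2[of "\<lambda>\<xi>. ennreal (u \<xi>)"]) auto
      then have "Liminf (at 0 within \<Theta>) (\<lambda>\<xi>. ennreal (u \<xi>)) \<le> Liminf (at 0 within \<Theta>) (lower_perron m \<alpha> \<Theta> f)"
        by (intro Liminf_mono always_eventually allI)
      then have "ennreal A \<le> Liminf (at 0 within \<Theta>) (lower_perron m \<alpha> \<Theta> f)"
        using frontier_limits(1)[OF assms(6) zF u(2)] u(3) by simp
      moreover have "ennreal (f 0) \<le> ennreal A + ennreal e"
      proof -
        have "ennreal (f 0) \<le> ennreal (A + e)" by (rule ennreal_leI) (simp add: A_def max_def)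
        then show ?thesis using A e by simp
      qed
      ultimately show "ennreal (f 0) \<le> Liminf (at 0 within \<Theta>) (lower_perron m \<alpha> \<Theta> f) + ennreal e"
        using add_right_mono order_trans by blast
    qed
  qed
  ultimately show "regular_positive m \<alpha> \<Theta> (0, 0)" by (simp add: regular_positive_def zero_prod_def)
qed

end
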